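(* Let $\delta>0$. Then there exists a bounded, uniformly elliptic, real-valued coefficient $\mathfrak a:[0,1]\times(0,\pi)\to\mathbb R$ satisfying $$\mathfrak a\in C^{0,1/2}([0,1];L^\infty(0,\pi)),\qquad \|\mathfrak a-1\|_{C^{0,1/2}([0,1];L^\infty(0,\pi))}<\delta,$$ but $$\mathfrak a\notin C^{0,\alpha}([0,1];L^\infty(0,\pi))\qquad\text{for every }\tfrac12<\alpha<1.$$ There also exist a real-valued forcing term $f\in C([0,1];L^2(0,\pi))\cap L^2(0,1;L^2(0,\pi))$ and a real-valued function $$u\in C([0,1];V)\cap C^1([0,1];V')\cap W^{1,1}(0,1;H)$$ such that $u(0)=0$ and $u$ is the unique Lions variational solution of $$\partial_tu(t)+\mathcal A(t)u(t)=f(t)$$ in $V'$ for every $t\in[0,1]$. Moreover, $u(t)\in D(A_H(t))$ for every $t\in[0,1]$, and $$A_H(\cdot)u(\cdot)\in L^1(0,1;H),\qquad A_H(\cdot)u(\cdot)\notin L^2(0,1;H),\qquad \partial_tu\notin L^2(0,1;H).$$ In particular, maximal $L^2$-regularity cannot hold for this diffusion coefficient.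
   Context: Let $H=L^2((0,\pi);\mathbb C)$, $V=H_0^1((0,\pi);\mathbb C)$ with norm $\|v\|_V=\|\partial_xv\|_{L^2(0,\pi)}$, and let $V'=H^{-1}((0,\pi);\mathbb C)$ be the anti-dual of $V$, with pairing $\langle\cdot,\cdot\rangle_{V',V}$ linear in the first and conjugate-linear in the second argument; $V\hookrightarrow H\hookrightarrow V'$ is the usual Gelfand triple. A real-valued measurable coefficient $\mathfrak a$ is bounded and uniformly elliptic if there are constants $0<\lambda\le\Lambda<\infty$ with $\lambda\le\mathfrak a(t,x)\le\Lambda$ for a.e. $(t,x)$. For such $\mathfrak a$, the operator $\mathcal A(t):V\to V'$ is defined by $$\langle\mathcal A(t)v,w\rangle_{V',V}=\int_0^\pi\mathfrak a(t,x)\,\partial_xv(x)\,\overline{\partial_xw(x)}\,dx,\qquad v,w\in V,$$ so $\mathcal A(t)v=-\partial_x(\mathfrak a(t,\cdot)\partial_xv)$ in the sense of distributions. Its realisation in $H$ is $D(A_H(t))=\{v\in V:\mathcal A(t)v\in H\}$, $A_H(t)v=\mathcal A(t)v$. For $0<\alpha<1$ and a Banach space $X$, $C^{0,\alpha}([0,T];X)$ is the Hölder space with norm $\|g\|_{C^{0,\alpha}([0,T];X)}=\sup_{t}\|g(t)\|_X+\sup_{s\ne t}\|g(t)-g(s)\|_X/|t-s|^\alpha$. For $f\in L^2(0,1;V')$, the Lions variational solution with initial value $u(0)=u_0\in H$ is the unique $u\in L^2(0,1;V)\cap H^1(0,1;V')$ satisfying $\partial_tu+\mathcal A(t)u=f$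 in $V'$ for a.e. $t$ and $u(0)=u_0$. Maximal $L^2$-regularity (in $H$) for the coefficient means that for every $f\in L^2(0,1;H)$ the variational solution $u$ with $u(0)=0$ satisfies $\partial_tu\in L^2(0,1;H)$, $u(t)\in D(A_H(t))$ for a.e. $t$, and $A_H(\cdot)u(\cdot)\in L^2(0,1;H)$. *)

theory Defs
  imports "HOL-Analysis.Analysis" "HOL-Probability.Essential_Supremum"
begin

subsection \<open>Hilbert space preliminaries\<close>

lemma second_countable_of_dense:
  fixes D :: "'a::metric_space set"
  assumes D: "countable D" and dense: "\<And>x e. e > 0 \<Longrightarrow> \<exists>d\<in>D. dist x d < e"
  shows "\<exists>B::'a set set. countable B \<and> open = generate_topology B"
proof (intro exI conjI)
  let ?B = "(\<lambda>(d, n). ball d (1 / real (Suc n))) ` (D \<times> (UNIV :: nat set))"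
  show "countable ?B" using D by auto
  show "open = generate_topology ?B"
  proof (rule topological_basis_imp_subbasis, rule topological_basisI)
    show "open B" if "B \<in> ?B" for B using that by auto
    fix S :: "'a set" and x assume S: "open S" "x \<in> S"
    then obtain e where e: "e > 0" "ball x e \<subseteq> S" by (meson openE)
    obtain n where n: "1 / real (Suc n) < e / 2"
      using e(1) nat_approx_posE[of "e/2"] by auto
    obtain d where d: "d \<in> D" "dist x d < 1 / real (Suc n)"
      using dense[of "1 / real (Suc n)" x] by auto
    have "ball d (1 / real (Suc n)) \<subseteq> ball x e"
    proof
      fix y assume "y \<in> ball d (1 / real (Suc n))"
      then show "y \<in> ball x e"
        using d(2) n dist_triangle[of x y d] by simp
    qed
    then show "\<exists>B\<in>?B. x \<in> B \<and> B \<subseteq> S"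
      using d e(2) by (intro bexI[of _ "ball d (1 / real (Suc n))"]) (auto simp: dist_commute)
  qed
qed

lemma second_countable_surj:
  fixes f :: "'a::second_countable_topology \<Rightarrow> 'b::metric_space"
  assumes f: "continuous_on UNIV f" "surj f"
  shows "\<exists>B::'b set set. countable B \<and> open = generate_topology B"
proof -
  obtain D :: "'a set" where D: "countable D" "\<And>X. open X \<Longrightarrow> X \<noteq> {} \<Longrightarrow> \<exists>d\<in>D. d \<in> X"
    by (erule countable_dense_setE)
  show ?thesis
  proof (rule second_countable_of_dense[of "f ` D"])
    fix x and e :: real assume "e > 0"
    have "open (f -` ball x e)" using f(1) by (simp add: open_vimage)
    moreover have "f -` ball x e \<noteq> {}" using f(2) \<open>e > 0\<close>
      by (metis centre_in_ball empty_iff surjD vimageI2)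
    ultimately show "\<exists>d\<in>f ` D. dist x d < e" using D(2) by fastforce
  qed (use D in auto)
qed

lemma second_countable_isometry:
  fixes f :: "'a::metric_space \<Rightarrow> 'b::{metric_space, second_countable_topology}"
  assumes f: "\<And>x y. dist (f x) (f y) = dist x y"
  shows "\<exists>B::'a set set. countable B \<and> open = generate_topology B"
proof -
  obtain B :: "'b set set" where B: "countable B" "topological_basis B"
    using ex_countable_basis by blast
  have cont: "continuous_on UNIV f"
    by (auto simp: continuous_on_iff f)
  show ?thesis
  proof (intro exI conjI)
    show "countable ((\<lambda>U. f -` U) ` B)" using B by auto
    show "open = generate_topology ((\<lambda>U. f -` U) ` B)"
    proof (rule topological_basis_imp_subbasis, rule topological_basisI)
      show "open U" if "U \<in> (\<lambda>U. f -` U) ` B" for U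
        using that B(2) cont by (auto simp: topological_basis_open open_vimage)
      fix S :: "'a set" and x assume S: "open S" "x \<in> S"
      then obtain e where e: "e > 0" "ball x e \<subseteq> S" by (meson openE)
      then obtain U where "U \<in> B" "f x \<in> U" "U \<subseteq> ball (f x) e"
        using topological_basisE[OF B(2), of "ball (f x) e" "f x"] by auto
      then show "\<exists>B'\<in>(\<lambda>U. f -` U) ` B. x \<in> B' \<and> B' \<subseteq> S"
        using e f by (intro bexI[of _ "f -` U"]) fastforce+
    qed
  qed
qed

lemma countable_dense_span:
  fixes S :: "'a::real_normed_vector set"
  assumes S: "countable S" and dense: "closure (span S) = UNIV"
  shows "\<exists>B::'a set set. countable B \<and> open = generate_topology B"
proof (rule second_countable_of_dense)
  define D where "D = (\<lambda>xs. \<Sum>(q, s)\<leftarrow>xs. of_rat q *\<^sub>R s) ` lists ((UNIV :: rat set) \<times> S)"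
  show "countable D" unfolding D_def using S by (intro countable_image countable_lists) auto
  have 1: "\<exists>d\<in>D. dist x d < e" if "x \<in> span S" "e > 0" for x e
    using that
  proof (induction arbitrary: e rule: span_induct_alt)
    case base
    then show ?case unfolding D_def by (intro bexI[of _ 0]) (auto intro!: image_eqI[of _ _ "[]"])
  next
    case (step c x y)
    obtain d where d: "d \<in> D" "dist y d < e / 2" using step.IH[of "e/2"] step.prems by auto
    obtain q where q: "c < of_rat q" "of_rat q < c + e / (2 * (norm x + 1))"
    proof -
      have "0 < e / (2 * (norm x + 1))"
        using step.prems by (intro divide_pos_pos mult_pos_pos add_nonneg_pos) auto
      then show ?thesis using that of_rat_dense[of c "c + e / (2 * (norm x + 1))"] by auto
    qed
    obtain xs where xs: "xs \<in> lists (UNIV \<times> S)" "d = (\<Sum>(q, s)\<leftarrow>xs. of_rat q *\<^sub>R s)"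
      using d by (auto simp: D_def)
    have "of_rat q *\<^sub>R x + d \<in> D"
      unfolding D_def using xs step.hyps by (intro image_eqI[of _ _ "(q, x) # xs"]) auto
    moreover have "dist (c *\<^sub>R x + y) (of_rat q *\<^sub>R x + d) < e"
    proof -
      have "norm x * \<bar>c - of_rat q\<bar> \<le> (norm x + 1) * (e / (2 * (norm x + 1)))"
        using q by (intro mult_mono) auto
      also have "\<dots> = e / 2"
        by (simp add: field_simps add_nonneg_eq_0_iff)
      finally have *: "norm (c *\<^sub>R x - of_rat q *\<^sub>R x) \<le> e / 2"
        by (simp add: scaleR_left_diff_distrib[symmetric] mult.commute)
      have "dist (c *\<^sub>R x + y) (of_rat q *\<^sub>R x + d) = norm ((c *\<^sub>R x - of_rat q *\<^sub>R x) + (y - d))"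
        by (simp add: dist_norm algebra_simps)
      also have "\<dots> \<le> norm (c *\<^sub>R x - of_rat q *\<^sub>R x) + norm (y - d)"
        by (rule norm_triangle_ineq)
      finally show ?thesis using * d(2) by (simp add: dist_norm)
    qed
    ultimately show ?case by blast
  qed
  fix x :: 'a and e :: real assume "e > 0"
  have "x \<in> closure (span S)" using dense by simp
  then obtain y where y: "y \<in> span S" "dist y x < e / 2"
    using \<open>e > 0\<close> unfolding closure_approachable by (meson half_gt_zero)
  obtain d where "d \<in> D" "dist y d < e / 2" using 1[OF y(1), of "e/2"] \<open>e > 0\<close> by auto
  then show "\<exists>d\<in>D. dist x d < e"
    using y(2) by (metis dist_commute dist_triangle_half_l)
qed

lemma orthogonal_projection_exists:
  fixes W :: "'a::{real_inner, complete_space} set"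
  assumes W: "subspace W" "closed W"
  shows "\<exists>w\<in>W. \<forall>v\<in>W. (x - w) \<bullet> v = 0"
proof -
  have "0 \<in> W" using W(1) by (simp add: subspace_0)
  define d where "d = infdist x W"
  have dle: "d \<le> norm (x - w)" if "w \<in> W" for w
    using infdist_le[OF that, of x] by (simp add: d_def dist_norm)
  have "d \<ge> 0" by (simp add: d_def infdist_nonneg)
  have "\<exists>w\<in>W. norm (x - w) < d + 1 / real (Suc n)" for n
  proof -
    have "W \<noteq> {}" using \<open>0 \<in> W\<close> by auto
    then have "(INF a\<in>W. dist x a) < d + 1 / real (Suc n)"
      unfolding d_def by (simp add: infdist_notempty)
    then show ?thesis using \<open>W \<noteq> {}\<close> by (subst (asm) cINF_less_iff) (auto simp: dist_norm intro!: bdd_belowI2[of _ 0])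
  qed
  then obtain w where w: "\<And>n. w n \<in> W" "\<And>n. norm (x - w n) < d + 1 / real (Suc n)"
    by metis
  have par: "(norm (w m - w n))\<^sup>2 \<le> 2 * (norm (x - w m))\<^sup>2 + 2 * (norm (x - w n))\<^sup>2 - 4 * d\<^sup>2" for m n
  proof -
    have "(1/2) *\<^sub>R (w m + w n) \<in> W" using W(1) w(1) by (simp add: subspace_add subspace_scale)
    then have "d\<^sup>2 \<le> (norm (x - (1/2) *\<^sub>R (w m + w n)))\<^sup>2" using dle \<open>d \<ge> 0\<close> by (intro power_mono)
    moreover have "(norm (w m - w n))\<^sup>2 + 4 * (norm (x - (1/2) *\<^sub>R (w m + w n)))\<^sup>2
        = 2 * (norm (x - w m))\<^sup>2 + 2 * (norm (x - w n))\<^sup>2"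
      by (simp add: power2_norm_eq_inner algebra_simps inner_commute)
    ultimately show ?thesis by linarith
  qed
  have lim: "(\<lambda>n. (norm (x - w n))\<^sup>2) \<longlonglongrightarrow> d\<^sup>2"
  proof -
    have "(\<lambda>n. d + 1 / real (Suc n)) \<longlonglongrightarrow> d + 0"
      by (intro tendsto_intros LIMSEQ_Suc[OF lim_1_over_n])
    then have up: "(\<lambda>n. d + 1 / real (Suc n)) \<longlonglongrightarrow> d" by simp
    have "(\<lambda>n. norm (x - w n)) \<longlonglongrightarrow> d"
    proof (rule tendsto_sandwich[OF _ _ tendsto_const up])
      show "\<forall>\<^sub>F n in sequentially. d \<le> norm (x - w n)"
        using dle[OF w(1)] by (intro always_eventually allI)
      show "\<forall>\<^sub>F n in sequentially. norm (x - w n) \<le> d + 1 / real (Suc n)"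
        using less_imp_le[OF w(2)] by (intro always_eventually allI)
    qed
    then show ?thesis by (intro tendsto_power)
  qed
  have "Cauchy w"
  proof (rule metric_CauchyI)
    fix e :: real assume "e > 0"
    have "\<forall>\<^sub>F n in sequentially. (norm (x - w n))\<^sup>2 < d\<^sup>2 + e\<^sup>2 / 4"
      using lim \<open>e > 0\<close> by (intro order_tendstoD) auto
    then obtain N where N: "\<And>n. n \<ge> N \<Longrightarrow> (norm (x - w n))\<^sup>2 < d\<^sup>2 + e\<^sup>2 / 4"
      by (auto simp: eventually_sequentially)
    have "dist (w m) (w n) < e" if "m \<ge> N" "n \<ge> N" for m n
    proof -
      have "(norm (w m - w n))\<^sup>2 < e\<^sup>2"
        using par[of m n] N[OF that(1)] N[OF that(2)] by linarith
      then show ?thesis using \<open>e > 0\<close> by (simp add: dist_norm power_less_imp_less_base)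
    qed
    then show "\<exists>M. \<forall>m\<ge>M. \<forall>n\<ge>M. dist (w m) (w n) < e" by blast
  qed
  then obtain y where y: "w \<longlonglongrightarrow> y" by (auto simp: Cauchy_convergent_iff convergent_def)
  have yW: "y \<in> W" using W(2) w(1) y by (meson closed_sequentially)
  have "(\<lambda>n. (norm (x - w n))\<^sup>2) \<longlonglongrightarrow> (norm (x - y))\<^sup>2" by (intro tendsto_intros y)
  then have ny: "(norm (x - y))\<^sup>2 = d\<^sup>2" using lim LIMSEQ_unique by blast
  have "(x - y) \<bullet> v = 0" if v: "v \<in> W" for v
  proof -
    define c where "c = (x - y) \<bullet> v"
    have *: "2 * t * c \<le> t\<^sup>2 * (v \<bullet> v)" for t
    proof -
      have "y + t *\<^sub>R v \<in> W" using W(1) yW v by (simp add: subspace_add subspace_scale)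
      then have "d\<^sup>2 \<le> (norm (x - (y + t *\<^sub>R v)))\<^sup>2" using dle \<open>d \<ge> 0\<close> by (intro power_mono)
      then have "(norm (x - y))\<^sup>2 \<le> (norm ((x - y) - t *\<^sub>R v))\<^sup>2" by (simp add: ny algebra_simps)
      also have "\<dots> = (norm (x - y))\<^sup>2 - 2 * t * c + t\<^sup>2 * (v \<bullet> v)"
        unfolding power2_norm_eq_inner c_def
        by (simp add: inner_diff_left inner_diff_right inner_commute power2_eq_square algebra_simps)
      finally show ?thesis by simp
    qed
    have "c = 0"
    proof (rule ccontr)
      assume "c \<noteq> 0"
      define s where "s = v \<bullet> v + 1"
      have "s > 0" by (simp add: s_def add_nonneg_pos)
      have "2 * c\<^sup>2 / s \<le> (c / s)\<^sup>2 * (v \<bullet> v)" using *[of "c / s"] by (simp add: power2_eq_square)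
      also have "\<dots> \<le> (c / s)\<^sup>2 * s" by (intro mult_left_mono) (auto simp: s_def)
      also have "\<dots> = c\<^sup>2 / s" using \<open>s > 0\<close> by (simp add: power2_eq_square)
      finally have "c\<^sup>2 / s \<le> 0" by simp
      then show False using \<open>s > 0\<close> \<open>c \<noteq> 0\<close> by (simp add: divide_le_0_iff)
    qed
    then show ?thesis by (simp add: c_def)
  qed
  then show ?thesis using yW by blast
qed

lemma dense_span_of_orthogonal:
  fixes S :: "'a::{real_inner, complete_space} set"
  assumes "\<And>x. (\<And>s. s \<in> S \<Longrightarrow> x \<bullet> s = 0) \<Longrightarrow> x = 0"
  shows "closure (span S) = UNIV"
proof -
  have "x \<in> closure (span S)" for x
  proof -
    have sub: "subspace (closure (span S))"
    proof (rule subspaceI)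
      show "0 \<in> closure (span S)" using closure_subset span_zero by blast
    next
      fix x y assume "x \<in> closure (span S)" "y \<in> closure (span S)"
      then show "x + y \<in> closure (span S)"
        unfolding closure_sequential by (metis (no_types, lifting) span_add tendsto_add)
    next
      fix c x assume "x \<in> closure (span S)"
      then show "c *\<^sub>R x \<in> closure (span S)"
        unfolding closure_sequential by (metis (no_types, lifting) span_scale tendsto_scaleR tendsto_const)
    qed
    obtain w where w: "w \<in> closure (span S)" "\<forall>v\<in>closure (span S). (x - w) \<bullet> v = 0"
      using orthogonal_projection_exists[OF sub, of x] by auto
    have "x - w = 0"
      by (rule assms) (use w(2) span_superset closure_subset in blast)
    then show ?thesis using w by simp
  qed
  then show ?thesis by blast
qed

lemma riesz_representation:
  fixes l :: "'a::{real_inner, complete_space} \<Rightarrow> real"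
  assumes l: "bounded_linear l"
  shows "\<exists>v. \<forall>w. l w = v \<bullet> w"
proof (cases "\<forall>x. l x = 0")
  case True
  then show ?thesis by (intro exI[of _ 0]) auto
next
  case False
  interpret l: bounded_linear l by fact
  obtain x where x: "l x \<noteq> 0" using False by blast
  define W where "W = {v. l v = 0}"
  have W: "subspace W" by (auto simp: W_def subspace_def l.zero l.add l.scaleR)
  have "W = l -` {0}" by (auto simp: W_def)
  then have "closed W" using l.continuous_on[OF continuous_on_id]
    by (auto intro!: closed_vimage)
  then obtain w where w: "w \<in> W" "\<And>v. v \<in> W \<Longrightarrow> (x - w) \<bullet> v = 0"
    using orthogonal_projection_exists[OF W] by blast
  define z where "z = x - w"
  have z: "l z = l x" using w(1) by (simp add: z_def W_def l.diff)
  then have "z \<noteq> 0" using x l.zero by auto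
  have "l v = ((l z / (z \<bullet> z)) *\<^sub>R z) \<bullet> v" for v
  proof -
    have "v - (l v / l z) *\<^sub>R z \<in> W" using x z by (simp add: W_def l.diff l.scaleR)
    then have "z \<bullet> (v - (l v / l z) *\<^sub>R z) = 0" using w(2) by (simp add: z_def)
    then have "z \<bullet> v = (l v / l z) * (z \<bullet> z)" by (simp add: inner_diff_right)
    then show ?thesis using x z \<open>z \<noteq> 0\<close> by (simp add: field_simps)
  qed
  then show ?thesis by blast
qed

subsection \<open>Test functions and weak derivatives\<close>

definition vderiv :: "(real \<Rightarrow> 'a::real_normed_vector) \<Rightarrow> real \<Rightarrow> 'a" where
  "vderiv f = (\<lambda>x. vector_derivative f (at x))"

definition smooth :: "(real \<Rightarrow> 'a::real_normed_vector) \<Rightarrow> bool" where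
  "smooth f \<longleftrightarrow> (\<forall>n x. (vderiv ^^ n) f differentiable at x)"

definition test_function :: "real \<Rightarrow> real \<Rightarrow> (real \<Rightarrow> 'a::real_normed_vector) \<Rightarrow> bool" where
  "test_function a b \<phi> \<longleftrightarrow>
     smooth \<phi> \<and> (\<exists>K. compact K \<and> K \<subseteq> {a<..<b} \<and> (\<forall>x. x \<notin> K \<longrightarrow> \<phi> x = 0))"

text \<open>
Weak derivative on \<open>(a, b)\<close> of a vector-valued function.  Real-valued test functions suffice, also for
  complex-valued \<open>u\<close>; the integrals are Bochner integrals, so the same definition gives the spatial
  derivative and the time derivative of functions with values in \<open>H\<close> or \<open>V'\<close>.
\<close>

definition weak_deriv ::
    "real \<Rightarrow> real \<Rightarrow> (real \<Rightarrow> 'a::{banach, second_countable_topology}) \<Rightarrow> (real \<Rightarrow> 'a) \<Rightarrow> bool" where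
  "weak_deriv a b u g \<longleftrightarrow>
     (\<forall>\<phi> :: real \<Rightarrow> real. test_function a b \<phi> \<longrightarrow>
        (\<integral>t. vderiv \<phi> t *\<^sub>R u t \<partial>lebesgue_on {a<..<b}) = - (\<integral>t. \<phi> t *\<^sub>R g t \<partial>lebesgue_on {a<..<b}))"

lemma vderiv_eq: "(\<And>x. (f has_vector_derivative f' x) (at x)) \<Longrightarrow> vderiv f = f'"
  by (auto simp: vderiv_def vector_derivative_at)

lemma smoothI:
  assumes F: "\<And>f. f \<in> F \<Longrightarrow> \<exists>f'\<in>F. \<forall>x. (f has_vector_derivative f' x) (at x)" and f: "f \<in> F"
  shows "smooth f"
proof -
  have *: "(vderiv ^^ n) f \<in> F" for n
  proof (induction n)
    case (Suc n)
    then show ?case using F[OF Suc] vderiv_eq by (metis comp_apply funpow.simps(2))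
  qed (use f in auto)
  show ?thesis unfolding smooth_def
    using F[OF *] differentiableI_vector by blast
qed

lemma smooth_iter: "smooth f \<Longrightarrow> smooth ((vderiv ^^ n) f)"
  unfolding smooth_def by (metis comp_apply funpow_add)

lemma smooth_vderiv: "smooth f \<Longrightarrow> smooth (vderiv f)"
  using smooth_iter[of f 1] by simp

lemma smooth_has_vderiv: "smooth f \<Longrightarrow> (f has_vector_derivative vderiv f x) (at x)"
  unfolding smooth_def vderiv_def
  by (metis funpow_0 vector_derivative_works)

lemma smooth_continuous: "smooth f \<Longrightarrow> continuous_on S f"
  by (meson continuous_at_imp_continuous_on has_vector_derivative_continuous smooth_has_vderiv)

lemma smooth_linear:
  assumes f: "smooth f" and g: "smooth g" and A: "bounded_linear A" and B: "bounded_linear B"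
  shows "smooth (\<lambda>x. A (f x) + B (g x))"
    and "vderiv (\<lambda>x. A (f x) + B (g x)) = (\<lambda>x. A (vderiv f x) + B (vderiv g x))"
proof -
  have d: "((\<lambda>x. A (f x) + B (g x)) has_vector_derivative (A (vderiv f x) + B (vderiv g x))) (at x)"
    if "smooth f" "smooth g" for f g x
    using that A B
    by (intro has_vector_derivative_add bounded_linear.has_vector_derivative[OF A]
        bounded_linear.has_vector_derivative[OF B] smooth_has_vderiv)
  show "smooth (\<lambda>x. A (f x) + B (g x))"
  proof (rule smoothI)
    show "(\<lambda>x. A (f x) + B (g x)) \<in> {h. \<exists>f g. h = (\<lambda>x. A (f x) + B (g x)) \<and> smooth f \<and> smooth g}"
      using f g by blast
  next
    fix h assume "h \<in> {h. \<exists>f g. h = (\<lambda>x. A (f x) + B (g x)) \<and> smooth f \<and> smooth g}"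
    then obtain f g where h: "h = (\<lambda>x. A (f x) + B (g x))" "smooth f" "smooth g" by blast
    show "\<exists>f'\<in>{h. \<exists>f g. h = (\<lambda>x. A (f x) + B (g x)) \<and> smooth f \<and> smooth g}. \<forall>x. (h has_vector_derivative f' x) (at x)"
      by (rule bexI[of _ "\<lambda>x. A (vderiv f x) + B (vderiv g x)"])
         (use h d[OF h(2,3)] smooth_vderiv[OF h(2)] smooth_vderiv[OF h(3)] in blast)+
  qed
  show "vderiv (\<lambda>x. A (f x) + B (g x)) = (\<lambda>x. A (vderiv f x) + B (vderiv g x))"
    using d[OF f g] by (rule vderiv_eq)
qed

lemma smooth_zero: "smooth (\<lambda>x. 0)"
  by (rule smoothI[of "{\<lambda>x. 0}"]) auto

lemma vderiv_zero: "vderiv (\<lambda>x. 0) = (\<lambda>x. 0)"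
  by (rule vderiv_eq) auto

lemma test_function_linear:
  assumes f: "test_function a b f" and g: "test_function a b g"
    and A: "bounded_linear A" and B: "bounded_linear B"
  shows "test_function a b (\<lambda>x. A (f x) + B (g x))"
proof -
  interpret A: bounded_linear A by fact
  interpret B: bounded_linear B by fact
  obtain K L where "compact K" "K \<subseteq> {a<..<b}" "\<forall>x. x \<notin> K \<longrightarrow> f x = 0"
    "compact L" "L \<subseteq> {a<..<b}" "\<forall>x. x \<notin> L \<longrightarrow> g x = 0"
    using f g unfolding test_function_def by blast
  then show ?thesis unfolding test_function_def
    using smooth_linear(1)[OF _ _ A B, of f g] f g
    by (intro conjI exI[of _ "K \<union> L"]) (auto simp: test_function_def A.zero B.zero)
qed

lemma test_function_linear1:
  assumes f: "test_function a b f" and A: "bounded_linear A"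
  shows "test_function a b (\<lambda>x. A (f x))" "vderiv (\<lambda>x. A (f x)) = (\<lambda>x. A (vderiv f x))"
  using test_function_linear[OF f f A bounded_linear_zero]
    smooth_linear(2)[OF _ _ A bounded_linear_zero, of f f] f
  by (auto simp: test_function_def)

lemma test_function_support:
  assumes "test_function a b f" "x \<notin> {a<..<b}"
  shows "f x = 0"
  using assms by (auto simp: test_function_def)

lemma test_function_vderiv:
  assumes "test_function a b f"
  shows "test_function a b (vderiv f)"
proof -
  obtain K where K: "compact K" "K \<subseteq> {a<..<b}" "\<forall>x. x \<notin> K \<longrightarrow> f x = 0"
    using assms unfolding test_function_def by blast
  have "vderiv f x = 0" if "x \<notin> K" for x
  proof -
    have "open (- K)" using K(1) by (simp add: compact_imp_closed open_Compl)
    have "((\<lambda>x. 0) has_vector_derivative 0) (at x)" by simp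
    then have "(f has_vector_derivative 0) (at x)"
      by (rule has_vector_derivative_transform_within_open[OF _ \<open>open (-K)\<close>]) (use that K in auto)
    then show ?thesis by (simp add: vderiv_def vector_derivative_at)
  qed
  then show ?thesis using assms K smooth_vderiv unfolding test_function_def by blast
qed

lemma test_function_bounded:
  fixes f :: "real \<Rightarrow> 'a::real_normed_vector"
  assumes "test_function a b f"
  obtains B where "0 < B" "\<And>x. norm (f x) \<le> B"
proof -
  have "continuous_on {a..b} f"
    using assms smooth_continuous unfolding test_function_def by blast
  then have "bounded (f ` {a..b})"
    by (intro compact_imp_bounded compact_continuous_image) auto
  then obtain B where B: "B > 0" "\<And>x. x \<in> {a..b} \<Longrightarrow> norm (f x) \<le> B"
    by (metis bounded_pos image_eqI)
  moreover have "f x = 0" if "x \<notin> {a..b}" for x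
    using test_function_support[OF assms, of x] that by auto
  ultimately show ?thesis using that[of B]
    by (metis less_eq_real_def norm_zero)
qed

lemma continuous_measurable_on:
  fixes f :: "real \<Rightarrow> 'a::{banach, second_countable_topology}"
  assumes "continuous_on UNIV f"
  shows "f \<in> borel_measurable (lebesgue_on S)"
proof -
  have "f \<in> borel_measurable lborel"
    using borel_measurable_continuous_onI[OF assms] by simp
  then show ?thesis by (intro measurable_restrict_space1 measurable_completion)
qed

lemma smooth_measurable:
  fixes f :: "real \<Rightarrow> 'a::{banach, second_countable_topology}"
  assumes "smooth f"
  shows "f \<in> borel_measurable (lebesgue_on S)"
  using assms smooth_continuous continuous_measurable_on by blast

subsection \<open>Bump functions\<close>

definition bump1 :: "real poly \<Rightarrow> real \<Rightarrow> real \<Rightarrow> real" where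
  "bump1 P k x = (if 0 < x then poly P (1 / x) * exp (- k / x) else 0)"

lemma poly_exp_tendsto:
  assumes "k > 0"
  shows "((\<lambda>y::real. poly P y * exp (- (k * y))) \<longlongrightarrow> 0) at_top"
proof -
  have 1: "((\<lambda>y::real. y ^ m * exp (- (k * y))) \<longlongrightarrow> 0) at_top" for m
  proof -
    have "filterlim (\<lambda>y. k * y) at_top at_top"
      using assms by (simp add: filterlim_at_top_mult_tendsto_pos filterlim_ident filterlim_tendsto_pos_mult_at_top[OF tendsto_const])
    from filterlim_compose[OF tendsto_power_div_exp_0 this]
    have "((\<lambda>y. (k * y) ^ m / exp (k * y)) \<longlongrightarrow> 0) at_top" .
    from tendsto_mult[OF tendsto_const[of "1 / k ^ m"] this]
    show ?thesis using assms by (simp add: field_simps exp_minus power_mult_distrib)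
  qed
  have "((\<lambda>y. \<Sum>i\<le>degree P. coeff P i * (y ^ i * exp (- (k * y)))) \<longlongrightarrow> (\<Sum>i\<le>degree P. coeff P i * 0)) at_top"
    by (intro tendsto_sum tendsto_mult tendsto_const 1)
  then show ?thesis
    by (simp add: poly_altdef sum_distrib_right mult.assoc)
qed

lemma bump1_deriv:
  assumes k: "k > 0"
  shows "(bump1 P k has_vector_derivative bump1 ([:0, 0, 1:] * (smult k P - pderiv P)) k x) (at x)"
    (is "(_ has_vector_derivative bump1 ?Q k x) _")
proof -
  consider "x < 0" | "x = 0" | "x > 0" by linarith
  then show ?thesis
  proof cases
    case 1
    have "((\<lambda>x. 0) has_vector_derivative bump1 ?Q k x) (at x)"
      using 1 by (simp add: bump1_def)
    then show ?thesis
      by (rule has_vector_derivative_transform_within_open[where S="{..<0}"])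
         (use 1 in \<open>auto simp: bump1_def\<close>)
  next
    case 3
    have "((\<lambda>x. poly P (1 / x) * exp (- k / x)) has_field_derivative
        poly ?Q (1 / x) * exp (- k / x)) (at x)"
      using 3
      apply -
      apply (rule derivative_eq_intros refl poly_DERIV DERIV_chain2[where f="poly P"] | simp)+
      by (simp add: field_simps power2_eq_square)
    then have "((\<lambda>x. poly P (1 / x) * exp (- k / x)) has_vector_derivative bump1 ?Q k x) (at x)"
      using 3 by (simp add: bump1_def has_real_derivative_iff_has_vector_derivative)
    then show ?thesis
      by (rule has_vector_derivative_transform_within_open[where S="{0<..}"])
         (use 3 in \<open>auto simp: bump1_def\<close>)
  next
    case 2
    have "((\<lambda>y. poly (pCons 0 P) y * exp (- (k * y))) \<longlongrightarrow> 0) at_top"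
      by (rule poly_exp_tendsto[OF k])
    from filterlim_compose[OF this filterlim_inverse_at_top_right]
    have "((\<lambda>h. poly (pCons 0 P) (inverse h) * exp (- (k * inverse h))) \<longlongrightarrow> 0) (at_right 0)" .
    then have "((\<lambda>h. bump1 P k h / h) \<longlongrightarrow> 0) (at_right 0)"
      by (rule Lim_transform_eventually)
         (auto simp: eventually_at_filter bump1_def field_simps)
    moreover have "((\<lambda>h. bump1 P k h / h) \<longlongrightarrow> 0) (at_left 0)"
      by (rule Lim_transform_eventually[OF tendsto_const])
         (auto simp: eventually_at_filter bump1_def)
    ultimately have "((\<lambda>h. bump1 P k h / h) \<longlongrightarrow> 0) (at 0)"
      by (simp add: filterlim_at_split)
    then have "(bump1 P k has_field_derivative 0) (at 0)"
      by (simp add: DERIV_def bump1_def)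
    then show ?thesis using 2
      by (simp add: bump1_def has_real_derivative_iff_has_vector_derivative)
  qed
qed

definition bump :: "nat \<Rightarrow> real \<Rightarrow> real \<Rightarrow> real \<Rightarrow> real" where
  "bump n c d x = bump1 1 (1 / Suc n) (x - c) * bump1 1 (1 / Suc n) (d - x)"

inductive_set bump_alg :: "real \<Rightarrow> real \<Rightarrow> real \<Rightarrow> (real \<Rightarrow> real) set" for k c d where
  "(\<lambda>x. bump1 P k (x - c) * bump1 Q k (d - x)) \<in> bump_alg k c d"
| "f \<in> bump_alg k c d \<Longrightarrow> g \<in> bump_alg k c d \<Longrightarrow> (\<lambda>x. f x + g x) \<in> bump_alg k c d"

lemma bump1_minus: "bump1 (- P) k x = - bump1 P k x"
  by (simp add: bump1_def)

lemma bump_alg_deriv: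
  assumes k: "k > 0" and f: "f \<in> bump_alg k c d"
  shows "\<exists>f'\<in>bump_alg k c d. \<forall>x. (f has_vector_derivative f' x) (at x)"
  using f
proof induction
  case (1 P Q)
  define P' where "P' = [:0, 0, 1:] * (smult k P - pderiv P)"
  define Q' where "Q' = - ([:0, 0, 1:] * (smult k Q - pderiv Q))"
  have P: "(bump1 P k has_real_derivative bump1 P' k x) (at x)" for x
    using bump1_deriv[OF k, of P x] by (simp add: P'_def has_real_derivative_iff_has_vector_derivative)
  have Q: "(bump1 Q k has_real_derivative - bump1 Q' k x) (at x)" for x
    using bump1_deriv[OF k, of Q x]
    by (simp add: Q'_def bump1_minus has_real_derivative_iff_has_vector_derivative del: mult_pCons_left)
  have "((\<lambda>x. bump1 P k (x - c) * bump1 Q k (d - x)) has_real_derivative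
     (bump1 P' k (x - c) * bump1 Q k (d - x) + bump1 P k (x - c) * bump1 Q' k (d - x))) (at x)" for x
    by (rule derivative_eq_intros DERIV_chain2[OF P] DERIV_chain2[OF Q] refl | simp)+
  then show ?case
    by (intro bexI[of _ "\<lambda>x. bump1 P' k (x - c) * bump1 Q k (d - x) + bump1 P k (x - c) * bump1 Q' k (d - x)"])
       (auto intro!: bump_alg.intros simp: has_real_derivative_iff_has_vector_derivative)
next
  case (2 f g)
  then show ?case
    by (metis (mono_tags, lifting) bump_alg.intros(2) has_vector_derivative_add)
qed

lemma test_function_bump:
  assumes "a < c" "d < b"
  shows "test_function a b (bump n c d)"
  unfolding test_function_def
proof (intro conjI exI)
  show "smooth (bump n c d)"
    by (rule smoothI[OF bump_alg_deriv[of "1 / Suc n" _ c d]])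
       (auto simp: bump_def[abs_def] intro: bump_alg.intros)
  show "compact {c..d}" "{c..d} \<subseteq> {a<..<b}" using assms by auto
  show "\<forall>x. x \<notin> {c..d} \<longrightarrow> bump n c d x = 0" by (auto simp: bump_def bump1_def)
qed

lemma bump_bounds: "0 \<le> bump n c d x" "bump n c d x \<le> 1"
  by (auto simp: bump_def bump1_def intro!: mult_le_one)

lemma bump_tendsto: "(\<lambda>n. bump n c d x) \<longlonglongrightarrow> indicator {c<..<d} x"
proof -
  have 1: "(\<lambda>n. bump1 1 (1 / Suc n) y) \<longlonglongrightarrow> (if 0 < y then 1 else 0)" for y
  proof (cases "0 < y")
    case True
    have "(\<lambda>n. exp (- ((1 / real (Suc n)) * (1/y)))) \<longlonglongrightarrow> exp (- (0 * (1/y)))"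
      by (intro tendsto_intros LIMSEQ_Suc[OF lim_1_over_n])
    then show ?thesis using True by (simp add: bump1_def)
  qed (simp add: bump1_def)
  have "(\<lambda>n. bump n c d x) \<longlonglongrightarrow> (if 0 < x - c then 1 else 0) * (if 0 < d - x then 1 else 0)"
    unfolding bump_def by (intro tendsto_mult 1)
  then show ?thesis by (simp add: indicator_def split: if_splits)
qed

subsection \<open>The fundamental lemma of the calculus of variations\<close>

lemma AE_zero_of_intervals:
  fixes g :: "real \<Rightarrow> 'a::{banach, second_countable_topology}"
  assumes g: "integrable (lebesgue_on {a<..<b}) g"
    and 0: "\<And>c d. c \<in> \<rat> \<Longrightarrow> d \<in> \<rat> \<Longrightarrow> a < c \<Longrightarrow> c < d \<Longrightarrow> d < b \<Longrightarrow> (\<integral>x. indicator {c<..<d} x *\<^sub>R g x \<partial>lebesgue_on {a<..<b}) = 0"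
  shows "AE x in lebesgue_on {a<..<b}. g x = 0"
proof (cases "a < b")
  case False
  then show ?thesis by (auto intro!: AE_I2)
next
  case ab: True
  let ?M = "lebesgue_on {a<..<b}"
  have meas: "A \<inter> {a<..<b} \<in> sets ?M" if "A \<in> sets borel" for A
    using that by (auto simp: sets_restrict_space_iff)
  have int: "integrable ?M (\<lambda>x. indicator A x *\<^sub>R g x)" if "A \<in> sets borel" for A
  proof -
    have "integrable ?M (\<lambda>x. indicator (A \<inter> {a<..<b}) x *\<^sub>R g x)"
      using meas[OF that] g by (rule integrable_mult_indicator)
    then show ?thesis
      by (rule Bochner_Integration.integrable_cong[THEN iffD1, rotated -1]) (auto simp: indicator_def)
  qed
  have 1: "(\<integral>x. indicator {c<..<d} x *\<^sub>R g x \<partial>?M) = 0" for c d :: real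
  proof -
    show ?thesis
    proof (cases "max c a < min d b")
      case False
      have "(\<integral>x. indicator {c<..<d} x *\<^sub>R g x \<partial>?M) = (\<integral>x. 0 \<partial>?M)"
        using False by (intro Bochner_Integration.integral_cong) (auto simp: indicator_def)
      then show ?thesis by simp
    next
      case True
    have "\<exists>q\<in>\<rat>. max c a < q \<and> q < max c a + 1 / real (Suc n)" for n
      by (rule Rats_dense_in_real) simp
    then obtain c' where c': "\<And>n. c' n \<in> \<rat>" "\<And>n. max c a < c' n" "\<And>n. c' n < max c a + 1 / real (Suc n)"
      by metis
    have "\<exists>q\<in>\<rat>. min d b - 1 / real (Suc n) < q \<and> q < min d b" for n
    proof (rule Rats_dense_in_real)
      have "0 < 1 / real (Suc n)" by simp
      then show "min d b - 1 / real (Suc n) < min d b" by linarith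
    qed
    then obtain d' where d': "\<And>n. d' n \<in> \<rat>" "\<And>n. min d b - 1 / real (Suc n) < d' n" "\<And>n. d' n < min d b"
      by metis
    have "(\<lambda>n. max c a + 1 / real (Suc n)) \<longlonglongrightarrow> max c a + 0"
      by (intro tendsto_intros LIMSEQ_Suc[OF lim_1_over_n])
    then have up: "(\<lambda>n. max c a + 1 / real (Suc n)) \<longlonglongrightarrow> max c a" by simp
    have c: "c' \<longlonglongrightarrow> max c a"
    proof (rule tendsto_sandwich[OF _ _ tendsto_const up])
      show "\<forall>\<^sub>F n in sequentially. max c a \<le> c' n"
        using less_imp_le[OF c'(2)] by (intro always_eventually allI)
      show "\<forall>\<^sub>F n in sequentially. c' n \<le> max c a + 1 / real (Suc n)"
        using less_imp_le[OF c'(3)] by (intro always_eventually allI)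
    qed
    have "(\<lambda>n. min d b - 1 / real (Suc n)) \<longlonglongrightarrow> min d b - 0"
      by (intro tendsto_intros LIMSEQ_Suc[OF lim_1_over_n])
    then have lo: "(\<lambda>n. min d b - 1 / real (Suc n)) \<longlonglongrightarrow> min d b" by simp
    have d: "d' \<longlonglongrightarrow> min d b"
    proof (rule tendsto_sandwich[OF _ _ lo tendsto_const])
      show "\<forall>\<^sub>F n in sequentially. min d b - 1 / real (Suc n) \<le> d' n"
        using less_imp_le[OF d'(2)] by (intro always_eventually allI)
      show "\<forall>\<^sub>F n in sequentially. d' n \<le> min d b"
        using less_imp_le[OF d'(3)] by (intro always_eventually allI)
    qed
    have "(\<lambda>n. \<integral>x. indicator {c' n<..<d' n} x *\<^sub>R g x \<partial>?M) \<longlonglongrightarrow> (\<integral>x. indicator {c<..<d} x *\<^sub>R g x \<partial>?M)"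
    proof (rule integral_dominated_convergence[where w="\<lambda>x. norm (g x)"])
      show "AE x in ?M. (\<lambda>n. indicator {c' n<..<d' n} x *\<^sub>R g x) \<longlonglongrightarrow> indicator {c<..<d} x *\<^sub>R g x"
      proof (rule AE_I2)
        fix x assume "x \<in> space ?M"
        then have x: "a < x" "x < b" by auto
        show "(\<lambda>n. indicator {c' n<..<d' n} x *\<^sub>R g x) \<longlonglongrightarrow> indicator {c<..<d} x *\<^sub>R g x"
        proof (cases "x \<in> {c<..<d}")
          case True
          have "\<forall>\<^sub>F n in sequentially. c' n < x" "\<forall>\<^sub>F n in sequentially. x < d' n"
            using order_tendstoD(2)[OF c, of x] order_tendstoD(1)[OF d, of x] True x by auto
          then have "\<forall>\<^sub>F n in sequentially. indicator {c<..<d} x *\<^sub>R g x = indicator {c' n<..<d' n} x *\<^sub>R g x"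
            by eventually_elim (use True in auto)
          then show ?thesis by (rule Lim_transform_eventually[OF tendsto_const])
        next
          case False
          then have "x \<notin> {c' n<..<d' n}" for n using c'(2)[of n] d'(3)[of n] x by auto
          then show ?thesis using False by simp
        qed
      qed
    next
      show "(\<lambda>x. indicator {c<..<d} x *\<^sub>R g x) \<in> borel_measurable ?M"
        "(\<lambda>x. indicator {c' n<..<d' n} x *\<^sub>R g x) \<in> borel_measurable ?M" for n
        by (intro borel_measurable_integrable int; simp)+
    qed (use g in \<open>auto simp: indicator_def intro!: AE_I2\<close>)
    moreover have "(\<integral>x. indicator {c' n<..<d' n} x *\<^sub>R g x \<partial>?M) = 0" for n
    proof (cases "c' n < d' n")
      case True
      have "a < c' n" "d' n < b" using c'(2)[of n] d'(3)[of n] by auto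
      then show ?thesis using True c'(1) d'(1) by (intro 0) 
    qed simp
    ultimately show ?thesis by (simp add: LIMSEQ_unique)
    qed
  qed
  have 2: "(\<integral>x. indicator A x *\<^sub>R g x \<partial>?M) = 0" if "A \<in> sets borel" for A
  proof -
    have UN: "(\<integral>x. indicator (\<Union>i. F i) x *\<^sub>R g x \<partial>?M) = 0"
      if F: "range F \<subseteq> sets borel" "disjoint_family F"
        "\<And>i::nat. (\<integral>x. indicator (F i) x *\<^sub>R g x \<partial>?M) = 0" for F
    proof -
      have "(\<lambda>n. \<integral>x. indicator (\<Union>i<n. F i) x *\<^sub>R g x \<partial>?M) \<longlonglongrightarrow> (\<integral>x. indicator (\<Union>i. F i) x *\<^sub>R g x \<partial>?M)"
      proof (rule integral_dominated_convergence[where w="\<lambda>x. norm (g x)"])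
        show "AE x in ?M. (\<lambda>n. indicator (\<Union>i<n. F i) x *\<^sub>R g x) \<longlonglongrightarrow> indicator (\<Union>i. F i) x *\<^sub>R g x"
          by (intro AE_I2 tendsto_scaleR tendsto_const LIMSEQ_indicator_UN)
      next
        show "(\<lambda>x. indicator (\<Union>i<n. F i) x *\<^sub>R g x) \<in> borel_measurable ?M" for n
          using F by (intro borel_measurable_integrable int) auto
        show "(\<lambda>x. indicator (\<Union>i. F i) x *\<^sub>R g x) \<in> borel_measurable ?M"
          using F by (intro borel_measurable_integrable int) auto
      qed (use g in \<open>auto simp: indicator_def intro!: AE_I2\<close>)
      moreover have "(\<integral>x. indicator (\<Union>i<n. F i) x *\<^sub>R g x \<partial>?M) = 0" for n
      proof -
        have "indicator (\<Union>i<n. F i) x = (\<Sum>i<n. indicator (F i) x :: real)" for x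
          using F(2) by (subst indicator_UN_disjoint) (auto simp: disjoint_family_on_def)
        then have "(\<integral>x. indicator (\<Union>i<n. F i) x *\<^sub>R g x \<partial>?M) = (\<integral>x. (\<Sum>i<n. indicator (F i) x *\<^sub>R g x) \<partial>?M)"
          by (simp add: scaleR_sum_left)
        also have "\<dots> = (\<Sum>i<n. (\<integral>x. indicator (F i) x *\<^sub>R g x \<partial>?M))"
          using F by (intro Bochner_Integration.integral_sum int) auto
        finally show ?thesis using F by simp
      qed
      ultimately show ?thesis by (simp add: LIMSEQ_unique)
    qed
    have univ: "(\<integral>x. g x \<partial>?M) = 0"
    proof -
      have "(\<integral>x. indicator {a<..<b} x *\<^sub>R g x \<partial>?M) = (\<integral>x. g x \<partial>?M)"
        by (rule Bochner_Integration.integral_cong) auto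
      then show ?thesis using 1 by simp
    qed
    have bor: "sets (borel :: real measure) = sigma_sets UNIV (range (\<lambda>(c, d). {c<..<d::real}))"
    proof -
      have "(\<lambda>(c, d). box c d) = (\<lambda>(c, d). {c<..<d::real})" by (auto simp: box_real)
      then have "(borel :: real measure) = sigma UNIV (range (\<lambda>(c, d). {c<..<d}))"
        using borel_eq_box[where ?'a = real] by argo
      then have "sets (borel :: real measure) = sets (sigma UNIV (range (\<lambda>(c, d). {c<..<d::real})))"
        by (rule arg_cong)
      also have "\<dots> = sigma_sets UNIV (range (\<lambda>(c, d). {c<..<d::real}))"
        by (rule sets_measure_of) simp
      finally show ?thesis .
    qed
    have st: "Int_stable (range (\<lambda>(c, d). {c<..<d::real}))"
      by (auto simp: Int_stable_def) 
    have "A \<in> sigma_sets UNIV (range (\<lambda>(c, d). {c<..<d::real}))"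
      using that by (simp add: bor)
    note A = this
    have R: "range (\<lambda>(c, d). {c<..<d::real}) \<subseteq> Pow UNIV" by simp
    from R A show ?thesis
    proof (induction A rule: sigma_sets_induct_disjoint[OF st, consumes 2, case_names basic empty compl union])
      case (compl A)
      have A: "A \<in> sets borel" using compl(1) by (simp add: bor)
      have "(\<integral>x. indicator (UNIV - A) x *\<^sub>R g x \<partial>?M) = (\<integral>x. g x - indicator A x *\<^sub>R g x \<partial>?M)"
        by (rule Bochner_Integration.integral_cong) (auto simp: indicator_def)
      then show ?case using A int[OF A] g compl univ by simp
    next
      case (union F)
      then show ?case by (intro UN) (auto simp: bor)
    qed (use 1 in auto)
  qed
  interpret finite_measure ?M by (rule finite_measure_lebesgue_on) simp
  show ?thesis
  proof (rule density_zero[OF g])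
    fix A assume "A \<in> sets ?M"
    then have A: "A \<in> sets lebesgue" "A \<subseteq> {a<..<b}" by (auto simp: sets_restrict_space_iff)
    define B where "B = main_part lborel A"
    have B: "B \<in> sets borel"
      using main_part_sets[OF A(1)] by (simp add: B_def)
    have "AE x in lebesgue. x \<notin> null_part lborel A"
      using AE_notin_null_part[OF A(1)] by (rule AE_completion)
    then have "AE x in ?M. x \<notin> null_part lborel A"
      by (subst AE_restrict_space_iff) auto
    then have "AE x in ?M. indicator A x *\<^sub>R g x = indicator B x *\<^sub>R g x"
    proof eventually_elim
      case (elim x)
      then have "x \<in> A \<longleftrightarrow> x \<in> B"
        using main_part_null_part_Un[OF A(1)] unfolding B_def by blast
      then show ?case by (simp add: indicator_def)
    qed
    then have "(\<integral>x. indicator A x *\<^sub>R g x \<partial>?M) = (\<integral>x. indicator B x *\<^sub>R g x \<partial>?M)"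
      using integrable_mult_indicator[OF \<open>A \<in> sets ?M\<close> g] int[OF B]
      by (intro integral_cong_AE borel_measurable_integrable)
    then show "set_lebesgue_integral ?M A g = 0"
      using 2[OF B] by (simp add: set_lebesgue_integral_def)
  qed
qed

lemma AE_zero_of_test_functions:
  fixes g :: "real \<Rightarrow> 'a::{banach, second_countable_topology}"
  assumes g: "integrable (lebesgue_on {a<..<b}) g"
    and 0: "\<And>\<phi>::real \<Rightarrow> real. test_function a b \<phi> \<Longrightarrow> (\<integral>x. \<phi> x *\<^sub>R g x \<partial>lebesgue_on {a<..<b}) = 0"
  shows "AE x in lebesgue_on {a<..<b}. g x = 0"
proof (rule AE_zero_of_intervals[OF g])
  let ?M = "lebesgue_on {a<..<b}"
  fix c d assume cd: "a < c" "c < d" "d < b"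
  have "(\<lambda>n. \<integral>x. bump n c d x *\<^sub>R g x \<partial>?M) \<longlonglongrightarrow> (\<integral>x. indicator {c<..<d} x *\<^sub>R g x \<partial>?M)"
  proof (rule integral_dominated_convergence[where w="\<lambda>x. norm (g x)"])
    have m: "bump n c d \<in> borel_measurable ?M" for n
      using test_function_bump[OF cd(1,3), of n] by (intro smooth_measurable) (auto simp: test_function_def)
    then show "(\<lambda>x. bump n c d x *\<^sub>R g x) \<in> borel_measurable ?M" for n
      using g by (intro borel_measurable_scaleR) auto
    have "(indicator {c<..<d} :: real \<Rightarrow> real) \<in> borel_measurable ?M"
      by (intro measurable_restrict_space1 measurable_completion) simp
    then show "(\<lambda>x. indicator {c<..<d} x *\<^sub>R g x) \<in> borel_measurable ?M"
      using g by (intro borel_measurable_scaleR) auto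
    show "AE x in ?M. (\<lambda>n. bump n c d x *\<^sub>R g x) \<longlonglongrightarrow> indicator {c<..<d} x *\<^sub>R g x"
      by (intro AE_I2 tendsto_scaleR tendsto_const bump_tendsto)
    show "AE x in ?M. norm (bump n c d x *\<^sub>R g x) \<le> norm (g x)" for n
      using bump_bounds by (auto intro!: mult_left_le_one_le)
  qed (use g in auto)
  then show "(\<integral>x. indicator {c<..<d} x *\<^sub>R g x \<partial>?M) = 0"
    using 0[OF test_function_bump[OF cd(1,3)]] by (simp add: LIMSEQ_const_iff)
qed

subsection \<open>The space \<open>H = L\<^sup>2((0,\<pi>); \<complex>)\<close>\<close>

text \<open>
Elements of \<open>H = L\<^sup>2((0,\<pi>); \<complex>)\<close> are classes of Lebesgue measurable functions modulo equality a.e.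
\<close>

abbreviation Om :: "real measure" where "Om \<equiv> lebesgue_on {0<..<pi}"

definition square_integrable :: "(real \<Rightarrow> complex) \<Rightarrow> bool" where
  "square_integrable f \<longleftrightarrow> f \<in> borel_measurable Om \<and> integrable Om (\<lambda>x. (cmod (f x))\<^sup>2)"

definition L2_rel :: "(real \<Rightarrow> complex) \<Rightarrow> (real \<Rightarrow> complex) \<Rightarrow> bool" where
  "L2_rel f g \<longleftrightarrow> square_integrable f \<and> square_integrable g \<and> (AE x in Om. f x = g x)"

lemma finite_measure_Om: "finite_measure Om"
  by (rule finite_measure_lebesgue_on) simp

lemma measure_Om: "measure Om {0<..<pi} = pi"
  by (simp add: measure_restrict_space)

lemma square_integrable_zero: "square_integrable (\<lambda>x. 0)"
  by (simp add: square_integrable_def)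

lemma square_integrable_add:
  assumes "square_integrable f" "square_integrable g"
  shows "square_integrable (\<lambda>x. f x + g x)"
proof -
  have m: "f \<in> borel_measurable Om" "g \<in> borel_measurable Om"
    using assms by (auto simp: square_integrable_def)
  have "integrable Om (\<lambda>x. (cmod (f x + g x))\<^sup>2)"
  proof (rule Bochner_Integration.integrable_bound)
    show "integrable Om (\<lambda>x. 2 * (cmod (f x))\<^sup>2 + 2 * (cmod (g x))\<^sup>2)"
      using assms by (auto simp: square_integrable_def)
    have "(cmod (f x + g x))\<^sup>2 \<le> 2 * (cmod (f x))\<^sup>2 + 2 * (cmod (g x))\<^sup>2" for x
    proof -
      have "(cmod (f x + g x))\<^sup>2 \<le> (cmod (f x) + cmod (g x))\<^sup>2"
        by (intro power_mono norm_triangle_ineq) auto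
      also have "\<dots> \<le> 2 * (cmod (f x))\<^sup>2 + 2 * (cmod (g x))\<^sup>2"
        using sum_squares_bound[of "cmod (f x)" "cmod (g x)"] by (simp add: power2_sum)
      finally show ?thesis .
    qed
    then show "AE x in Om. norm ((cmod (f x + g x))\<^sup>2) \<le> norm (2 * (cmod (f x))\<^sup>2 + 2 * (cmod (g x))\<^sup>2)"
      by (intro AE_I2) (simp add: order_trans[OF _ abs_ge_self])
  qed (use m in measurable)
  then show ?thesis using m by (simp add: square_integrable_def)
qed

lemma square_integrable_mult:
  assumes "square_integrable f" and b: "b \<in> borel_measurable Om" "AE x in Om. cmod (b x) \<le> C"
  shows "square_integrable (\<lambda>x. b x * f x)"
proof -
  have m: "f \<in> borel_measurable Om" using assms by (auto simp: square_integrable_def)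
  have "integrable Om (\<lambda>x. (cmod (b x * f x))\<^sup>2)"
  proof (rule Bochner_Integration.integrable_bound)
    show "integrable Om (\<lambda>x. C\<^sup>2 * (cmod (f x))\<^sup>2)"
      using assms by (auto simp: square_integrable_def)
    show "AE x in Om. norm ((cmod (b x * f x))\<^sup>2) \<le> norm (C\<^sup>2 * (cmod (f x))\<^sup>2)"
      using b(2) by eventually_elim
        (auto simp: norm_mult power_mult_distrib intro!: mult_right_mono power_mono)
  qed (use m b in measurable)
  then show ?thesis using m b by (simp add: square_integrable_def)
qed

lemma square_integrable_cmult: "square_integrable f \<Longrightarrow> square_integrable (\<lambda>x. c * f x)"
  by (rule square_integrable_mult[where C = "cmod c"]) auto

lemma square_integrable_scaleR: "square_integrable f \<Longrightarrow> square_integrable (\<lambda>x. c *\<^sub>R f x)"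
  using square_integrable_cmult[of f "of_real c"] by (simp add: scaleR_conv_of_real)

lemma square_integrable_diff:
  "square_integrable f \<Longrightarrow> square_integrable g \<Longrightarrow> square_integrable (\<lambda>x. f x - g x)"
  using square_integrable_add[of f "\<lambda>x. - 1 * g x"] square_integrable_cmult[of g "-1"] by simp

lemma square_integrable_prod:
  assumes "square_integrable f" "square_integrable g"
  shows "integrable Om (\<lambda>x. f x * cnj (g x))" "integrable Om (\<lambda>x. f x \<bullet> g x)"
proof -
  have m: "f \<in> borel_measurable Om" "g \<in> borel_measurable Om"
    using assms by (auto simp: square_integrable_def)
  have int: "integrable Om (\<lambda>x. (cmod (f x))\<^sup>2 + (cmod (g x))\<^sup>2)"
    using assms by (auto simp: square_integrable_def)
  have *: "cmod (f x) * cmod (g x) \<le> (cmod (f x))\<^sup>2 + (cmod (g x))\<^sup>2" for x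
    using sum_squares_bound[of "cmod (f x)" "cmod (g x)"]
      mult_nonneg_nonneg[OF norm_ge_zero[of "f x"] norm_ge_zero[of "g x"]] by linarith
  show "integrable Om (\<lambda>x. f x * cnj (g x))"
  proof (rule Bochner_Integration.integrable_bound[OF int])
    have "(\<lambda>x. cnj (g x)) \<in> borel_measurable Om"
      using m(2) by (intro borel_measurable_continuous_on[of cnj] continuous_intros)
    then show "(\<lambda>x. f x * cnj (g x)) \<in> borel_measurable Om" using m by measurable
  qed (use * in \<open>auto simp: norm_mult intro!: AE_I2\<close>)
  show "integrable Om (\<lambda>x. f x \<bullet> g x)"
  proof (rule Bochner_Integration.integrable_bound[OF int])
    show "(\<lambda>x. f x \<bullet> g x) \<in> borel_measurable Om" using m by measurable
    show "AE x in Om. norm (f x \<bullet> g x) \<le> norm ((cmod (f x))\<^sup>2 + (cmod (g x))\<^sup>2)"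
      using * Cauchy_Schwarz_ineq2[of "f x" "g x" for x]
      by (intro AE_I2) (auto intro: order_trans)
  qed
qed

quotient_type L2 = "real \<Rightarrow> complex" / partial: L2_rel
proof (rule part_equivpI)
  show "\<exists>f. L2_rel f f"
    by (rule exI[of _ "\<lambda>x. 0"]) (simp add: L2_rel_def square_integrable_zero)
  show "symp L2_rel"
    unfolding symp_def L2_rel_def by (auto simp: eq_commute)
  show "transp L2_rel"
    unfolding transp_def L2_rel_def by (auto elim: AE_mp)
qed

lemma L2_relD:
  assumes "L2_rel f g"
  shows "square_integrable f" "square_integrable g" "AE x in Om. f x = g x"
    "f \<in> borel_measurable Om" "g \<in> borel_measurable Om"
  using assms by (auto simp: L2_rel_def square_integrable_def)

instantiation L2 :: real_vector
begin

lift_definition zero_L2 :: L2 is "\<lambda>x. 0"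
  by (simp add: L2_rel_def square_integrable_zero)

lift_definition plus_L2 :: "L2 \<Rightarrow> L2 \<Rightarrow> L2" is "\<lambda>f g x. f x + g x"
  unfolding L2_rel_def by (auto intro: square_integrable_add elim!: AE_mp)

lift_definition minus_L2 :: "L2 \<Rightarrow> L2 \<Rightarrow> L2" is "\<lambda>f g x. f x - g x"
  unfolding L2_rel_def by (auto intro: square_integrable_diff elim!: AE_mp)

lift_definition uminus_L2 :: "L2 \<Rightarrow> L2" is "\<lambda>f x. - f x"
  unfolding L2_rel_def using square_integrable_cmult[of _ "-1"] by auto

lift_definition scaleR_L2 :: "real \<Rightarrow> L2 \<Rightarrow> L2" is "\<lambda>c f x. c *\<^sub>R f x"
  unfolding L2_rel_def by (auto intro: square_integrable_scaleR elim!: AE_mp)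

instance
proof
  fix f g h :: L2 and r s :: real
  note sq = square_integrable_add square_integrable_diff square_integrable_scaleR square_integrable_zero
  show "f + g + h = f + (g + h)"
    by transfer (auto simp: L2_rel_def algebra_simps intro!: sq)
  show "f + g = g + f"
    by transfer (auto simp: L2_rel_def algebra_simps intro!: sq)
  show "0 + f = f"
    by transfer (auto simp: L2_rel_def algebra_simps intro!: sq)
  show "- f + f = 0"
    by transfer (auto simp: L2_rel_def algebra_simps intro!: sq)
  show "f - g = f + - g"
    by transfer (use square_integrable_diff in \<open>auto simp: L2_rel_def algebra_simps intro!: sq\<close>)
  show "r *\<^sub>R (f + g) = r *\<^sub>R f + r *\<^sub>R g"
    by transfer (auto simp: L2_rel_def algebra_simps intro!: sq)
  show "(r + s) *\<^sub>R f = r *\<^sub>R f + s *\<^sub>R f"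
    by transfer (auto simp: L2_rel_def algebra_simps intro!: sq)
  show "r *\<^sub>R s *\<^sub>R f = (r * s) *\<^sub>R f"
    by transfer (auto simp: L2_rel_def algebra_simps intro!: sq)
  show "1 *\<^sub>R f = f"
    by transfer (auto simp: L2_rel_def algebra_simps intro!: sq)
qed

end

instantiation L2 :: real_inner
begin

lift_definition inner_L2 :: "L2 \<Rightarrow> L2 \<Rightarrow> real" is "\<lambda>f g. \<integral>x. f x \<bullet> g x \<partial>Om"
proof -
  fix f f' g g' assume a: "L2_rel f f'" "L2_rel g g'"
  show "(\<integral>x. f x \<bullet> g x \<partial>Om) = (\<integral>x. f' x \<bullet> g' x \<partial>Om)"
  proof (rule integral_cong_AE)
    show "AE x in Om. f x \<bullet> g x = f' x \<bullet> g' x"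
      using L2_relD(3)[OF a(1)] L2_relD(3)[OF a(2)] by eventually_elim simp
  qed (use L2_relD(4,5)[OF a(1)] L2_relD(4,5)[OF a(2)] in measurable)
qed

lift_definition norm_L2 :: "L2 \<Rightarrow> real" is "\<lambda>f. sqrt (\<integral>x. (cmod (f x))\<^sup>2 \<partial>Om)"
proof -
  fix f f' assume a: "L2_rel f f'"
  have "(\<integral>x. (cmod (f x))\<^sup>2 \<partial>Om) = (\<integral>x. (cmod (f' x))\<^sup>2 \<partial>Om)"
  proof (rule integral_cong_AE)
    show "AE x in Om. (cmod (f x))\<^sup>2 = (cmod (f' x))\<^sup>2"
      using L2_relD(3)[OF a] by eventually_elim simp
  qed (use L2_relD(4,5)[OF a] in measurable)
  then show "sqrt (\<integral>x. (cmod (f x))\<^sup>2 \<partial>Om) = sqrt (\<integral>x. (cmod (f' x))\<^sup>2 \<partial>Om)" by simp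
qed

definition sgn_L2 :: "L2 \<Rightarrow> L2" where "sgn_L2 f = f /\<^sub>R norm f"
definition dist_L2 :: "L2 \<Rightarrow> L2 \<Rightarrow> real" where "dist_L2 f g = norm (f - g)"
definition uniformity_L2 :: "(L2 \<times> L2) filter" where
  "uniformity_L2 = (INF e\<in>{0 <..}. principal {(f, g). dist f g < e})"
definition open_L2 :: "L2 set \<Rightarrow> bool" where
  "open_L2 U \<longleftrightarrow> (\<forall>f\<in>U. \<forall>\<^sub>F (f', g) in uniformity. f' = f \<longrightarrow> g \<in> U)"

instance
proof
  fix f g h :: L2 and r :: real
  show "sgn f = f /\<^sub>R norm f" by (rule sgn_L2_def)
  show "dist f g = norm (f - g)" by (rule dist_L2_def)
  show "uniformity = (INF e\<in>{0 <..}. principal {(f :: L2, g). dist f g < e})"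
    by (rule uniformity_L2_def)
  show "open U \<longleftrightarrow> (\<forall>f\<in>U. \<forall>\<^sub>F (f', g) in uniformity. f' = f \<longrightarrow> g \<in> U)" for U :: "L2 set"
    by (rule open_L2_def)
  show "f \<bullet> g = g \<bullet> f"
    by transfer (simp add: inner_commute)
  show "(f + g) \<bullet> h = f \<bullet> h + g \<bullet> h"
    by transfer (auto simp: L2_rel_def inner_add_left
        intro!: Bochner_Integration.integral_add square_integrable_prod)
  show "r *\<^sub>R f \<bullet> g = r * (f \<bullet> g)"
    by transfer simp
  show "0 \<le> f \<bullet> f"
    by transfer (simp add: integral_nonneg_AE)
  show "f \<bullet> f = 0 \<longleftrightarrow> f = 0"
  proof transfer
    fix f assume f: "L2_rel f f"
    have "((\<integral>x. f x \<bullet> f x \<partial>Om) = 0) = (AE x in Om. f x \<bullet> f x = 0)"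
      using square_integrable_prod(2)[of f f] f
      by (intro integral_nonneg_eq_0_iff_AE) (auto simp: L2_rel_def)
    then show "((\<integral>x. f x \<bullet> f x \<partial>Om) = 0) = L2_rel f (\<lambda>x. 0)"
      using f by (simp add: L2_rel_def square_integrable_zero)
  qed
  show "norm f = sqrt (f \<bullet> f)"
    by transfer (simp add: power2_norm_eq_inner)
qed

end

lift_definition scaleC_L2 :: "complex \<Rightarrow> L2 \<Rightarrow> L2" is "\<lambda>c f x. c * f x"
  unfolding L2_rel_def by (auto intro: square_integrable_cmult elim!: AE_mp)

lift_definition cinner_L2 :: "L2 \<Rightarrow> L2 \<Rightarrow> complex" is "\<lambda>f g. \<integral>x. f x * cnj (g x) \<partial>Om"
proof -
  fix f f' g g' assume a: "L2_rel f f'" "L2_rel g g'"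
  show "(\<integral>x. f x * cnj (g x) \<partial>Om) = (\<integral>x. f' x * cnj (g' x) \<partial>Om)"
  proof (rule integral_cong_AE)
    show "AE x in Om. f x * cnj (g x) = f' x * cnj (g' x)"
      using L2_relD(3)[OF a(1)] L2_relD(3)[OF a(2)] by eventually_elim simp
  qed (use square_integrable_prod(1) L2_relD(1,2)[OF a(1)] L2_relD(1,2)[OF a(2)] in
      \<open>auto intro: borel_measurable_integrable\<close>)
qed

text \<open>The class of a function, meaningful for square integrable arguments only.\<close>

definition L2_of :: "(real \<Rightarrow> complex) \<Rightarrow> L2" where "L2_of = abs_L2"

lemma L2_rel_rep: "L2_rel (rep_L2 f) (rep_L2 f)"
  by (rule Quotient3_rep_reflp[OF Quotient3_L2])

lemma square_integrable_rep: "square_integrable (rep_L2 f)"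
  using L2_rel_rep[of f] by (simp add: L2_rel_def)

lemma L2_of_rep: "L2_of (rep_L2 f) = f"
  unfolding L2_of_def by (rule Quotient3_abs_rep[OF Quotient3_L2])

lemma L2_of_eq_iff:
  assumes "square_integrable f" "square_integrable g"
  shows "L2_of f = L2_of g \<longleftrightarrow> (AE x in Om. f x = g x)"
  unfolding L2_of_def
  using Quotient3_rel[OF Quotient3_L2, of f g] assms by (auto simp: L2_rel_def)

lemma rep_L2_of: "square_integrable f \<Longrightarrow> AE x in Om. rep_L2 (L2_of f) x = f x"
  using L2_of_eq_iff[OF square_integrable_rep, of f "L2_of f"] by (simp add: L2_of_rep)

lemma L2_of_ops:
  assumes f: "square_integrable f" and g: "square_integrable g"
  shows "L2_of f + L2_of g = L2_of (\<lambda>x. f x + g x)"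
    "L2_of f - L2_of g = L2_of (\<lambda>x. f x - g x)"
    "r *\<^sub>R L2_of f = L2_of (\<lambda>x. r *\<^sub>R f x)"
    "scaleC_L2 c (L2_of f) = L2_of (\<lambda>x. c * f x)"
    "cinner_L2 (L2_of f) (L2_of g) = (\<integral>x. f x * cnj (g x) \<partial>Om)"
    "L2_of f \<bullet> L2_of g = (\<integral>x. f x \<bullet> g x \<partial>Om)"
    "norm (L2_of f) = sqrt (\<integral>x. (cmod (f x))\<^sup>2 \<partial>Om)"
proof -
  have *: "eq_onp square_integrable f f" "eq_onp square_integrable g g"
    using f g by (auto simp: eq_onp_def)
  have R: "L2_rel f f" "L2_rel g g" using f g by (auto simp: L2_rel_def)
  show "L2_of f + L2_of g = L2_of (\<lambda>x. f x + g x)"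
    "L2_of f - L2_of g = L2_of (\<lambda>x. f x - g x)"
    "r *\<^sub>R L2_of f = L2_of (\<lambda>x. r *\<^sub>R f x)"
    "scaleC_L2 c (L2_of f) = L2_of (\<lambda>x. c * f x)"
    "cinner_L2 (L2_of f) (L2_of g) = (\<integral>x. f x * cnj (g x) \<partial>Om)"
    "L2_of f \<bullet> L2_of g = (\<integral>x. f x \<bullet> g x \<partial>Om)"
    "norm (L2_of f) = sqrt (\<integral>x. (cmod (f x))\<^sup>2 \<partial>Om)"
    unfolding L2_of_def using R
    by (simp_all add: plus_L2.abs_eq minus_L2.abs_eq scaleR_L2.abs_eq scaleC_L2.abs_eq
        cinner_L2.abs_eq inner_L2.abs_eq norm_L2.abs_eq)
qed

lemma L2_of_zero: "L2_of (\<lambda>x. 0) = 0"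
  by (simp add: L2_of_def zero_L2_def)

lemma norm_L2_rep: "norm f = sqrt (\<integral>x. (cmod (rep_L2 f x))\<^sup>2 \<partial>Om)"
  using L2_of_ops(7)[of "rep_L2 f" "rep_L2 f"] square_integrable_rep[of f] by (simp add: L2_of_rep)

lemma Re_cinner_L2: "Re (cinner_L2 f g) = f \<bullet> g"
proof transfer
  fix f g assume "L2_rel f f" "L2_rel g g"
  then have "integrable Om (\<lambda>x. f x * cnj (g x))" by (intro square_integrable_prod) (auto simp: L2_rel_def)
  then have "Re (\<integral>x. f x * cnj (g x) \<partial>Om) = (\<integral>x. Re (f x * cnj (g x)) \<partial>Om)"
    by (rule integral_Re[symmetric])
  then show "Re (\<integral>x. f x * cnj (g x) \<partial>Om) = (\<integral>x. f x \<bullet> g x \<partial>Om)"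
    by (simp add: inner_complex_def)
qed

lemma cinner_L2_add_left: "cinner_L2 (f + g) h = cinner_L2 f h + cinner_L2 g h"
  by transfer (auto simp: L2_rel_def algebra_simps
      intro!: Bochner_Integration.integral_add square_integrable_prod)

lemma cinner_L2_add_right: "cinner_L2 h (f + g) = cinner_L2 h f + cinner_L2 h g"
  by transfer (auto simp: L2_rel_def algebra_simps
      intro!: Bochner_Integration.integral_add square_integrable_prod)

lemma cinner_L2_scaleC_left: "cinner_L2 (scaleC_L2 c f) g = c * cinner_L2 f g"
  by transfer (simp add: mult.assoc)

lemma cinner_L2_scaleC_right: "cinner_L2 f (scaleC_L2 c g) = cnj c * cinner_L2 f g"
proof transfer
  fix f g :: "real \<Rightarrow> complex" and c
  have "(\<integral>x. f x * cnj (c * g x) \<partial>Om) = (\<integral>x. cnj c * (f x * cnj (g x)) \<partial>Om)"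
    by (simp add: mult.left_commute)
  then show "(\<integral>x. f x * cnj (c * g x) \<partial>Om) = cnj c * (\<integral>x. f x * cnj (g x) \<partial>Om)"
    by (simp only: integral_mult_right_zero)
qed

lemma scaleR_scaleC_L2: "scaleC_L2 (of_real r) f = r *\<^sub>R f"
  by transfer (simp add: L2_rel_def scaleR_conv_of_real square_integrable_cmult)

lemma scaleC_L2_add: "scaleC_L2 c (f + g) = scaleC_L2 c f + scaleC_L2 c g"
  by transfer (auto simp: L2_rel_def algebra_simps intro!: square_integrable_add square_integrable_cmult)

lemma scaleC_L2_scaleC: "scaleC_L2 c (scaleC_L2 d f) = scaleC_L2 (c * d) f"
  by transfer (auto simp: L2_rel_def algebra_simps intro!: square_integrable_cmult)

lemma norm_scaleC_L2: "norm (scaleC_L2 c f) = cmod c * norm f"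
  by transfer (simp add: norm_mult power_mult_distrib real_sqrt_mult)

lemma cinner_L2_scaleR_right: "cinner_L2 f (r *\<^sub>R g) = r *\<^sub>R cinner_L2 f g"
  by (metis cinner_L2_scaleC_right complex_cnj_complex_of_real scaleR_conv_of_real scaleR_scaleC_L2)

lemma cinner_L2_scaleR_left: "cinner_L2 (r *\<^sub>R g) f = r *\<^sub>R cinner_L2 g f"
  by (metis cinner_L2_scaleC_left scaleR_conv_of_real scaleR_scaleC_L2)

lemma cinner_L2_bound: "cmod (cinner_L2 f g) \<le> norm f * norm g"
proof (cases "cinner_L2 f g = 0")
  case False
  define z where "z = cinner_L2 f g"
  define c where "c = cnj z / of_real (cmod z)"
  have z: "z \<noteq> 0" using False by (simp add: z_def)
  have "cmod c = 1" using z by (simp add: c_def norm_divide)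
  have "c * z = of_real (cmod z)"
    using z complex_norm_square[of z] by (simp add: c_def field_simps power2_eq_square)
  then have "cmod z = Re (cinner_L2 (scaleC_L2 c f) g)" by (simp add: cinner_L2_scaleC_left z_def)
  also have "\<dots> \<le> norm (scaleC_L2 c f) * norm g"
    unfolding Re_cinner_L2 by (rule norm_cauchy_schwarz)
  finally show ?thesis using \<open>cmod c = 1\<close> by (simp add: norm_scaleC_L2 z_def)
qed simp

lemma square_integrable_integrable:
  assumes "square_integrable f"
  shows "integrable Om f"
proof -
  interpret finite_measure Om by (rule finite_measure_Om)
  have "square_integrable (\<lambda>x. 1)" by (simp add: square_integrable_def)
  from square_integrable_prod(1)[OF assms this] show ?thesis by simp
qed

lemma L1_L2_bound:
  assumes "square_integrable f"
  shows "(\<integral>x. cmod (f x) \<partial>Om) \<le> sqrt pi * norm (L2_of f)"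
proof -
  interpret finite_measure Om by (rule finite_measure_Om)
  have 1: "square_integrable (\<lambda>x. of_real (cmod (f x)))" "square_integrable (\<lambda>x. 1)"
    using assms by (auto simp: square_integrable_def)
  have "(\<integral>x. cmod (f x) \<partial>Om) = (\<integral>x. of_real (cmod (f x)) \<bullet> (1::complex) \<partial>Om)"
    by (simp add: inner_complex_def)
  also have "\<dots> = L2_of (\<lambda>x. of_real (cmod (f x))) \<bullet> L2_of (\<lambda>x. 1)"
    using L2_of_ops(6)[OF 1] by simp
  also have "\<dots> \<le> norm (L2_of (\<lambda>x. of_real (cmod (f x)))) * norm (L2_of (\<lambda>x. 1))"
    by (rule norm_cauchy_schwarz)
  also have "\<dots> = sqrt pi * norm (L2_of f)"
    using L2_of_ops(7)[OF 1(1) 1(1)] L2_of_ops(7)[OF 1(2) 1(1)] L2_of_ops(7)[OF assms assms] measure_Om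
    by simp
  finally show ?thesis .
qed

lemma L2_Cauchy_convergent:
  fixes X :: "nat \<Rightarrow> L2"
  assumes "Cauchy X"
  shows "convergent X"
proof -
  define f where "f n = rep_L2 (X n)" for n
  have f: "square_integrable (f n)" "X n = L2_of (f n)" for n
    by (auto simp: f_def square_integrable_rep L2_of_rep)
  have m: "f n \<in> borel_measurable Om" for n using f(1)[of n] by (simp add: square_integrable_def)
  have "\<forall>k. \<exists>N. \<forall>m\<ge>N. \<forall>n\<ge>N. dist (X m) (X n) < (1/2) ^ k"
    using assms unfolding Cauchy_def by auto
  then obtain N where N: "\<And>k m n. m \<ge> N k \<Longrightarrow> n \<ge> N k \<Longrightarrow> dist (X m) (X n) < (1/2) ^ k" by metis
  define r where "r k = sum N {..k}" for k
  have r: "N k \<le> r j" if "k \<le> j" for k j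
    unfolding r_def using that by (intro member_le_sum) auto
  define g where "g k x = f (r (Suc k)) x - f (r k) x" for k x
  have sg: "square_integrable (g k)" for k
    unfolding g_def by (intro square_integrable_diff f)
  have gm: "g k \<in> borel_measurable Om" for k
    using sg[of k] by (simp add: square_integrable_def)
  have gint: "(\<integral>x. cmod (g k x) \<partial>Om) \<le> sqrt pi * (1/2) ^ k" for k
  proof -
    have "norm (L2_of (g k)) = dist (X (r (Suc k))) (X (r k))"
      using L2_of_ops(2)[OF f(1) f(1)] f(2) by (simp add: g_def[abs_def] dist_norm)
    also have "\<dots> < (1/2) ^ k" by (intro N r) auto
    finally have "sqrt pi * norm (L2_of (g k)) \<le> sqrt pi * (1/2) ^ k"
      by (intro mult_left_mono) auto
    then show ?thesis using L1_L2_bound[OF sg, of k] by linarith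
  qed
  have "(\<integral>\<^sup>+x. (\<Sum>k. ennreal (cmod (g k x))) \<partial>Om) = (\<Sum>k. \<integral>\<^sup>+x. ennreal (cmod (g k x)) \<partial>Om)"
    using gm by (intro nn_integral_suminf) measurable
  also have "\<dots> = (\<Sum>k. ennreal (\<integral>x. cmod (g k x) \<partial>Om))"
    using square_integrable_integrable[OF sg] by (intro suminf_cong nn_integral_eq_integral) auto
  also have "\<dots> \<le> (\<Sum>k. ennreal (sqrt pi * (1/2) ^ k))"
    by (intro suminf_le ennreal_leI gint) auto
  also have "\<dots> < \<infinity>"
    by (simp add: suminf_ennreal_eq[OF _ summable_sums] summable_mult ennreal_less_top
        less_top[symmetric])
  finally have fin: "(\<integral>\<^sup>+x. (\<Sum>k. ennreal (cmod (g k x))) \<partial>Om) \<noteq> \<infinity>" by simp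
  have "AE x in Om. (\<Sum>k. ennreal (cmod (g k x))) \<noteq> \<infinity>"
    using fin gm by (intro nn_integral_PInf_AE) measurable
  then have conv: "AE x in Om. convergent (\<lambda>k. f (r k) x)"
  proof eventually_elim
    case (elim x)
    then have "summable (\<lambda>k. cmod (g k x))" by (intro summable_suminf_not_top) auto
    then have "summable (\<lambda>k. g k x)" by (rule summable_norm_cancel)
    then have "convergent (\<lambda>n. \<Sum>k<n. g k x)" by (simp add: summable_iff_convergent)
    moreover have "(\<Sum>k<n. g k x) = f (r n) x - f (r 0) x" for n
      using sum_lessThan_telescope[of "\<lambda>k. f (r k) x" n] by (simp add: g_def)
    ultimately have "convergent (\<lambda>n. f (r n) x - f (r 0) x)" by simp
    from convergent_add[OF this convergent_const[of "f (r 0) x"]] show ?case by simp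
  qed
  define F where "F x = lim (\<lambda>k. f (r k) x)" for x
  have Fm: "F \<in> borel_measurable Om"
    unfolding F_def using m by (intro borel_measurable_lim_metric)
  have lim: "AE x in Om. (\<lambda>k. f (r k) x) \<longlonglongrightarrow> F x"
    using conv by eventually_elim (auto simp: F_def convergent_LIMSEQ_iff)
  have bd: "(\<integral>\<^sup>+x. ennreal ((cmod (F x - f n x))\<^sup>2) \<partial>Om) \<le> ennreal (((1/2) ^ k)\<^sup>2)" if n: "n \<ge> N k" for k n
  proof -
    have "(\<integral>\<^sup>+x. ennreal ((cmod (F x - f n x))\<^sup>2) \<partial>Om)
        = (\<integral>\<^sup>+x. liminf (\<lambda>j. ennreal ((cmod (f (r j) x - f n x))\<^sup>2)) \<partial>Om)"
    proof (rule nn_integral_cong_AE)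
      show "AE x in Om. ennreal ((cmod (F x - f n x))\<^sup>2) = liminf (\<lambda>j. ennreal ((cmod (f (r j) x - f n x))\<^sup>2))"
        using lim
      proof eventually_elim
        case (elim x)
        then have "(\<lambda>j. ennreal ((cmod (f (r j) x - f n x))\<^sup>2)) \<longlonglongrightarrow> ennreal ((cmod (F x - f n x))\<^sup>2)"
          by (intro tendsto_ennrealI tendsto_intros)
        from lim_imp_Liminf[OF sequentially_bot this] show ?case by simp
      qed
    qed
    also have "\<dots> \<le> liminf (\<lambda>j. \<integral>\<^sup>+x. ennreal ((cmod (f (r j) x - f n x))\<^sup>2) \<partial>Om)"
      using m by (intro nn_integral_liminf) measurable
    also have "\<dots> \<le> ennreal (((1/2) ^ k)\<^sup>2)"
    proof (rule Liminf_le)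
      have "(\<integral>\<^sup>+x. ennreal ((cmod (f (r j) x - f n x))\<^sup>2) \<partial>Om) \<le> ennreal (((1/2) ^ k)\<^sup>2)" if "j \<ge> k" for j
      proof -
        have s: "square_integrable (\<lambda>x. f (r j) x - f n x)" by (intro square_integrable_diff f)
        have "norm (X (r j) - X n) < (1/2) ^ k"
          using N[OF r[OF that] n] by (simp add: dist_norm)
        then have "(norm (X (r j) - X n))\<^sup>2 \<le> ((1/2) ^ k)\<^sup>2" by (intro power_mono) auto
        moreover have "X (r j) - X n = L2_of (\<lambda>x. f (r j) x - f n x)"
          using L2_of_ops(2)[OF f(1) f(1)] f(2) by simp
        ultimately have "(\<integral>x. (cmod (f (r j) x - f n x))\<^sup>2 \<partial>Om) \<le> ((1/2) ^ k)\<^sup>2"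
          using L2_of_ops(7)[OF s s] by simp
        moreover have "(\<integral>\<^sup>+x. ennreal ((cmod (f (r j) x - f n x))\<^sup>2) \<partial>Om)
            = ennreal (\<integral>x. (cmod (f (r j) x - f n x))\<^sup>2 \<partial>Om)"
          using s by (intro nn_integral_eq_integral) (auto simp: square_integrable_def)
        ultimately show ?thesis by (simp add: ennreal_leI)
      qed
      then show "\<forall>\<^sub>F j in sequentially. (\<integral>\<^sup>+x. ennreal ((cmod (f (r j) x - f n x))\<^sup>2) \<partial>Om) \<le> ennreal (((1/2) ^ k)\<^sup>2)"
        by (auto simp: eventually_sequentially)
    qed simp
    finally show ?thesis .
  qed
  have sF: "square_integrable (\<lambda>x. F x - f n x)" if "n \<ge> N k" for n k
    unfolding square_integrable_def
  proof (intro conjI integrableI_bounded)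
    show "(\<integral>\<^sup>+x. ennreal (norm ((cmod (F x - f n x))\<^sup>2)) \<partial>Om) < \<infinity>"
      using bd[OF that] by (simp add: order_le_less_trans ennreal_less_top)
  qed (use Fm m in measurable)
  have Fs: "square_integrable F"
    using square_integrable_add[OF sF[of 0 "N 0"] f(1)[of "N 0"]] by simp
  have "X \<longlonglongrightarrow> L2_of F"
  proof (rule metric_LIMSEQ_I)
    fix e :: real assume "e > 0"
    then obtain k where k: "(1/2) ^ k < e" using real_arch_pow_inv[of e "1/2"] by auto
    have "dist (X n) (L2_of F) < e" if "n \<ge> N k" for n
    proof -
      have "L2_of F - X n = L2_of (\<lambda>x. F x - f n x)"
        using L2_of_ops(2)[OF Fs f(1)] f(2) by simp
      moreover have "(\<integral>x. (cmod (F x - f n x))\<^sup>2 \<partial>Om) \<le> ((1/2) ^ k)\<^sup>2"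
        using bd[OF that] sF[OF that]
        by (subst (asm) nn_integral_eq_integral) (auto simp: square_integrable_def)
      ultimately have "norm (L2_of F - X n) \<le> (1/2) ^ k"
        using L2_of_ops(7)[OF sF[OF that] sF[OF that]] by (simp add: real_le_lsqrt)
      then show ?thesis using k by (simp add: dist_norm norm_minus_commute)
    qed
    then show "\<exists>no. \<forall>n\<ge>no. dist (X n) (L2_of F) < e" by blast
  qed
  then show ?thesis by (auto simp: convergent_def)
qed

instance L2 :: banach
  by standard (rule L2_Cauchy_convergent)

lemma square_integrable_bounded:
  assumes "f \<in> borel_measurable Om" "\<And>x. cmod (f x) \<le> B"
  shows "square_integrable f"
proof -
  interpret finite_measure Om by (rule finite_measure_Om)
  have "square_integrable (\<lambda>x. 1)" by (simp add: square_integrable_def)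
  from square_integrable_mult[OF this assms(1), of B] show ?thesis using assms(2) by auto
qed

lemma square_integrable_smooth:
  assumes "test_function 0 pi f" shows "square_integrable f"
proof -
  obtain B where "\<And>x. cmod (f x) \<le> B" using test_function_bounded[OF assms] by metis
  then show ?thesis using assms
    by (intro square_integrable_bounded smooth_measurable) (auto simp: test_function_def)
qed

instance L2 :: second_countable_topology
proof
  define S where "S = (\<lambda>(c, d, z). L2_of (\<lambda>x. z * indicator {c<..<d} x)) ` (\<rat> \<times> \<rat> \<times> {1, \<i>})"
  have sq: "square_integrable (\<lambda>x. z * indicator {c<..<d} x)" for z c d
    by (intro square_integrable_cmult square_integrable_bounded[where B=1]
        measurable_restrict_space1 measurable_completion) (auto simp: indicator_def)
  have "countable S" unfolding S_def
    by (intro countable_image countable_SIGMA countable_rat) auto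
  moreover have "closure (span S) = UNIV"
  proof (rule dense_span_of_orthogonal)
    fix h assume h: "\<And>s. s \<in> S \<Longrightarrow> h \<bullet> s = 0"
    define f where "f = rep_L2 h"
    have f: "square_integrable f" "h = L2_of f" by (auto simp: f_def square_integrable_rep L2_of_rep)
    have "AE x in Om. f x = 0"
    proof (rule AE_zero_of_intervals)
      show "integrable Om f" by (rule square_integrable_integrable[OF f(1)])
      fix c d :: real assume cd: "c \<in> \<rat>" "d \<in> \<rat>"
      let ?I = "\<integral>x. indicator {c<..<d} x *\<^sub>R f x \<partial>Om"
      have int: "integrable Om (\<lambda>x. indicator {c<..<d} x *\<^sub>R f x)"
        using square_integrable_prod(1)[OF f(1) sq[of 1 c d]]
        by (rule Bochner_Integration.integrable_cong[THEN iffD1, rotated -1])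
           (auto simp: indicator_def)
      have 1: "(\<integral>x. f x \<bullet> (z * indicator {c<..<d} x) \<partial>Om) = 0" if "z \<in> {1, \<i>}" for z
        using h[of "L2_of (\<lambda>x. z * indicator {c<..<d} x)"] that cd L2_of_ops(6)[OF f(1) sq] f(2)
        by (force simp: S_def)
      have "Re ?I = (\<integral>x. f x \<bullet> (1 * indicator {c<..<d} x) \<partial>Om)"
        unfolding integral_Re[OF int, symmetric]
        by (intro Bochner_Integration.integral_cong) (auto simp: inner_complex_def indicator_def)
      moreover have "Im ?I = (\<integral>x. f x \<bullet> (\<i> * indicator {c<..<d} x) \<partial>Om)"
        unfolding integral_Im[OF int, symmetric]
        by (intro Bochner_Integration.integral_cong) (auto simp: inner_complex_def indicator_def)
      ultimately show "?I = 0" using 1[of 1] 1[of \<i>] by (intro complex_eqI) auto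
    qed
    then show "h = 0"
      using L2_of_eq_iff[OF f(1) square_integrable_zero] f(2) by (simp add: L2_of_zero)
  qed
  ultimately show "\<exists>B::L2 set set. countable B \<and> open = generate_topology B"
    by (rule countable_dense_span)
qed

subsection \<open>The space \<open>V = H\<^sub>0\<^sup>1((0,\<pi>); \<complex>)\<close>\<close>

definition has_weak_dx :: "L2 \<Rightarrow> L2 \<Rightarrow> bool" where
  "has_weak_dx v g \<longleftrightarrow> weak_deriv 0 pi (rep_L2 v) (rep_L2 g)"

definition wdx :: "L2 \<Rightarrow> L2" where
  "wdx v = (THE g. has_weak_dx v g)"

text \<open>
\<open>H10_set\<close> is the closure of the test functions in \<open>H\<^sup>1(0,\<pi>)\<close>; the norm of \<open>V\<close> below is \<open>norm (wdx v)\<close>.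
\<close>

definition H10_set :: "L2 set" where
  "H10_set = {v. (\<exists>g. has_weak_dx v g) \<and>
     (\<exists>\<phi> :: nat \<Rightarrow> real \<Rightarrow> complex. (\<forall>n. test_function 0 pi (\<phi> n)) \<and>
        (\<lambda>n. L2_of (\<phi> n)) \<longlonglongrightarrow> v \<and> (\<lambda>n. wdx (L2_of (\<phi> n))) \<longlonglongrightarrow> wdx v)}"

lemma bounded_linear_cinner_left: "bounded_linear (\<lambda>f. cinner_L2 f g)"
  by (rule bounded_linear_intro[where K = "norm g"])
     (auto simp: cinner_L2_add_left cinner_L2_scaleR_left cinner_L2_bound)

lemma bounded_linear_cinner_right: "bounded_linear (\<lambda>g. cinner_L2 f g)"
proof (rule bounded_linear_intro[where K = "norm f"])
  show "cmod (cinner_L2 f g) \<le> norm g * norm f" for g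
    using cinner_L2_bound[of f g] by (simp only: mult.commute)
qed (auto simp: cinner_L2_add_right cinner_L2_scaleR_right)

definition L2_real :: "(real \<Rightarrow> real) \<Rightarrow> L2" where
  "L2_real \<phi> = L2_of (\<lambda>x. of_real (\<phi> x))"

lemma test_function_of_real:
  assumes "test_function a b \<phi>"
  shows "test_function a b (\<lambda>x. complex_of_real (\<phi> x))"
    "vderiv (\<lambda>x. complex_of_real (\<phi> x)) = (\<lambda>x. of_real (vderiv \<phi> x))"
  using test_function_linear1[OF assms bounded_linear_of_real] by auto

lemma cinner_L2_real:
  assumes "test_function 0 pi \<phi>"
  shows "cinner_L2 g (L2_real \<phi>) = (\<integral>x. \<phi> x *\<^sub>R rep_L2 g x \<partial>Om)"
proof -
  have s: "square_integrable (\<lambda>x. complex_of_real (\<phi> x))"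
    using test_function_of_real(1)[OF assms] by (rule square_integrable_smooth)
  show ?thesis
    using L2_of_ops(5)[OF square_integrable_rep s, of g] unfolding L2_real_def L2_of_rep
    by (simp add: scaleR_conv_of_real mult.commute)
qed

lemma has_weak_dx_iff:
  "has_weak_dx v g \<longleftrightarrow>
     (\<forall>\<phi>. test_function 0 pi \<phi> \<longrightarrow> cinner_L2 v (L2_real (vderiv \<phi>)) = - cinner_L2 g (L2_real \<phi>))"
  unfolding has_weak_dx_def weak_deriv_def
  using cinner_L2_real cinner_L2_real[OF test_function_vderiv] by simp

lemma L2_eq_0I:
  assumes "\<And>\<phi>. test_function 0 pi \<phi> \<Longrightarrow> cinner_L2 g (L2_real \<phi>) = 0"
  shows "g = 0"
proof -
  have "AE x in Om. rep_L2 g x = 0"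
    using assms cinner_L2_real
    by (intro AE_zero_of_test_functions square_integrable_integrable square_integrable_rep) metis
  then show ?thesis
    using L2_of_eq_iff[OF square_integrable_rep square_integrable_zero, of g]
    by (simp add: L2_of_rep L2_of_zero)
qed

lemma has_weak_dx_unique:
  assumes "has_weak_dx v g" "has_weak_dx v h"
  shows "g = h"
proof -
  have "cinner_L2 (g - h) (L2_real \<phi>) = 0" if "test_function 0 pi \<phi>" for \<phi>
  proof -
    interpret bounded_linear "\<lambda>f. cinner_L2 f (L2_real \<phi>)" by (rule bounded_linear_cinner_left)
    show ?thesis using assms that by (simp add: has_weak_dx_iff diff)
  qed
  then show ?thesis using L2_eq_0I[of "g - h"] by simp
qed

lemma wdx_eq: "has_weak_dx v g \<Longrightarrow> wdx v = g"
  unfolding wdx_def by (rule the_equality, assumption, rule has_weak_dx_unique)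

lemma has_weak_dx_limit:
  assumes "\<And>n. has_weak_dx (v n) (g n)" "v \<longlonglongrightarrow> v'" "g \<longlonglongrightarrow> g'"
  shows "has_weak_dx v' g'"
  unfolding has_weak_dx_iff
proof (intro allI impI)
  fix \<phi> :: "real \<Rightarrow> real" assume \<phi>: "test_function 0 pi \<phi>"
  have "(\<lambda>n. cinner_L2 (v n) (L2_real (vderiv \<phi>))) \<longlonglongrightarrow> cinner_L2 v' (L2_real (vderiv \<phi>))"
    by (rule bounded_linear.tendsto[OF bounded_linear_cinner_left assms(2)])
  moreover have "(\<lambda>n. - cinner_L2 (g n) (L2_real \<phi>)) \<longlonglongrightarrow> - cinner_L2 g' (L2_real \<phi>)"
    by (intro tendsto_minus bounded_linear.tendsto[OF bounded_linear_cinner_left assms(3)])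
  ultimately show "cinner_L2 v' (L2_real (vderiv \<phi>)) = - cinner_L2 g' (L2_real \<phi>)"
    using assms(1) \<phi> LIMSEQ_unique by (simp add: has_weak_dx_iff)
qed

lemma has_weak_dx_add:
  "has_weak_dx v g \<Longrightarrow> has_weak_dx w h \<Longrightarrow> has_weak_dx (v + w) (g + h)"
  unfolding has_weak_dx_iff cinner_L2_add_left
proof (intro allI impI)
  fix \<phi> :: "real \<Rightarrow> real"
  assume "\<forall>\<phi>. test_function 0 pi \<phi> \<longrightarrow> cinner_L2 v (L2_real (vderiv \<phi>)) = - cinner_L2 g (L2_real \<phi>)"
    "\<forall>\<phi>. test_function 0 pi \<phi> \<longrightarrow> cinner_L2 w (L2_real (vderiv \<phi>)) = - cinner_L2 h (L2_real \<phi>)"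
    "test_function 0 pi \<phi>"
  then have "cinner_L2 v (L2_real (vderiv \<phi>)) = - cinner_L2 g (L2_real \<phi>)"
    "cinner_L2 w (L2_real (vderiv \<phi>)) = - cinner_L2 h (L2_real \<phi>)" by blast+
  then show "cinner_L2 v (L2_real (vderiv \<phi>)) + cinner_L2 w (L2_real (vderiv \<phi>))
      = - (cinner_L2 g (L2_real \<phi>) + cinner_L2 h (L2_real \<phi>))" by simp
qed

lemma integral_Om_FTC:
  fixes F f :: "real \<Rightarrow> complex"
  assumes F: "\<And>x. (F has_vector_derivative f x) (at x)" and f: "continuous_on UNIV f"
    and x: "0 \<le> x" "x \<le> pi"
  shows "(\<integral>t. indicator {0<..<x} t *\<^sub>R f t \<partial>Om) = F x - F 0"
    "integrable Om (\<lambda>t. indicator {0<..<x} t *\<^sub>R f t)"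
proof -
  have sub: "{0<..<x} \<inter> {0<..<pi} = {0<..<x}" using x by auto
  have "f absolutely_integrable_on {0..x}"
    by (intro absolutely_integrable_continuous_real continuous_on_subset[OF f]) auto
  then have "f absolutely_integrable_on {0<..<x}"
    by (rule set_integrable_subset) auto
  then have int: "integrable (lebesgue_on {0<..<x}) f"
    by (simp add: integrable_restrict_space set_integrable_def)
  have "(f has_integral F x - F 0) {0..x}"
    by (rule fundamental_theorem_of_calculus[OF x(1)]) (rule has_vector_derivative_at_within[OF F])
  then have "(f has_integral F x - F 0) {0<..<x}" by (simp add: has_integral_Icc_iff_Ioo)
  then have *: "(\<integral>t. f t \<partial>lebesgue_on {0<..<x}) = F x - F 0"
    using has_integral_unique[OF has_integral_integral_lebesgue_on[OF int]] by simp
  have eq: "indicat_real {0<..<pi} t * indicator {0<..<x} t = indicator {0<..<x} t" for t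
    using x by (auto simp: indicator_def)
  have "(\<integral>t. indicator {0<..<x} t *\<^sub>R f t \<partial>Om) = (\<integral>t. f t \<partial>lebesgue_on {0<..<x})"
    by (subst (1 2) integral_restrict_space) (auto simp: eq)
  then show "(\<integral>t. indicator {0<..<x} t *\<^sub>R f t \<partial>Om) = F x - F 0" using * by simp
  show "integrable Om (\<lambda>t. indicator {0<..<x} t *\<^sub>R f t)"
    using int by (subst integrable_restrict_space) (auto simp: eq integrable_restrict_space)
qed

lemma test_function_endpoints:
  assumes "test_function 0 pi \<phi>" shows "\<phi> 0 = 0" "\<phi> pi = 0"
  using test_function_support[OF assms, of 0] test_function_support[OF assms, of pi] by auto

lemma has_weak_dx_test:
  fixes \<phi> :: "real \<Rightarrow> complex"
  assumes \<phi>: "test_function 0 pi \<phi>"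
  shows "has_weak_dx (L2_of \<phi>) (L2_of (vderiv \<phi>))"
  unfolding has_weak_dx_iff
proof (intro allI impI)
  fix \<psi> :: "real \<Rightarrow> real" assume \<psi>: "test_function 0 pi \<psi>"
  note \<psi>c = test_function_of_real[OF \<psi>]
  note s = square_integrable_smooth[OF \<phi>] square_integrable_smooth[OF test_function_vderiv[OF \<phi>]]
    square_integrable_smooth[OF \<psi>c(1)] square_integrable_smooth[OF test_function_vderiv[OF \<psi>c(1)]]
  have sm: "smooth \<phi>" "smooth \<psi>" using \<phi> \<psi> by (auto simp: test_function_def)
  let ?f = "\<lambda>x. \<phi> x * of_real (vderiv \<psi> x) + vderiv \<phi> x * of_real (\<psi> x)"
  have d: "((\<lambda>x. \<phi> x * of_real (\<psi> x)) has_vector_derivative ?f x) (at x)" for x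
  proof -
    have "((\<lambda>x. complex_of_real (\<psi> x)) has_vector_derivative of_real (vderiv \<psi> x)) (at x)"
      using smooth_has_vderiv[of "\<lambda>x. complex_of_real (\<psi> x)" x] \<psi>c by (simp add: test_function_def)
    from has_vector_derivative_mult[OF smooth_has_vderiv[OF sm(1)] this] show ?thesis .
  qed
  have c: "continuous_on UNIV ?f"
    using smooth_continuous[OF sm(1)] smooth_continuous[OF sm(2)]
      smooth_continuous[OF smooth_vderiv[OF sm(1)]] smooth_continuous[OF smooth_vderiv[OF sm(2)]]
    by (intro continuous_intros)
  have "(\<integral>t. indicator {0<..<pi} t *\<^sub>R ?f t \<partial>Om) = 0"
    using integral_Om_FTC(1)[OF d c, of pi] test_function_endpoints[OF \<phi>] by simp
  moreover have "(\<integral>t. indicator {0<..<pi} t *\<^sub>R ?f t \<partial>Om) = (\<integral>t. ?f t \<partial>Om)"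
    by (rule Bochner_Integration.integral_cong) auto
  ultimately have 0: "(\<integral>t. ?f t \<partial>Om) = 0" by simp
  have "(\<integral>t. ?f t \<partial>Om) = (\<integral>x. \<phi> x * of_real (vderiv \<psi> x) \<partial>Om) + (\<integral>x. vderiv \<phi> x * of_real (\<psi> x) \<partial>Om)"
    using square_integrable_prod(1)[OF s(1) s(4)] square_integrable_prod(1)[OF s(2) s(3)] \<psi>c(2)
    by (intro Bochner_Integration.integral_add) auto
  then show "cinner_L2 (L2_of \<phi>) (L2_real (vderiv \<psi>)) = - cinner_L2 (L2_of (vderiv \<phi>)) (L2_real \<psi>)"
    using 0 L2_of_ops(5)[OF s(1) s(4)] L2_of_ops(5)[OF s(2) s(3)] \<psi>c(2)
    by (simp add: L2_real_def add_eq_0_iff2)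
qed

lemma wdx_test: "test_function 0 pi \<phi> \<Longrightarrow> wdx (L2_of \<phi>) = L2_of (vderiv \<phi>)"
  by (rule wdx_eq[OF has_weak_dx_test])

lemma poincare_test:
  fixes \<phi> :: "real \<Rightarrow> complex"
  assumes \<phi>: "test_function 0 pi \<phi>"
  shows "norm (L2_of \<phi>) \<le> pi * norm (L2_of (vderiv \<phi>))"
proof -
  interpret finite_measure Om by (rule finite_measure_Om)
  define M where "M = sqrt pi * norm (L2_of (vderiv \<phi>))"
  have M: "0 \<le> M" by (simp add: M_def)
  have sm: "smooth \<phi>" using \<phi> by (auto simp: test_function_def)
  note s = square_integrable_smooth[OF \<phi>] square_integrable_smooth[OF test_function_vderiv[OF \<phi>]]
  have bd: "cmod (\<phi> x) \<le> M" if x: "0 < x" "x < pi" for x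
  proof -
    note ftc = integral_Om_FTC[OF smooth_has_vderiv[OF sm] smooth_continuous[OF smooth_vderiv[OF sm]], of x]
    have "\<phi> x = (\<integral>t. indicator {0<..<x} t *\<^sub>R vderiv \<phi> t \<partial>Om)"
      using ftc(1) x test_function_endpoints[OF \<phi>] by simp
    also have "cmod \<dots> \<le> (\<integral>t. cmod (vderiv \<phi> t) \<partial>Om)"
      using ftc(2) x square_integrable_integrable[OF s(2)]
      by (intro order_trans[OF integral_norm_bound] integral_mono integrable_norm) (auto simp: indicator_def)
    also have "\<dots> \<le> M" unfolding M_def by (rule L1_L2_bound[OF s(2)])
    finally show ?thesis .
  qed
  have "(\<integral>x. (cmod (\<phi> x))\<^sup>2 \<partial>Om) \<le> (\<integral>x. M\<^sup>2 \<partial>Om)"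
    using s(1) bd by (intro integral_mono) (auto simp: square_integrable_def intro!: power_mono)
  also have "\<dots> = pi * M\<^sup>2" using measure_Om by simp
  also have "\<dots> = (pi * norm (L2_of (vderiv \<phi>)))\<^sup>2"
    by (simp add: M_def power_mult_distrib power2_eq_square)
  finally show ?thesis
    using L2_of_ops(7)[OF s(1) s(1)] by (simp add: real_le_lsqrt)
qed

lemma H10_setE:
  assumes "v \<in> H10_set"
  obtains \<phi> :: "nat \<Rightarrow> real \<Rightarrow> complex"
  where "\<And>n. test_function 0 pi (\<phi> n)" "(\<lambda>n. L2_of (\<phi> n)) \<longlonglongrightarrow> v"
    "(\<lambda>n. L2_of (vderiv (\<phi> n))) \<longlonglongrightarrow> wdx v" "has_weak_dx v (wdx v)"
proof -
  obtain g and \<phi> :: "nat \<Rightarrow> real \<Rightarrow> complex" where g: "has_weak_dx v g" and \<phi>: "\<And>n. test_function 0 pi (\<phi> n)"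
    "(\<lambda>n. L2_of (\<phi> n)) \<longlonglongrightarrow> v" "(\<lambda>n. wdx (L2_of (\<phi> n))) \<longlonglongrightarrow> wdx v"
    using assms unfolding H10_set_def by blast
  show ?thesis
  proof (rule that[OF \<phi>(1,2)])
    show "(\<lambda>n. L2_of (vderiv (\<phi> n))) \<longlonglongrightarrow> wdx v" using \<phi>(3) unfolding wdx_test[OF \<phi>(1)] .
    show "has_weak_dx v (wdx v)" using g unfolding wdx_eq[OF g] .
  qed
qed

lemma H10_setI:
  assumes \<phi>: "\<And>n. test_function 0 pi (\<phi> n)" and lim: "(\<lambda>n. L2_of (\<phi> n)) \<longlonglongrightarrow> v"
    "(\<lambda>n. L2_of (vderiv (\<phi> n))) \<longlonglongrightarrow> g"
  shows "v \<in> H10_set" "has_weak_dx v g" "wdx v = g"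
proof -
  show 1: "has_weak_dx v g"
    by (rule has_weak_dx_limit[OF has_weak_dx_test[OF \<phi>] lim])
  show 2: "wdx v = g" by (rule wdx_eq[OF 1])
  show "v \<in> H10_set" unfolding H10_set_def
  proof (intro CollectI conjI exI)
    show "has_weak_dx v g" by (rule 1)
    show "\<forall>n. test_function 0 pi (\<phi> n)" using \<phi> by blast
    show "(\<lambda>n. wdx (L2_of (\<phi> n))) \<longlonglongrightarrow> wdx v" unfolding wdx_test[OF \<phi>] 2 by (rule lim(2))
  qed (rule lim(1))
qed

lemma poincare:
  assumes "v \<in> H10_set"
  shows "norm v \<le> pi * norm (wdx v)"
  using assms
proof (rule H10_setE)
  fix \<phi> :: "nat \<Rightarrow> real \<Rightarrow> complex"
  assume "\<And>n. test_function 0 pi (\<phi> n)" "(\<lambda>n. L2_of (\<phi> n)) \<longlonglongrightarrow> v"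
    "(\<lambda>n. L2_of (vderiv (\<phi> n))) \<longlonglongrightarrow> wdx v"
  then show ?thesis
    by (intro LIMSEQ_le[of "\<lambda>n. norm (L2_of (\<phi> n))" _ "\<lambda>n. pi * norm (L2_of (vderiv (\<phi> n)))"]
        tendsto_intros) (use poincare_test in auto)
qed

lemma H10_set_test: "test_function 0 pi \<phi> \<Longrightarrow> L2_of \<phi> \<in> H10_set"
  by (rule H10_setI[of "\<lambda>n. \<phi>"]) auto

lemma H10_set_zero: "0 \<in> H10_set" "wdx 0 = 0"
proof -
  have t: "test_function 0 pi (\<lambda>x. 0 :: complex)"
    unfolding test_function_def by (intro conjI exI[of _ "{}"]) (auto simp: smooth_zero)
  show "0 \<in> H10_set" using H10_set_test[OF t] by (simp add: L2_of_zero)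
  show "wdx 0 = 0" using wdx_test[OF t] by (simp add: L2_of_zero vderiv_zero)
qed

lemma H10_set_lincomb:
  assumes v: "v \<in> H10_set" and w: "w \<in> H10_set"
  shows "scaleC_L2 c v + scaleC_L2 d w \<in> H10_set"
    "wdx (scaleC_L2 c v + scaleC_L2 d w) = scaleC_L2 c (wdx v) + scaleC_L2 d (wdx w)"
proof -
  obtain \<phi> :: "nat \<Rightarrow> real \<Rightarrow> complex" where \<phi>: "\<And>n. test_function 0 pi (\<phi> n)" "(\<lambda>n. L2_of (\<phi> n)) \<longlonglongrightarrow> v"
    "(\<lambda>n. L2_of (vderiv (\<phi> n))) \<longlonglongrightarrow> wdx v" "has_weak_dx v (wdx v)" by (rule H10_setE[OF v], rule that)
  obtain \<psi> :: "nat \<Rightarrow> real \<Rightarrow> complex" where \<psi>: "\<And>n. test_function 0 pi (\<psi> n)" "(\<lambda>n. L2_of (\<psi> n)) \<longlonglongrightarrow> w"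
    "(\<lambda>n. L2_of (vderiv (\<psi> n))) \<longlonglongrightarrow> wdx w" "has_weak_dx w (wdx w)" by (rule H10_setE[OF w], rule that)
  have bl: "bounded_linear (scaleC_L2 c)" for c
    by (rule bounded_linear_intro[where K = "cmod c"])
       (auto simp: scaleC_L2_add norm_scaleC_L2 scaleC_L2_scaleC simp flip: scaleR_scaleC_L2, simp add: mult.commute)
  note lin = bounded_linear_mult_right[of c] bounded_linear_mult_right[of d]
  have t: "test_function 0 pi (\<lambda>x. c * \<phi> n x + d * \<psi> n x)" for n
    by (rule test_function_linear[OF \<phi>(1) \<psi>(1) lin])
  have dv: "vderiv (\<lambda>x. c * \<phi> n x + d * \<psi> n x) = (\<lambda>x. c * vderiv (\<phi> n) x + d * vderiv (\<psi> n) x)" for n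
    using smooth_linear(2)[OF _ _ lin, of "\<phi> n" "\<psi> n"] \<phi>(1) \<psi>(1) by (auto simp: test_function_def)
  have L: "L2_of (\<lambda>x. c * f x + d * g x) = scaleC_L2 c (L2_of f) + scaleC_L2 d (L2_of g)"
    if "square_integrable f" "square_integrable g" for f g
    using L2_of_ops(4)[OF that(1) that(1), of c] L2_of_ops(4)[OF that(2) that(2), of d]
      L2_of_ops(1)[OF square_integrable_cmult[OF that(1), of c] square_integrable_cmult[OF that(2), of d]]
    by simp
  have l1: "(\<lambda>n. L2_of (\<lambda>x. c * \<phi> n x + d * \<psi> n x)) \<longlonglongrightarrow> scaleC_L2 c v + scaleC_L2 d w"
    using L[OF square_integrable_smooth[OF \<phi>(1)] square_integrable_smooth[OF \<psi>(1)]]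
    by (simp add: tendsto_add bounded_linear.tendsto[OF bl \<phi>(2)] bounded_linear.tendsto[OF bl \<psi>(2)])
  have l2: "(\<lambda>n. L2_of (vderiv (\<lambda>x. c * \<phi> n x + d * \<psi> n x)))
      \<longlonglongrightarrow> scaleC_L2 c (wdx v) + scaleC_L2 d (wdx w)"
    unfolding dv
    using L[OF square_integrable_smooth[OF test_function_vderiv[OF \<phi>(1)]]
        square_integrable_smooth[OF test_function_vderiv[OF \<psi>(1)]]]
    by (simp add: tendsto_add bounded_linear.tendsto[OF bl \<phi>(3)] bounded_linear.tendsto[OF bl \<psi>(3)])
  show "scaleC_L2 c v + scaleC_L2 d w \<in> H10_set"
    "wdx (scaleC_L2 c v + scaleC_L2 d w) = scaleC_L2 c (wdx v) + scaleC_L2 d (wdx w)"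
    using H10_setI(1,3)[OF t l1 l2] by auto
qed

lemma scaleC_L2_simps: "scaleC_L2 1 f = f" "scaleC_L2 0 f = 0" "scaleC_L2 (- 1) f = - f" "scaleC_L2 c 0 = 0"
proof -
  show "scaleC_L2 1 f = f" using scaleR_scaleC_L2[of 1 f] by simp
  show "scaleC_L2 0 f = 0" using scaleR_scaleC_L2[of 0 f] by simp
  show "scaleC_L2 (- 1) f = - f" using scaleR_scaleC_L2[of "-1" f] by simp
  have "norm (scaleC_L2 c 0) = 0" by (simp add: norm_scaleC_L2)
  then show "scaleC_L2 c 0 = 0" by simp
qed

lemma H10_set_ops:
  assumes v: "v \<in> H10_set" and w: "w \<in> H10_set"
  shows "v + w \<in> H10_set" "wdx (v + w) = wdx v + wdx w"
    "v - w \<in> H10_set" "wdx (v - w) = wdx v - wdx w"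
    "- v \<in> H10_set" "wdx (- v) = - wdx v"
    "r *\<^sub>R v \<in> H10_set" "wdx (r *\<^sub>R v) = r *\<^sub>R wdx v"
    "scaleC_L2 c v \<in> H10_set" "wdx (scaleC_L2 c v) = scaleC_L2 c (wdx v)"
  using H10_set_lincomb[OF v w, of 1 1] H10_set_lincomb[OF v w, of 1 "-1"]
    H10_set_lincomb[OF v w, of "-1" 0] H10_set_lincomb[OF v w, of "of_real r" 0]
    H10_set_lincomb[OF v w, of c 0]
  by (simp_all add: scaleC_L2_simps scaleR_scaleC_L2)

lemma H10_set_closed:
  assumes v: "\<And>n. v n \<in> H10_set" and lim: "v \<longlonglongrightarrow> v'" "(\<lambda>n. wdx (v n)) \<longlonglongrightarrow> g"
  shows "v' \<in> H10_set" "wdx v' = g"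
proof -
  have "\<exists>\<phi> :: real \<Rightarrow> complex. test_function 0 pi \<phi> \<and> dist (L2_of \<phi>) (v n) < 1 / real (Suc n) \<and>
      dist (L2_of (vderiv \<phi>)) (wdx (v n)) < 1 / real (Suc n)" for n
  proof -
    obtain \<phi> :: "nat \<Rightarrow> real \<Rightarrow> complex" where \<phi>: "\<And>n. test_function 0 pi (\<phi> n)" "(\<lambda>n. L2_of (\<phi> n)) \<longlonglongrightarrow> v n"
      "(\<lambda>n. L2_of (vderiv (\<phi> n))) \<longlonglongrightarrow> wdx (v n)" "has_weak_dx (v n) (wdx (v n))" by (rule H10_setE[OF v[of n]], rule that)
    have "\<forall>\<^sub>F m in sequentially. dist (L2_of (\<phi> m)) (v n) < 1 / real (Suc n)"
      "\<forall>\<^sub>F m in sequentially. dist (L2_of (vderiv (\<phi> m))) (wdx (v n)) < 1 / real (Suc n)"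
      using \<phi>(2,3) by (auto intro!: tendstoD)
    then have "\<forall>\<^sub>F m in sequentially. dist (L2_of (\<phi> m)) (v n) < 1 / real (Suc n) \<and>
      dist (L2_of (vderiv (\<phi> m))) (wdx (v n)) < 1 / real (Suc n)" by (rule eventually_conj)
    then obtain m where "dist (L2_of (\<phi> m)) (v n) < 1 / real (Suc n)"
      "dist (L2_of (vderiv (\<phi> m))) (wdx (v n)) < 1 / real (Suc n)"
      by (metis (no_types, lifting) eventually_sequentially order_refl)
    then show ?thesis using \<phi>(1) by blast
  qed
  then obtain \<phi> :: "nat \<Rightarrow> real \<Rightarrow> complex" where \<phi>: "\<And>n. test_function 0 pi (\<phi> n)"
    "\<And>n. dist (L2_of (\<phi> n)) (v n) < 1 / real (Suc n)"
    "\<And>n. dist (L2_of (vderiv (\<phi> n))) (wdx (v n)) < 1 / real (Suc n)"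
    by metis
  have *: "X \<longlonglongrightarrow> z" if "\<And>n. dist (X n) (Y n) < 1 / real (Suc n)" "Y \<longlonglongrightarrow> z"
    for X Y :: "nat \<Rightarrow> L2" and z
  proof -
    have "(\<lambda>n. dist (X n) (Y n)) \<longlonglongrightarrow> 0"
      by (rule tendsto_sandwich[OF _ _ tendsto_const LIMSEQ_Suc[OF lim_1_over_n]])
         (use less_imp_le[OF that(1)] in \<open>auto intro!: always_eventually\<close>)
    then have "(\<lambda>n. X n - Y n) \<longlonglongrightarrow> 0" by (simp add: dist_norm tendsto_norm_zero_iff)
    from tendsto_add[OF this that(2)] show ?thesis by simp
  qed
  have l: "(\<lambda>n. L2_of (\<phi> n)) \<longlonglongrightarrow> v'" "(\<lambda>n. L2_of (vderiv (\<phi> n))) \<longlonglongrightarrow> g"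
    using *[OF \<phi>(2) lim(1)] *[OF \<phi>(3) lim(2)] .
  show "v' \<in> H10_set" "wdx v' = g" by (rule H10_setI[OF \<phi>(1) l])+
qed

typedef H10 = H10_set
  using H10_set_zero by blast

setup_lifting type_definition_H10

lift_definition Dx :: "H10 \<Rightarrow> L2" is wdx .

instantiation H10 :: real_vector
begin
lift_definition zero_H10 :: H10 is 0 by (rule H10_set_zero)
lift_definition plus_H10 :: "H10 \<Rightarrow> H10 \<Rightarrow> H10" is "(+)" by (rule H10_set_ops)
lift_definition minus_H10 :: "H10 \<Rightarrow> H10 \<Rightarrow> H10" is "(-)" by (rule H10_set_ops)
lift_definition uminus_H10 :: "H10 \<Rightarrow> H10" is uminus by (rule H10_set_ops)
lift_definition scaleR_H10 :: "real \<Rightarrow> H10 \<Rightarrow> H10" is "(*\<^sub>R)" by (rule H10_set_ops)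
instance
  by standard (transfer; simp add: algebra_simps)+
end

lift_definition scaleC_H10 :: "complex \<Rightarrow> H10 \<Rightarrow> H10" is scaleC_L2
  by (rule H10_set_ops)

lemma Dx_ops:
  "Dx 0 = 0" "Dx (v + w) = Dx v + Dx w" "Dx (v - w) = Dx v - Dx w" "Dx (- v) = - Dx v"
  "Dx (r *\<^sub>R v) = r *\<^sub>R Dx v" "Dx (scaleC_H10 c v) = scaleC_L2 c (Dx v)"
  by (transfer; simp add: H10_set_zero H10_set_ops)+

lemma poincare_H10: "norm (Rep_H10 v) \<le> pi * norm (Dx v)"
  by transfer (rule poincare)

instantiation H10 :: real_inner
begin
definition inner_H10 :: "H10 \<Rightarrow> H10 \<Rightarrow> real" where "inner_H10 v w = Dx v \<bullet> Dx w"
definition norm_H10 :: "H10 \<Rightarrow> real" where "norm_H10 v = norm (Dx v)"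
definition sgn_H10 :: "H10 \<Rightarrow> H10" where "sgn_H10 v = v /\<^sub>R norm v"
definition dist_H10 :: "H10 \<Rightarrow> H10 \<Rightarrow> real" where "dist_H10 v w = norm (v - w)"
definition uniformity_H10 :: "(H10 \<times> H10) filter" where
  "uniformity_H10 = (INF e\<in>{0 <..}. principal {(v, w). dist v w < e})"
definition open_H10 :: "H10 set \<Rightarrow> bool" where
  "open_H10 U \<longleftrightarrow> (\<forall>v\<in>U. \<forall>\<^sub>F (v', w) in uniformity. v' = v \<longrightarrow> w \<in> U)"
instance
proof
  fix u v w :: H10 and r :: real
  show "sgn v = v /\<^sub>R norm v" by (rule sgn_H10_def)
  show "dist v w = norm (v - w)" by (rule dist_H10_def)
  show "uniformity = (INF e\<in>{0 <..}. principal {(v :: H10, w). dist v w < e})"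
    by (rule uniformity_H10_def)
  show "open U \<longleftrightarrow> (\<forall>v\<in>U. \<forall>\<^sub>F (v', w) in uniformity. v' = v \<longrightarrow> w \<in> U)" for U :: "H10 set"
    by (rule open_H10_def)
  show "v \<bullet> w = w \<bullet> v" by (simp add: inner_H10_def inner_commute)
  show "(u + v) \<bullet> w = u \<bullet> w + v \<bullet> w" by (simp add: inner_H10_def Dx_ops inner_add_left)
  show "r *\<^sub>R v \<bullet> w = r * (v \<bullet> w)" by (simp add: inner_H10_def Dx_ops)
  show "0 \<le> v \<bullet> v" by (simp add: inner_H10_def)
  show "v \<bullet> v = 0 \<longleftrightarrow> v = 0"
  proof
    assume "v \<bullet> v = 0"
    then have "Dx v = 0" by (simp add: inner_H10_def)
    then have "Rep_H10 v = 0" using poincare_H10[of v] by simp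
    then show "v = 0" by transfer
  qed (simp add: inner_H10_def Dx_ops)
  show "norm v = sqrt (v \<bullet> v)" by (simp add: inner_H10_def norm_H10_def norm_eq_sqrt_inner)
qed
end

lemma norm_Rep_H10: "norm (Rep_H10 v) \<le> pi * norm v"
  using poincare_H10 by (simp add: norm_H10_def)

instance H10 :: banach
proof
  fix X :: "nat \<Rightarrow> H10" assume X: "Cauchy X"
  have dD: "dist (Dx v) (Dx w) = dist v w" for v w
    by (simp add: dist_norm norm_H10_def Dx_ops)
  have dR: "dist (Rep_H10 v) (Rep_H10 w) \<le> pi * dist v w" for v w
    using norm_Rep_H10[of "v - w"] by (simp add: dist_norm minus_H10.rep_eq)
  have "Cauchy (\<lambda>n. Dx (X n))" using X by (simp add: Cauchy_def dD)
  then obtain g where g: "(\<lambda>n. Dx (X n)) \<longlonglongrightarrow> g"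
    by (auto simp: Cauchy_convergent_iff convergent_def)
  have "Cauchy (\<lambda>n. Rep_H10 (X n))"
  proof (rule metric_CauchyI)
    fix e :: real assume "e > 0"
    then obtain M where "\<forall>m\<ge>M. \<forall>n\<ge>M. dist (X m) (X n) < e / pi"
      using X unfolding Cauchy_def by (metis divide_pos_pos pi_gt_zero)
    then show "\<exists>M. \<forall>m\<ge>M. \<forall>n\<ge>M. dist (Rep_H10 (X m)) (Rep_H10 (X n)) < e"
      using dR by (intro exI[of _ M]) (metis le_less_trans pi_gt_zero pos_less_divide_eq mult.commute)
  qed
  then obtain v where v: "(\<lambda>n. Rep_H10 (X n)) \<longlonglongrightarrow> v"
    by (auto simp: Cauchy_convergent_iff convergent_def)
  note * = H10_set_closed[OF Rep_H10 v g[unfolded Dx.rep_eq]]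
  have "Dx (Abs_H10 v) = g" using * by (simp add: Dx.rep_eq Abs_H10_inverse)
  then have "(\<lambda>n. dist (X n) (Abs_H10 v)) \<longlonglongrightarrow> 0"
    using tendsto_dist_iff[THEN iffD1, OF g] dD[of _ "Abs_H10 v"] by simp
  then have "X \<longlonglongrightarrow> Abs_H10 v" by (rule tendsto_dist_iff[THEN iffD2])
  then show "convergent X" by (auto simp: convergent_def)
qed

instance H10 :: second_countable_topology
proof
  show "\<exists>B::H10 set set. countable B \<and> open = generate_topology B"
    by (rule second_countable_isometry[of Dx]) (simp add: dist_norm norm_H10_def Dx_ops)
qed

lemma bounded_linear_Rep_H10: "bounded_linear Rep_H10"
  by (rule bounded_linear_intro[where K = pi])
     (auto simp: plus_H10.rep_eq scaleR_H10.rep_eq norm_Rep_H10 mult.commute)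

lemma bounded_linear_Dx: "bounded_linear Dx"
  by (rule bounded_linear_intro[where K = 1]) (auto simp: Dx_ops norm_H10_def)

subsection \<open>The anti-dual \<open>V' = H\<^sup>-\<^sup>1((0,\<pi>); \<complex>)\<close>\<close>

text \<open>
The anti-dual of \<open>V\<close>: bounded real-linear functionals that are conjugate-homogeneous, with the operator norm.
\<close>

typedef Hm1 = "{l :: H10 \<Rightarrow>\<^sub>L complex.
    \<forall>c v. blinfun_apply l (scaleC_H10 c v) = cnj c * blinfun_apply l v}"
  by (rule exI[of _ 0]) simp

setup_lifting type_definition_Hm1
lifting_forget H10.lifting
lifting_forget L2.lifting

lift_definition dual_pair :: "Hm1 \<Rightarrow> H10 \<Rightarrow> complex" is blinfun_apply .

instantiation Hm1 :: real_vector
begin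
lift_definition zero_Hm1 :: Hm1 is 0 by simp
lift_definition plus_Hm1 :: "Hm1 \<Rightarrow> Hm1 \<Rightarrow> Hm1" is "(+)"
  by (simp add: blinfun.add_left algebra_simps)
lift_definition minus_Hm1 :: "Hm1 \<Rightarrow> Hm1 \<Rightarrow> Hm1" is "(-)"
  by (simp add: blinfun.diff_left algebra_simps)
lift_definition uminus_Hm1 :: "Hm1 \<Rightarrow> Hm1" is uminus
  by (simp add: blinfun.minus_left)
lift_definition scaleR_Hm1 :: "real \<Rightarrow> Hm1 \<Rightarrow> Hm1" is "(*\<^sub>R)"
  by (simp add: blinfun.scaleR_left)
instance
proof
  fix j k l :: Hm1 and r s :: real
  show "j + k + l = j + (k + l)" "j + k = k + j" "0 + j = j" "- j + j = 0" "j - k = j + - k"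
    by (transfer; simp)+
  show "r *\<^sub>R (j + k) = r *\<^sub>R j + r *\<^sub>R k" "(r + s) *\<^sub>R j = r *\<^sub>R j + s *\<^sub>R j"
    "r *\<^sub>R s *\<^sub>R j = (r * s) *\<^sub>R j" "1 *\<^sub>R j = j"
    by (transfer; simp add: algebra_simps)+
qed
end

instantiation Hm1 :: real_normed_vector
begin
lift_definition norm_Hm1 :: "Hm1 \<Rightarrow> real" is norm .
lift_definition sgn_Hm1 :: "Hm1 \<Rightarrow> Hm1" is sgn
  by (simp add: sgn_blinfun_def blinfun.scaleR_left)
definition dist_Hm1 :: "Hm1 \<Rightarrow> Hm1 \<Rightarrow> real" where "dist_Hm1 k l = norm (k - l)"
definition uniformity_Hm1 :: "(Hm1 \<times> Hm1) filter" where
  "uniformity_Hm1 = (INF e\<in>{0 <..}. principal {(k, l). dist k l < e})"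
definition open_Hm1 :: "Hm1 set \<Rightarrow> bool" where
  "open_Hm1 U \<longleftrightarrow> (\<forall>k\<in>U. \<forall>\<^sub>F (k', l) in uniformity. k' = k \<longrightarrow> l \<in> U)"
instance
proof
  fix j k :: Hm1 and r :: real
  show "sgn j = j /\<^sub>R norm j" by transfer (simp add: sgn_div_norm)
  show "dist j k = norm (j - k)" by (rule dist_Hm1_def)
  show "uniformity = (INF e\<in>{0 <..}. principal {(k :: Hm1, l). dist k l < e})"
    by (rule uniformity_Hm1_def)
  show "open U \<longleftrightarrow> (\<forall>k\<in>U. \<forall>\<^sub>F (k', l) in uniformity. k' = k \<longrightarrow> l \<in> U)" for U :: "Hm1 set"
    by (rule open_Hm1_def)
  show "norm j = 0 \<longleftrightarrow> j = 0" by transfer simp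
  show "norm (j + k) \<le> norm j + norm k" by transfer (rule norm_triangle_ineq)
  show "norm (r *\<^sub>R j) = \<bar>r\<bar> * norm j" by transfer simp
qed
end

lemma dual_pair_ops:
  "dual_pair (k + l) v = dual_pair k v + dual_pair l v"
  "dual_pair (k - l) v = dual_pair k v - dual_pair l v"
  "dual_pair (r *\<^sub>R l) v = r *\<^sub>R dual_pair l v"
  "dual_pair 0 v = 0"
  "dual_pair l (scaleC_H10 c v) = cnj c * dual_pair l v"
  "dual_pair l (v + w) = dual_pair l v + dual_pair l w"
  by (transfer; simp add: blinfun.add_left blinfun.diff_left blinfun.scaleR_left blinfun.add_right)+

lemma dual_pair_bound: "cmod (dual_pair l v) \<le> norm l * norm v"
  by transfer (rule norm_blinfun)

lemma Hm1_eqI: "(\<And>v. dual_pair k v = dual_pair l v) \<Longrightarrow> k = l"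
  by (simp add: dual_pair.rep_eq blinfun_eqI flip: Rep_Hm1_inject)

lemma norm_Hm1_le:
  assumes "0 \<le> C" "\<And>v. cmod (dual_pair l v) \<le> C * norm v"
  shows "norm l \<le> C"
  using assms unfolding norm_Hm1.rep_eq dual_pair.rep_eq by (rule norm_blinfun_bound)

instance Hm1 :: banach
proof
  fix X :: "nat \<Rightarrow> Hm1" assume "Cauchy X"
  then have "Cauchy (\<lambda>n. Rep_Hm1 (X n))"
    by (simp add: Cauchy_def dist_norm norm_Hm1.rep_eq minus_Hm1.rep_eq)
  then obtain l where l: "(\<lambda>n. Rep_Hm1 (X n)) \<longlonglongrightarrow> l"
    by (auto simp: Cauchy_convergent_iff convergent_def)
  have pt: "(\<lambda>n. blinfun_apply (Rep_Hm1 (X n)) v) \<longlonglongrightarrow> blinfun_apply l v" for v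
    by (intro blinfun.tendsto l tendsto_const)
  have "blinfun_apply l (scaleC_H10 c v) = cnj c * blinfun_apply l v" for c v
  proof (rule LIMSEQ_unique[OF pt])
    have "blinfun_apply (Rep_Hm1 (X n)) (scaleC_H10 c v) = cnj c * blinfun_apply (Rep_Hm1 (X n)) v" for n
      using Rep_Hm1[of "X n"] by simp
    then show "(\<lambda>n. blinfun_apply (Rep_Hm1 (X n)) (scaleC_H10 c v)) \<longlonglongrightarrow> cnj c * blinfun_apply l v"
      using tendsto_mult[OF tendsto_const pt] by simp
  qed
  then have r: "Rep_Hm1 (Abs_Hm1 l) = l" by (simp add: Abs_Hm1_inverse)
  have "(\<lambda>n. norm (Rep_Hm1 (X n) - l)) \<longlonglongrightarrow> 0"
    using l by (simp add: LIM_zero tendsto_norm_zero)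
  then have "(\<lambda>n. dist (X n) (Abs_Hm1 l)) \<longlonglongrightarrow> 0"
    by (simp add: dist_norm norm_Hm1.rep_eq minus_Hm1.rep_eq r)
  then have "X \<longlonglongrightarrow> Abs_Hm1 l" by (rule tendsto_dist_iff[THEN iffD2])
  then show "convergent X" by (auto simp: convergent_def)
qed

lemma bounded_linear_cinner_Rep: "bounded_linear (\<lambda>w. cinner_L2 h (Rep_H10 w))"
  by (rule bounded_linear_compose[OF bounded_linear_cinner_right bounded_linear_Rep_H10])

lemma bounded_linear_cinner_Dx: "bounded_linear (\<lambda>w. cinner_L2 g (Dx w))"
  by (rule bounded_linear_compose[OF bounded_linear_cinner_right bounded_linear_Dx])

text \<open>
The embedding \<open>H \<subseteq> V'\<close> of the Gelfand triple.
\<close>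

lift_definition L2_to_Hm1 :: "L2 \<Rightarrow> Hm1" is "\<lambda>h. Blinfun (\<lambda>w. cinner_L2 h (Rep_H10 w))"
  by (simp add: bounded_linear_Blinfun_apply[OF bounded_linear_cinner_Rep] scaleC_H10.rep_eq
      cinner_L2_scaleC_right)

lift_definition neg_div :: "L2 \<Rightarrow> Hm1" is "\<lambda>g. Blinfun (\<lambda>w. cinner_L2 g (Dx w))"
  by (simp add: bounded_linear_Blinfun_apply[OF bounded_linear_cinner_Dx] Dx_ops cinner_L2_scaleC_right)

lemma dual_pair_L2: "dual_pair (L2_to_Hm1 h) w = cinner_L2 h (Rep_H10 w)"
  by transfer (simp add: bounded_linear_Blinfun_apply[OF bounded_linear_cinner_Rep])

lemma dual_pair_neg_div: "dual_pair (neg_div g) w = cinner_L2 g (Dx w)"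
  by transfer (simp add: bounded_linear_Blinfun_apply[OF bounded_linear_cinner_Dx])

lemma bounded_linear_L2_to_Hm1: "bounded_linear L2_to_Hm1"
proof (rule bounded_linear_intro[where K = pi])
  show "norm (L2_to_Hm1 h) \<le> norm h * pi" for h
  proof (rule norm_Hm1_le)
    fix v
    have "cmod (cinner_L2 h (Rep_H10 v)) \<le> norm h * norm (Rep_H10 v)" by (rule cinner_L2_bound)
    also have "\<dots> \<le> norm h * (pi * norm v)" by (intro mult_left_mono norm_Rep_H10) auto
    finally show "cmod (dual_pair (L2_to_Hm1 h) v) \<le> norm h * pi * norm v" by (simp add: dual_pair_L2)
  qed simp
qed (auto intro!: Hm1_eqI simp: dual_pair_ops dual_pair_L2 cinner_L2_add_left cinner_L2_scaleR_left)

lemma bounded_linear_neg_div: "bounded_linear neg_div"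
proof (rule bounded_linear_intro[where K = 1])
  show "norm (neg_div g) \<le> norm g * 1" for g
    using cinner_L2_bound[of g] by (intro norm_Hm1_le) (auto simp: dual_pair_neg_div norm_H10_def)
qed (auto intro!: Hm1_eqI simp: dual_pair_ops dual_pair_neg_div cinner_L2_add_left cinner_L2_scaleR_left)

lemma inj_L2_to_Hm1: "inj L2_to_Hm1"
proof (rule injI)
  fix g h assume eq: "L2_to_Hm1 g = L2_to_Hm1 h"
  interpret bounded_linear L2_to_Hm1 by (rule bounded_linear_L2_to_Hm1)
  have 0: "L2_to_Hm1 (g - h) = 0" using eq by (simp add: diff)
  have "g - h = 0"
  proof (rule L2_eq_0I)
    fix \<phi> :: "real \<Rightarrow> real" assume "test_function 0 pi \<phi>"
    then have "L2_real \<phi> \<in> H10_set"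
      unfolding L2_real_def by (intro H10_set_test test_function_of_real)
    then have "cinner_L2 (g - h) (L2_real \<phi>) = dual_pair (L2_to_Hm1 (g - h)) (Abs_H10 (L2_real \<phi>))"
      by (simp add: dual_pair_L2 Abs_H10_inverse)
    then show "cinner_L2 (g - h) (L2_real \<phi>) = 0" by (simp add: 0 dual_pair_ops)
  qed
  then show "g = h" by simp
qed

lemma surj_neg_div_Dx: "\<exists>v. l = neg_div (Dx v)"
proof -
  have bl: "bounded_linear (\<lambda>w. Re (dual_pair l w))"
  proof -
    have "bounded_linear (\<lambda>w. blinfun_apply (Rep_Hm1 l) w)" by (rule blinfun.bounded_linear_right)
    from bounded_linear_compose[OF bounded_linear_Re this] show ?thesis
      by (simp add: dual_pair.rep_eq)
  qed
  obtain v where v: "\<And>w. Re (dual_pair l w) = v \<bullet> w"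
    using riesz_representation[OF bl] by blast
  have re: "Re (dual_pair l w) = Re (dual_pair (neg_div (Dx v)) w)" for w
    by (simp add: v inner_H10_def dual_pair_neg_div Re_cinner_L2)
  have "l = neg_div (Dx v)"
  proof (rule Hm1_eqI, rule complex_eqI[OF re])
    fix w
    show "Im (dual_pair l w) = Im (dual_pair (neg_div (Dx v)) w)"
      using re[of "scaleC_H10 \<i> w"] by (simp add: dual_pair_ops)
  qed
  then show ?thesis by blast
qed

instance Hm1 :: second_countable_topology
proof
  have "continuous_on UNIV (\<lambda>v. neg_div (Dx v))"
    by (intro linear_continuous_on bounded_linear_compose[OF bounded_linear_neg_div bounded_linear_Dx])
  moreover have "surj (\<lambda>v. neg_div (Dx v))"
    using surj_neg_div_Dx by (auto simp: surj_def)
  ultimately show "\<exists>B::Hm1 set set. countable B \<and> open = generate_topology B"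
    by (rule second_countable_surj)
qed

subsection \<open>The space \<open>L\<^sup>\<infinity>((0,\<pi>); \<real>)\<close>\<close>

definition ess_bounded :: "(real \<Rightarrow> real) \<Rightarrow> bool" where
  "ess_bounded b \<longleftrightarrow> b \<in> borel_measurable Om \<and> esssup Om (\<lambda>x. ereal \<bar>b x\<bar>) < \<infinity>"

definition Linf_rel :: "(real \<Rightarrow> real) \<Rightarrow> (real \<Rightarrow> real) \<Rightarrow> bool" where
  "Linf_rel f g \<longleftrightarrow> ess_bounded f \<and> ess_bounded g \<and> (AE x in Om. f x = g x)"

lemma emeasure_Om: "emeasure Om (space Om) \<noteq> 0"
  by (simp add: emeasure_restrict_space)

lemma esssup_Om_nonneg: "0 \<le> esssup Om (\<lambda>x. ereal \<bar>b x\<bar>)"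
proof (rule ccontr)
  assume a: "\<not> 0 \<le> esssup Om (\<lambda>x. ereal \<bar>b x\<bar>)"
  have "AE x in Om. False"
    using esssup_AE[of "\<lambda>x. ereal \<bar>b x\<bar>" Om]
  proof eventually_elim
    case (elim x)
    have "0 \<le> ereal \<bar>b x\<bar>" by simp
    then show ?case using elim a by (meson order_trans)
  qed
  then show False using emeasure_Om ae_filter_eq_bot_iff[of Om] unfolding eventually_False by blast
qed

lemma esssup_Om_le:
  assumes "b \<in> borel_measurable Om" "AE x in Om. \<bar>b x\<bar> \<le> C"
  shows "esssup Om (\<lambda>x. ereal \<bar>b x\<bar>) \<le> ereal C"
  using assms by (intro esssup_I) auto

lemma ess_boundedI:
  assumes "b \<in> borel_measurable Om" "AE x in Om. \<bar>b x\<bar> \<le> C"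
  shows "ess_bounded b"
  using assms esssup_Om_le[OF assms] unfolding ess_bounded_def by auto

lemma ess_boundedE:
  assumes "ess_bounded b"
  shows "b \<in> borel_measurable Om"
    "AE x in Om. \<bar>b x\<bar> \<le> real_of_ereal (esssup Om (\<lambda>x. ereal \<bar>b x\<bar>))"
proof -
  show "b \<in> borel_measurable Om" using assms by (simp add: ess_bounded_def)
  have e: "esssup Om (\<lambda>x. ereal \<bar>b x\<bar>) = ereal (real_of_ereal (esssup Om (\<lambda>x. ereal \<bar>b x\<bar>)))"
    using assms esssup_Om_nonneg[of b] by (cases "esssup Om (\<lambda>x. ereal \<bar>b x\<bar>)") (auto simp: ess_bounded_def)
  show "AE x in Om. \<bar>b x\<bar> \<le> real_of_ereal (esssup Om (\<lambda>x. ereal \<bar>b x\<bar>))"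
    using esssup_AE[of "\<lambda>x. ereal \<bar>b x\<bar>" Om]
    by eventually_elim (metis e ereal_less_eq(3))
qed

lemma ess_bounded_lincomb:
  assumes "ess_bounded f" "ess_bounded g"
  shows "ess_bounded (\<lambda>x. r * f x + s * g x)"
proof (rule ess_boundedI)
  let ?C = "\<bar>r\<bar> * real_of_ereal (esssup Om (\<lambda>x. ereal \<bar>f x\<bar>)) + \<bar>s\<bar> * real_of_ereal (esssup Om (\<lambda>x. ereal \<bar>g x\<bar>))"
  show "AE x in Om. \<bar>r * f x + s * g x\<bar> \<le> ?C"
    using ess_boundedE(2)[OF assms(1)] ess_boundedE(2)[OF assms(2)]
  proof eventually_elim
    case (elim x)
    have "\<bar>r * f x + s * g x\<bar> \<le> \<bar>r\<bar> * \<bar>f x\<bar> + \<bar>s\<bar> * \<bar>g x\<bar>"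
      using abs_triangle_ineq[of "r * f x" "s * g x"] by (simp add: abs_mult)
    also have "\<dots> \<le> ?C" using elim by (intro add_mono mult_left_mono) auto
    finally show ?case .
  qed
qed (use ess_boundedE(1)[OF assms(1)] ess_boundedE(1)[OF assms(2)] in measurable)

lemma ess_bounded_const: "ess_bounded (\<lambda>x. c)"
  by (rule ess_boundedI[where C = "\<bar>c\<bar>"]) auto

lemma ess_bounded_ops:
  assumes "ess_bounded f" "ess_bounded g"
  shows "ess_bounded (\<lambda>x. f x + g x)" "ess_bounded (\<lambda>x. f x - g x)"
    "ess_bounded (\<lambda>x. - f x)" "ess_bounded (\<lambda>x. r * f x)"
  using ess_bounded_lincomb[OF assms, of 1 1] ess_bounded_lincomb[OF assms, of 1 "-1"]
    ess_bounded_lincomb[OF assms, of "-1" 0] ess_bounded_lincomb[OF assms, of r 0] by simp_all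

quotient_type Linf = "real \<Rightarrow> real" / partial: Linf_rel
proof (rule part_equivpI)
  show "\<exists>f. Linf_rel f f"
    by (rule exI[of _ "\<lambda>x. 0"]) (simp add: Linf_rel_def ess_bounded_const)
  show "symp Linf_rel"
    unfolding symp_def Linf_rel_def by (auto simp: eq_commute)
  show "transp Linf_rel"
    unfolding transp_def Linf_rel_def by (auto elim: AE_mp)
qed

instantiation Linf :: real_vector
begin
lift_definition zero_Linf :: Linf is "\<lambda>x. 0"
  by (simp add: Linf_rel_def ess_bounded_const)
lift_definition plus_Linf :: "Linf \<Rightarrow> Linf \<Rightarrow> Linf" is "\<lambda>f g x. f x + g x"
  unfolding Linf_rel_def by (auto intro: ess_bounded_ops elim!: AE_mp)
lift_definition minus_Linf :: "Linf \<Rightarrow> Linf \<Rightarrow> Linf" is "\<lambda>f g x. f x - g x"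
  unfolding Linf_rel_def by (auto intro: ess_bounded_ops elim!: AE_mp)
lift_definition uminus_Linf :: "Linf \<Rightarrow> Linf" is "\<lambda>f x. - f x"
  unfolding Linf_rel_def by (auto intro: ess_bounded_ops)
lift_definition scaleR_Linf :: "real \<Rightarrow> Linf \<Rightarrow> Linf" is "\<lambda>r f x. r * f x"
  unfolding Linf_rel_def by (auto intro: ess_bounded_ops elim!: AE_mp)
instance
proof
  fix f g h :: Linf and r s :: real
  note eb = ess_bounded_const ess_bounded_ops
  show "f + g + h = f + (g + h)"
    by transfer (auto simp: Linf_rel_def algebra_simps intro!: eb)
  show "f + g = g + f"
    by transfer (auto simp: Linf_rel_def algebra_simps intro!: eb)
  show "0 + f = f"
    by transfer (auto simp: Linf_rel_def algebra_simps intro!: eb)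
  show "- f + f = 0"
    by transfer (auto simp: Linf_rel_def algebra_simps intro!: eb)
  show "f - g = f + - g"
    by transfer (auto simp: Linf_rel_def algebra_simps intro!: eb)
  show "r *\<^sub>R (f + g) = r *\<^sub>R f + r *\<^sub>R g"
    by transfer (auto simp: Linf_rel_def algebra_simps intro!: eb)
  show "(r + s) *\<^sub>R f = r *\<^sub>R f + s *\<^sub>R f"
    by transfer (auto simp: Linf_rel_def algebra_simps intro!: eb)
  show "r *\<^sub>R s *\<^sub>R f = (r * s) *\<^sub>R f"
    by transfer (auto simp: Linf_rel_def algebra_simps intro!: eb)
  show "1 *\<^sub>R f = f"
    by transfer (auto simp: Linf_rel_def algebra_simps intro!: eb)
qed
end

instantiation Linf :: real_normed_vector
begin
lift_definition norm_Linf :: "Linf \<Rightarrow> real" is "\<lambda>f. real_of_ereal (esssup Om (\<lambda>x. ereal \<bar>f x\<bar>))"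
proof -
  fix f g assume "Linf_rel f g"
  then have "f \<in> borel_measurable Om" "g \<in> borel_measurable Om" "AE x in Om. f x = g x"
    by (auto simp: Linf_rel_def ess_bounded_def)
  then have "esssup Om (\<lambda>x. ereal \<bar>f x\<bar>) = esssup Om (\<lambda>x. ereal \<bar>g x\<bar>)"
    by (intro esssup_AE_cong) auto
  then show "real_of_ereal (esssup Om (\<lambda>x. ereal \<bar>f x\<bar>)) = real_of_ereal (esssup Om (\<lambda>x. ereal \<bar>g x\<bar>))"
    by simp
qed
definition sgn_Linf :: "Linf \<Rightarrow> Linf" where "sgn_Linf f = f /\<^sub>R norm f"
definition dist_Linf :: "Linf \<Rightarrow> Linf \<Rightarrow> real" where "dist_Linf f g = norm (f - g)"
definition uniformity_Linf :: "(Linf \<times> Linf) filter" where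
  "uniformity_Linf = (INF e\<in>{0 <..}. principal {(f, g). dist f g < e})"
definition open_Linf :: "Linf set \<Rightarrow> bool" where
  "open_Linf U \<longleftrightarrow> (\<forall>f\<in>U. \<forall>\<^sub>F (f', g) in uniformity. f' = f \<longrightarrow> g \<in> U)"
instance
proof
  fix f g :: Linf and r :: real
  let ?N = "\<lambda>f. real_of_ereal (esssup Om (\<lambda>x. ereal \<bar>f x\<bar>))"
  have le: "?N b \<le> C" if "b \<in> borel_measurable Om" "AE x in Om. \<bar>b x\<bar> \<le> C" "0 \<le> C" for b :: "real \<Rightarrow> real" and C
    using esssup_Om_le[OF that(1,2)] esssup_Om_nonneg[of b] that(3)
    by (cases "esssup Om (\<lambda>x. ereal \<bar>b x\<bar>)") auto
  have nn: "0 \<le> ?N b" for b :: "real \<Rightarrow> real"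
    using esssup_Om_nonneg[of b] by (simp add: real_of_ereal_pos)
  show "sgn f = f /\<^sub>R norm f" by (rule sgn_Linf_def)
  show "dist f g = norm (f - g)" by (rule dist_Linf_def)
  show "uniformity = (INF e\<in>{0 <..}. principal {(f :: Linf, g). dist f g < e})"
    by (rule uniformity_Linf_def)
  show "open U \<longleftrightarrow> (\<forall>f\<in>U. \<forall>\<^sub>F (f', g) in uniformity. f' = f \<longrightarrow> g \<in> U)" for U :: "Linf set"
    by (rule open_Linf_def)
  show "norm f = 0 \<longleftrightarrow> f = 0"
  proof transfer
    fix f assume f: "Linf_rel f f"
    then have eb: "ess_bounded f" by (simp add: Linf_rel_def)
    show "(?N f = 0) = Linf_rel f (\<lambda>x. 0)"
    proof
      assume "?N f = 0"
      then show "Linf_rel f (\<lambda>x. 0)"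
        using ess_boundedE(2)[OF eb] eb by (auto simp: Linf_rel_def ess_bounded_const)
    next
      assume "Linf_rel f (\<lambda>x. 0)"
      then have "?N f \<le> 0" using ess_boundedE(1)[OF eb] by (intro le) (auto simp: Linf_rel_def)
      then show "?N f = 0" using nn[of f] by (rule antisym)
    qed
  qed
  show "norm (f + g) \<le> norm f + norm g"
  proof transfer
    fix f g assume "Linf_rel f f" "Linf_rel g g"
    then have eb: "ess_bounded f" "ess_bounded g" by (auto simp: Linf_rel_def)
    show "?N (\<lambda>x. f x + g x) \<le> ?N f + ?N g"
    proof (rule le)
      show "AE x in Om. \<bar>f x + g x\<bar> \<le> ?N f + ?N g"
        using ess_boundedE(2)[OF eb(1)] ess_boundedE(2)[OF eb(2)] by eventually_elim linarith
    qed (use nn[of f] nn[of g] ess_boundedE(1)[OF ess_bounded_ops(1)[OF eb]] in auto)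
  qed
  have scale_le: "?N (\<lambda>x. r * f x) \<le> \<bar>r\<bar> * ?N f" if eb: "ess_bounded f" for r and f :: "real \<Rightarrow> real"
  proof (rule le)
    show "AE x in Om. \<bar>r * f x\<bar> \<le> \<bar>r\<bar> * ?N f"
      using ess_boundedE(2)[OF eb] by eventually_elim (auto simp: abs_mult intro: mult_left_mono)
  qed (use nn[of f] ess_boundedE(1)[OF ess_bounded_ops(4)[OF eb eb]] in auto)
  show "norm (r *\<^sub>R f) = \<bar>r\<bar> * norm f"
  proof transfer
    fix r f assume "Linf_rel f f"
    then have eb: "ess_bounded f" by (auto simp: Linf_rel_def)
    show "?N (\<lambda>x. r * f x) = \<bar>r\<bar> * ?N f"
    proof (cases "r = 0")
      case True
      have "?N (\<lambda>x. 0 * f x) \<le> 0" using scale_le[OF eb, of 0] by (simp only: abs_zero mult_zero_left)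
      then have "?N (\<lambda>x. 0 * f x) = 0" using nn[of "\<lambda>x. 0 * f x"] by (rule antisym)
      then show ?thesis using True by (simp only: abs_zero mult_zero_left)
    next
      case False
      have "?N f \<le> \<bar>1 / r\<bar> * ?N (\<lambda>x. r * f x)"
        using scale_le[OF ess_bounded_ops(4)[OF eb eb], of "1/r" r] False by simp
      then have "\<bar>r\<bar> * ?N f \<le> ?N (\<lambda>x. r * f x)" using False by (simp add: field_simps)
      then show ?thesis using scale_le[OF eb, of r] by simp
    qed
  qed
qed
end

text \<open>
The class of a function, meaningful for essentially bounded arguments only.
\<close>

definition Linf_of :: "(real \<Rightarrow> real) \<Rightarrow> Linf" where "Linf_of = abs_Linf"

lemma Linf_of_diff:
  assumes "ess_bounded f" "ess_bounded g"
  shows "Linf_of f - Linf_of g = Linf_of (\<lambda>x. f x - g x)"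
  unfolding Linf_of_def using assms by (subst minus_Linf.abs_eq) (auto simp: Linf_rel_def)

lemma norm_Linf_of:
  assumes "ess_bounded f"
  shows "norm (Linf_of f) = real_of_ereal (esssup Om (\<lambda>x. ereal \<bar>f x\<bar>))"
  unfolding Linf_of_def using assms by (subst norm_Linf.abs_eq) (auto simp: Linf_rel_def)

subsection \<open>The elliptic operators\<close>

text \<open>
The operator \<open>v \<mapsto> - \<partial>\<^sub>x (b \<partial>\<^sub>x v)\<close> from \<open>V\<close> to \<open>V'\<close>.  The functional exists uniquely for essentially bounded
  \<open>b\<close> (lemma \<open>dual_pair_opA\<close>).
\<close>

definition opA :: "(real \<Rightarrow> real) \<Rightarrow> H10 \<Rightarrow> Hm1" where
  "opA b v = (THE l. \<forall>w. dual_pair l w =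
     (\<integral>x. of_real (b x) * rep_L2 (Dx v) x * cnj (rep_L2 (Dx w) x) \<partial>Om))"

lemma dual_pair_opA:
  assumes "ess_bounded b"
  shows "dual_pair (opA b v) w =
    (\<integral>x. of_real (b x) * rep_L2 (Dx v) x * cnj (rep_L2 (Dx w) x) \<partial>Om)"
proof -
  define C where "C = real_of_ereal (esssup Om (\<lambda>x. ereal \<bar>b x\<bar>))"
  let ?g = "\<lambda>x. of_real (b x) * rep_L2 (Dx v) x"
  have g: "square_integrable ?g"
  proof (rule square_integrable_mult[OF square_integrable_rep])
    show "(\<lambda>x. complex_of_real (b x)) \<in> borel_measurable Om"
      using ess_boundedE(1)[OF assms] by measurable
    show "AE x in Om. cmod (complex_of_real (b x)) \<le> C"
      using ess_boundedE(2)[OF assms] by (simp add: C_def)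
  qed
  have ex: "\<forall>w. dual_pair (neg_div (L2_of ?g)) w = (\<integral>x. ?g x * cnj (rep_L2 (Dx w) x) \<partial>Om)"
    using L2_of_ops(5)[OF g square_integrable_rep] by (simp add: dual_pair_neg_div L2_of_rep)
  have "\<forall>w. dual_pair (opA b v) w = (\<integral>x. ?g x * cnj (rep_L2 (Dx w) x) \<partial>Om)"
    unfolding opA_def
  proof (rule theI[where a = "neg_div (L2_of ?g)"])
    show "l = neg_div (L2_of ?g)"
      if "\<forall>w. dual_pair l w = (\<integral>x. ?g x * cnj (rep_L2 (Dx w) x) \<partial>Om)" for l
      using that ex by (intro Hm1_eqI) simp
  qed (rule ex)
  then show ?thesis by blast
qed

definition dom_AH :: "(real \<Rightarrow> real) \<Rightarrow> H10 set" where
  "dom_AH b = {v. \<exists>h. L2_to_Hm1 h = opA b v}"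

text \<open>
Unique because \<open>H\<close> embeds injectively into \<open>V'\<close>; meaningful for \<open>v \<in> dom_AH b\<close>.
\<close>

definition AH :: "(real \<Rightarrow> real) \<Rightarrow> H10 \<Rightarrow> L2" where
  "AH b v = (THE h. L2_to_Hm1 h = opA b v)"

lemma AH_eq: "L2_to_Hm1 h = opA b v \<Longrightarrow> AH b v = h"
  unfolding AH_def using inj_L2_to_Hm1 by (auto simp: inj_def)

subsection \<open>Spaces of vector-valued functions on the time interval\<close>

abbreviation I01 :: "real measure" where "I01 \<equiv> lebesgue_on {0<..<1}"

text \<open>
  \<open>L\<^sup>p(0,1;X)\<close>.  As \<open>X\<close> is second countable, Borel measurability is strong measurability.
\<close>

definition bochner_Lp :: "nat \<Rightarrow> (real \<Rightarrow> 'a::{banach, second_countable_topology}) \<Rightarrow> bool" where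
  "bochner_Lp p u \<longleftrightarrow> u \<in> borel_measurable I01 \<and> integrable I01 (\<lambda>t. norm (u t) ^ p)"

text \<open>\<open>\<partial>\<^sub>t u \<in> L\<^sup>p(0,1;X)\<close>.\<close>

definition deriv_in_Lp :: "nat \<Rightarrow> (real \<Rightarrow> 'a::{banach, second_countable_topology}) \<Rightarrow> bool" where
  "deriv_in_Lp p u \<longleftrightarrow> (\<exists>g. bochner_Lp p g \<and> weak_deriv 0 1 u g)"

definition sobolev_W1 :: "nat \<Rightarrow> (real \<Rightarrow> 'a::{banach, second_countable_topology}) \<Rightarrow> bool" where
  "sobolev_W1 p u \<longleftrightarrow> bochner_Lp p u \<and> deriv_in_Lp p u"

definition C1_with_deriv :: "(real \<Rightarrow> 'a::real_normed_vector) \<Rightarrow> (real \<Rightarrow> 'a) \<Rightarrow> bool" where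
  "C1_with_deriv u u' \<longleftrightarrow> continuous_on {0..1} u' \<and>
     (\<forall>t\<in>{0..1}. (u has_vector_derivative u' t) (at t within {0..1}))"

text \<open>
  The norm of \<open>C\<^sup>0\<^sup>,\<^sup>\<alpha>([0,T];X)\<close>, with value \<open>\<infinity>\<close> outside of that space.
\<close>

definition holder_norm :: "real \<Rightarrow> real \<Rightarrow> (real \<Rightarrow> 'a::real_normed_vector) \<Rightarrow> ereal" where
  "holder_norm T \<alpha> g =
     (SUP t\<in>{0..T}. ereal (norm (g t))) +
     (SUP (s, t)\<in>{(s, t). s \<in> {0..T} \<and> t \<in> {0..T} \<and> s \<noteq> t}.
        ereal (norm (g t - g s) / \<bar>t - s\<bar> powr \<alpha>))"

subsection \<open>Coefficients, variational solutions and maximal regularity\<close>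

text \<open>Coefficients are functions \<open>a t x\<close>, of which only the values on \<open>[0,1] \<times> (0,\<pi>)\<close> matter.\<close>

definition elliptic_coefficient :: "(real \<Rightarrow> real \<Rightarrow> real) \<Rightarrow> bool" where
  "elliptic_coefficient a \<longleftrightarrow>
     (\<lambda>(t, x). a t x) \<in> borel_measurable (lebesgue_on ({0..1} \<times> {0<..<pi})) \<and>
     (\<exists>l L. 0 < l \<and> l \<le> L \<and>
        (AE (t, x) in lebesgue_on ({0..1} \<times> {0<..<pi}). l \<le> a t x \<and> a t x \<le> L))"

text \<open>\<open>a \<in> C\<^sup>0\<^sup>,\<^sup>\<alpha>([0,1]; L\<^sup>\<infinity>(0,\<pi>))\<close>.\<close>

definition holder_coefficient :: "real \<Rightarrow> (real \<Rightarrow> real \<Rightarrow> real) \<Rightarrow> bool" where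
  "holder_coefficient \<alpha> a \<longleftrightarrow>
     (\<forall>t\<in>{0..1}. ess_bounded (a t)) \<and> holder_norm 1 \<alpha> (\<lambda>t. Linf_of (a t)) < \<infinity>"

definition real_valued :: "L2 \<Rightarrow> bool" where
  "real_valued h \<longleftrightarrow> (AE x in Om. Im (rep_L2 h x) = 0)"

abbreviation H10_to_L2 :: "H10 \<Rightarrow> L2" where "H10_to_L2 \<equiv> Rep_H10"

abbreviation H10_to_Hm1 :: "H10 \<Rightarrow> Hm1" where "H10_to_Hm1 v \<equiv> L2_to_Hm1 (H10_to_L2 v)"

text \<open>
  Solutions are determined up to equality for a.e. \<open>t\<close>, so the initial value refers to the
  representative in \<open>C([0,1];H)\<close>.
\<close>

definition lions_solution ::
    "(real \<Rightarrow> real \<Rightarrow> real) \<Rightarrow> (real \<Rightarrow> Hm1) \<Rightarrow> L2 \<Rightarrow> (real \<Rightarrow> H10) \<Rightarrow> bool" where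
  "lions_solution a f u0 u \<longleftrightarrow>
     bochner_Lp 2 u \<and>
     (\<exists>u'. bochner_Lp 2 u' \<and> weak_deriv 0 1 (\<lambda>t. H10_to_Hm1 (u t)) u' \<and>
        (AE t in I01. u' t + opA (a t) (u t) = f t)) \<and>
     (\<exists>w. continuous_on {0..1} w \<and> (AE t in I01. w t = H10_to_L2 (u t)) \<and> w 0 = u0)"

definition maximal_L2_regularity :: "(real \<Rightarrow> real \<Rightarrow> real) \<Rightarrow> bool" where
  "maximal_L2_regularity a \<longleftrightarrow>
     (\<forall>f u. bochner_Lp 2 f \<longrightarrow> lions_solution a (\<lambda>t. L2_to_Hm1 (f t)) 0 u \<longrightarrow>
        deriv_in_Lp 2 (\<lambda>t. H10_to_L2 (u t)) \<and>
        (AE t in I01. u t \<in> dom_AH (a t)) \<and>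
        bochner_Lp 2 (\<lambda>t. AH (a t) (u t)))"

end

theory Submission
  imports Defs
begin

text \<open>
  The construction starts from the solution and reads off the coefficient.  In one space dimension the
  equation \<open>\<partial>\<^sub>t u = \<partial>\<^sub>x (a \<partial>\<^sub>x u) + f\<close> fixes the coefficient as the quotient of the flux and the slope.
  For a potential \<open>\<psi>\<close> put \<open>u = t sin x + \<partial>\<^sub>x \<psi>\<close> and prescribe the flux \<open>t cos x + \<partial>\<^sub>t \<psi>\<close>.  Since
  \<open>\<partial>\<^sub>x \<partial>\<^sub>t \<psi>\<close> is the rough part both of \<open>\<partial>\<^sub>t u\<close> and of the derivative of the flux, it cancels, the forcing
  term is \<open>(1 + t) sin x\<close> whatever \<open>\<psi>\<close> is, and \<open>a = (t cos x + \<partial>\<^sub>t \<psi>) / (t cos x + \<partial>\<^sub>x\<^sup>2 \<psi>)\<close>.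

  The potential is a small multiple of a sum of terms \<open>k\<^sup>-\<^sup>3 (1 - cos (2 \<pi> k\<^sup>2 t)) (1 - cos (k x)) / (2 \<pi>)\<close>
  on \<open>0 < x < \<pi>/4\<close>, with \<open>k\<close> running through powers of \<open>2\<close>.  Each term is in parabolic scaling, so
  \<open>\<partial>\<^sub>t \<psi>\<close> and \<open>\<partial>\<^sub>x\<^sup>2 \<psi>\<close> are lacunary sums with amplitudes \<open>1/k\<close> and time frequencies \<open>k\<^sup>2\<close>: as for the
  Weierstrass function they are Hoelder continuous of exponent \<open>1/2\<close> in time, uniformly in \<open>x\<close>
  (\<open>pulse_sum_Hoelder\<close>), and so is \<open>a\<close> (\<open>coef_pert_Hoelder\<close>).  No larger exponent works, because at
  distance about \<open>k\<^sup>-\<^sup>2\<close> from the final time the coefficient still deviates from \<open>1\<close> by about \<open>1/k\<close>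
  (\<open>coef_not_holder\<close>).  On the other hand the terms \<open>sin (2 \<pi> k\<^sup>2 t) sin (k x)\<close> of \<open>\<partial>\<^sub>x \<partial>\<^sub>t \<psi>\<close> all have
  amplitude \<open>1\<close> and are orthogonal in \<open>H\<close>, so \<open>\<parallel>\<partial>\<^sub>x \<partial>\<^sub>t \<psi>(t)\<parallel>\<^sup>2\<close> is, on average
  in time, comparable to the number of terms.

  The \<open>n\<close>th term is therefore switched on only for the last \<open>1/(n+4)\<close>, roughly, of the unit time
  interval.  The squared norm then integrates to a multiple of the harmonic series, which diverges
  (\<open>not_bochner_L2_rough_rate\<close>), while at time \<open>t\<close> at most \<open>2/(1-t)\<close> terms are active and the norm
  itself is integrable (\<open>bochner_L1_rough_rate\<close>).  A whole number of periods fits into each active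
  interval, so the terms start and end smoothly, and at every fixed time, \<open>t = 1\<close> included, the sums
  are finite; this gives \<open>u(t) \<in> D(A\<^sub>H(t))\<close> for every \<open>t\<close> (\<open>opA_rough_sol\<close>).

  Uniqueness (\<open>lions_solution_unique\<close>) is the energy argument: the difference \<open>z\<close> of two solutions
  satisfies \<open>z' = - A z\<close>, while \<open>\<integral> Re \<langle>z', z\<rangle> \<ge> 0\<close>.  That inequality is obtained by projecting onto
  finitely many sines, which are orthogonal in \<open>H\<close> and in \<open>V\<close> at once, so that only the scalar identity
  \<open>y(1)\<^sup>2 = 2 \<integral> y y'\<close> for weakly differentiable \<open>y\<close> is needed.
\<close>

section \<open>Test functions and weak derivatives\<close>

lemma integral_lebesgue_on_FTC:
  fixes F f :: "real \<Rightarrow> 'a::euclidean_space"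
  assumes ab: "a \<le> b" and F: "continuous_on {a..b} F" and K: "finite K"
    and d: "\<And>x. x \<in> {a<..<b} - K \<Longrightarrow> (F has_vector_derivative f x) (at x)"
    and f: "integrable (lebesgue_on {a<..<b}) f"
  shows "(\<integral>x. f x \<partial>lebesgue_on {a<..<b}) = F b - F a"
proof -
  have "(f has_integral F b - F a) {a..b}"
    by (rule fundamental_theorem_of_calculus_interior_strong[OF K ab d F])
  then have "(f has_integral F b - F a) {a<..<b}" by (simp add: has_integral_Icc_iff_Ioo)
  then show ?thesis
    using has_integral_unique[OF has_integral_integral_lebesgue_on[OF f]] by simp
qed

lemma test_function_measurable:
  fixes \<phi> :: "real \<Rightarrow> real"
  assumes "test_function a b \<phi>"
  shows "\<phi> \<in> borel_measurable (lebesgue_on S)"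
  using assms smooth_measurable[of \<phi>] by (simp add: test_function_def)

lemma integrable_test_scaleR:
  fixes \<phi> :: "real \<Rightarrow> real" and u :: "real \<Rightarrow> 'a::{banach, second_countable_topology}"
  assumes \<phi>: "test_function a b \<phi>" and u: "integrable (lebesgue_on {c<..<d}) u"
  shows "integrable (lebesgue_on {c<..<d}) (\<lambda>x. \<phi> x *\<^sub>R u x)"
proof -
  obtain B where B: "0 < B" "\<And>x. norm (\<phi> x) \<le> B" by (rule test_function_bounded[OF \<phi>]) blast
  show ?thesis
  proof (rule Bochner_Integration.integrable_bound)
    show "integrable (lebesgue_on {c<..<d}) (\<lambda>x. B *\<^sub>R u x)" using u by simp
    show "(\<lambda>x. \<phi> x *\<^sub>R u x) \<in> borel_measurable (lebesgue_on {c<..<d})"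
      using test_function_measurable[OF \<phi>] u by (intro borel_measurable_scaleR) auto
    show "AE x in lebesgue_on {c<..<d}. norm (\<phi> x *\<^sub>R u x) \<le> norm (B *\<^sub>R u x)"
      using B by (intro AE_I2) (auto intro!: mult_right_mono)
  qed
qed

lemma test_function_integrable:
  fixes \<phi> :: "real \<Rightarrow> real"
  assumes \<phi>: "test_function a b \<phi>"
  shows "integrable (lebesgue_on {c<..<d}) \<phi>"
proof -
  interpret finite_measure "lebesgue_on {c<..<d}" by (rule finite_measure_lebesgue_on) simp
  show ?thesis using integrable_test_scaleR[OF \<phi>, of c d "\<lambda>x. 1::real"] by simp
qed

text \<open>
  A test function is the derivative of a test function as soon as its integral vanishes, because its
  antiderivative is then zero to the right of its support as well as to the left.
\<close>

lemma test_function_antiderivative: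
  fixes \<zeta> :: "real \<Rightarrow> real"
  assumes \<zeta>: "test_function a b \<zeta>" and 0: "(\<integral>x. \<zeta> x \<partial>lebesgue_on {a<..<b}) = 0"
  shows "\<exists>\<phi>. test_function a b \<phi> \<and> vderiv \<phi> = \<zeta>"
proof (cases "a < b")
  case False
  then have "\<zeta> = (\<lambda>x. 0)" using test_function_support[OF \<zeta>] by force
  then show ?thesis using \<zeta> vderiv_zero by auto
next
  case ab: True
  have sm: "smooth \<zeta>" using \<zeta> by (simp add: test_function_def)
  have c: "continuous_on S \<zeta>" for S by (rule smooth_continuous[OF sm])
  have io: "\<zeta> integrable_on {x..y}" for x y by (intro integrable_continuous_real c)
  obtain K where K: "compact K" "K \<subseteq> {a<..<b}" "\<And>x. x \<notin> K \<Longrightarrow> \<zeta> x = 0"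
    using \<zeta> unfolding test_function_def by blast
  have "\<exists>l r. a < l \<and> r < b \<and> K \<subseteq> {l..r}"
  proof (cases "K = {}")
    case True
    obtain m where "a < m" "m < b" using dense[OF ab] by blast
    then show ?thesis using True by blast
  next
    case False
    obtain l where "l \<in> K" "\<And>x. x \<in> K \<Longrightarrow> l \<le> x" using compact_attains_inf[OF K(1) False] by blast
    moreover obtain r where "r \<in> K" "\<And>x. x \<in> K \<Longrightarrow> x \<le> r" using compact_attains_sup[OF K(1) False] by blast
    ultimately show ?thesis using K(2) by (metis atLeastAtMost_iff greaterThanLessThan_iff subset_iff)
  qed
  then obtain l r where lr: "a < l" "r < b" "K \<subseteq> {l..r}" by blast
  have z: "\<zeta> x = 0" if "x < l \<or> r < x" for x using K(3) lr(3) that by force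
  define \<phi> where "\<phi> x = integral {a..x} \<zeta>" for x
  have zero: "integral {x..y} \<zeta> = 0" if "\<And>t. x \<le> t \<Longrightarrow> t \<le> y \<Longrightarrow> t < l \<or> r < t" for x y
  proof -
    have "integral {x..y} \<zeta> = integral {x..y} (\<lambda>t. 0)"
      by (intro Henstock_Kurzweil_Integration.integral_cong z) (use that in auto)
    then show ?thesis by simp
  qed
  have "(\<integral>x. \<zeta> x \<partial>lebesgue_on {a<..<b}) = integral {a<..<b} \<zeta>"
    by (rule lebesgue_integral_eq_integral[OF test_function_integrable[OF \<zeta>]]) simp
  then have tot: "integral {a..b} \<zeta> = 0" using 0 by (simp add: integral_open_interval_real)
  have left: "\<phi> x = 0" if "x < l" for x
    unfolding \<phi>_def by (rule zero) (use that in auto)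
  have right: "\<phi> x = 0" if "r < x" for x
  proof (cases "x < a")
    case False
    have "integral {a..x} \<zeta> + integral {x..max x b} \<zeta> = integral {a..max x b} \<zeta>"
      using False by (intro Henstock_Kurzweil_Integration.integral_combine io) auto
    moreover have "integral {a..b} \<zeta> + integral {b..max x b} \<zeta> = integral {a..max x b} \<zeta>"
      using ab by (intro Henstock_Kurzweil_Integration.integral_combine io) auto
    moreover have "integral {x..max x b} \<zeta> = 0" "integral {b..max x b} \<zeta> = 0"
      using that lr by (intro zero; auto)+
    ultimately show ?thesis using tot by (simp add: \<phi>_def)
  qed (simp add: \<phi>_def)
  have d: "(\<phi> has_vector_derivative \<zeta> x) (at x)" for x
  proof (cases "x < l")
    case True
    have "((\<lambda>x. 0) has_vector_derivative \<zeta> x) (at x)" using z[of x] True by simp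
    then show ?thesis
      by (rule has_vector_derivative_transform_within_open[where S = "{..<l}"]) (use True left in auto)
  next
    case False
    then have x: "a < x" using lr by simp
    have "((\<lambda>u. integral {a..u} \<zeta>) has_vector_derivative \<zeta> x) (at x within {a..x+1})"
      by (rule integral_has_vector_derivative[OF c]) (use x in auto)
    then show ?thesis
      using x at_within_Icc_at[of a x "x+1"] by (simp add: \<phi>_def[abs_def])
  qed
  have v: "vderiv \<phi> = \<zeta>" by (rule vderiv_eq[OF d])
  have "smooth \<phi>" unfolding smooth_def
  proof (intro allI)
    fix n x show "(vderiv ^^ n) \<phi> differentiable at x"
    proof (cases n)
      case 0
      then show ?thesis using d[of x] by (auto intro: differentiableI_vector)
    next
      case (Suc m)
      have "(vderiv ^^ n) \<phi> = (vderiv ^^ m) \<zeta>" unfolding Suc funpow_Suc_right by (simp add: v)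
      then show ?thesis using sm by (simp add: smooth_def)
    qed
  qed
  moreover have "compact {l..r}" "{l..r} \<subseteq> {a<..<b}" "\<forall>x. x \<notin> {l..r} \<longrightarrow> \<phi> x = 0"
    using lr left right by force+
  ultimately have "test_function a b \<phi>" unfolding test_function_def by blast
  then show ?thesis using v by blast
qed

text \<open>
  The du Bois-Reymond lemma.  Subtracting a multiple of a fixed test function of nonzero integral turns
  any test function into a derivative.
\<close>

lemma weak_deriv_zero_imp_const:
  fixes u :: "real \<Rightarrow> 'a::{banach, second_countable_topology}"
  assumes ab: "a < b" and u: "integrable (lebesgue_on {a<..<b}) u" and w: "weak_deriv a b u (\<lambda>x. 0)"
  shows "\<exists>c. AE x in lebesgue_on {a<..<b}. u x = c"
proof -
  let ?M = "lebesgue_on {a<..<b}"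
  interpret finite_measure ?M by (rule finite_measure_lebesgue_on) simp
  have "\<exists>\<theta>. test_function a b \<theta> \<and> (\<integral>x. \<theta> x \<partial>?M) \<noteq> (0::real)"
  proof (rule ccontr)
    assume "\<not> ?thesis"
    then have "AE x in ?M. (1::real) = 0"
      by (intro AE_zero_of_test_functions) auto
    then have "emeasure ?M (space ?M) = 0"
      using ae_filter_eq_bot_iff[of ?M] by (simp add: eventually_False)
    then show False using ab by (simp add: emeasure_restrict_space)
  qed
  then obtain \<theta> where \<theta>: "test_function a b \<theta>" "(\<integral>x. \<theta> x \<partial>?M) \<noteq> (0::real)" by blast
  define m where "m = (\<integral>x. \<theta> x \<partial>?M)"
  define c where "c = (1 / m) *\<^sub>R (\<integral>x. \<theta> x *\<^sub>R u x \<partial>?M)"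
  have "AE x in ?M. u x - c = 0"
  proof (rule AE_zero_of_test_functions)
    show "integrable ?M (\<lambda>x. u x - c)" using u by simp
    fix \<zeta> :: "real \<Rightarrow> real" assume \<zeta>: "test_function a b \<zeta>"
    define q where "q = (\<integral>x. \<zeta> x \<partial>?M) / m"
    have t: "test_function a b (\<lambda>x. \<zeta> x + (- q) * \<theta> x)"
      by (rule test_function_linear[OF \<zeta> \<theta>(1) bounded_linear_ident bounded_linear_mult_right])
    note i = test_function_integrable[OF \<zeta>, of a b] test_function_integrable[OF \<theta>(1), of a b]
    have "(\<integral>x. \<zeta> x + (- q) * \<theta> x \<partial>?M) = 0"
      using i \<theta>(2) by (subst Bochner_Integration.integral_add) (auto simp: q_def m_def)
    then obtain \<phi> where \<phi>: "test_function a b \<phi>" "vderiv \<phi> = (\<lambda>x. \<zeta> x + (- q) * \<theta> x)"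
      using test_function_antiderivative[OF t] by blast
    note j = integrable_test_scaleR[OF \<zeta> u] integrable_test_scaleR[OF \<theta>(1) u]
    have "0 = (\<integral>x. vderiv \<phi> x *\<^sub>R u x \<partial>?M)"
      using w \<phi>(1) by (simp add: weak_deriv_def)
    also have "\<dots> = (\<integral>x. \<zeta> x *\<^sub>R u x - q *\<^sub>R (\<theta> x *\<^sub>R u x) \<partial>?M)"
      unfolding \<phi>(2) by (intro Bochner_Integration.integral_cong) (auto simp: algebra_simps)
    also have "\<dots> = (\<integral>x. \<zeta> x *\<^sub>R u x \<partial>?M) - q *\<^sub>R (\<integral>x. \<theta> x *\<^sub>R u x \<partial>?M)"
      using j by (subst Bochner_Integration.integral_diff) (auto simp del: scaleR_scaleR)
    also have "q *\<^sub>R (\<integral>x. \<theta> x *\<^sub>R u x \<partial>?M) = (\<integral>x. \<zeta> x \<partial>?M) *\<^sub>R c"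
      by (simp add: q_def c_def)
    finally have "(\<integral>x. \<zeta> x *\<^sub>R u x \<partial>?M) = (\<integral>x. \<zeta> x \<partial>?M) *\<^sub>R c" by simp
    moreover have "(\<integral>x. \<zeta> x *\<^sub>R (u x - c) \<partial>?M) = (\<integral>x. \<zeta> x *\<^sub>R u x \<partial>?M) - (\<integral>x. \<zeta> x \<partial>?M) *\<^sub>R c"
      using i(1) j(1) by (simp add: scaleR_diff_right)
    ultimately show "(\<integral>x. \<zeta> x *\<^sub>R (u x - c) \<partial>?M) = 0" by simp
  qed
  then show ?thesis by auto
qed

lemma weak_deriv_unique:
  fixes u :: "real \<Rightarrow> 'a::{banach, second_countable_topology}"
  assumes "weak_deriv a b u g" "weak_deriv a b u h"
    and g: "integrable (lebesgue_on {a<..<b}) g" and h: "integrable (lebesgue_on {a<..<b}) h"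
  shows "AE x in lebesgue_on {a<..<b}. g x = h x"
proof -
  have "AE x in lebesgue_on {a<..<b}. g x - h x = 0"
  proof (rule AE_zero_of_test_functions)
    show "integrable (lebesgue_on {a<..<b}) (\<lambda>x. g x - h x)" using g h by simp
    fix \<phi> :: "real \<Rightarrow> real" assume \<phi>: "test_function a b \<phi>"
    show "(\<integral>x. \<phi> x *\<^sub>R (g x - h x) \<partial>lebesgue_on {a<..<b}) = 0"
      using integrable_test_scaleR[OF \<phi> g] integrable_test_scaleR[OF \<phi> h] assms(1,2) \<phi>
      by (simp add: scaleR_diff_right weak_deriv_def)
  qed
  then show ?thesis by simp
qed

lemma weak_deriv_cong_AE:
  fixes u :: "real \<Rightarrow> 'a::{banach, second_countable_topology}"
  assumes "weak_deriv a b u g"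
    and "AE x in lebesgue_on {a<..<b}. u x = u' x" "AE x in lebesgue_on {a<..<b}. g x = g' x"
    and "u \<in> borel_measurable (lebesgue_on {a<..<b})" "u' \<in> borel_measurable (lebesgue_on {a<..<b})"
      "g \<in> borel_measurable (lebesgue_on {a<..<b})" "g' \<in> borel_measurable (lebesgue_on {a<..<b})"
  shows "weak_deriv a b u' g'"
  unfolding weak_deriv_def
proof (intro allI impI)
  let ?M = "lebesgue_on {a<..<b}"
  fix \<phi> :: "real \<Rightarrow> real" assume \<phi>: "test_function a b \<phi>"
  have "(\<integral>t. vderiv \<phi> t *\<^sub>R u' t \<partial>?M) = (\<integral>t. vderiv \<phi> t *\<^sub>R u t \<partial>?M)"
    using assms test_function_measurable[OF test_function_vderiv[OF \<phi>]]
    by (intro integral_cong_AE borel_measurable_scaleR) auto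
  moreover have "(\<integral>t. \<phi> t *\<^sub>R g' t \<partial>?M) = (\<integral>t. \<phi> t *\<^sub>R g t \<partial>?M)"
    using assms test_function_measurable[OF \<phi>]
    by (intro integral_cong_AE borel_measurable_scaleR) auto
  ultimately show "(\<integral>t. vderiv \<phi> t *\<^sub>R u' t \<partial>?M) = - (\<integral>t. \<phi> t *\<^sub>R g' t \<partial>?M)"
    using assms(1) \<phi> by (simp add: weak_deriv_def)
qed

lemma weak_deriv_bounded_linear:
  fixes u :: "real \<Rightarrow> 'a::{banach, second_countable_topology}"
    and T :: "'a \<Rightarrow> 'b::{banach, second_countable_topology}"
  assumes T: "bounded_linear T" and w: "weak_deriv a b u g"
    and u: "integrable (lebesgue_on {a<..<b}) u" and g: "integrable (lebesgue_on {a<..<b}) g"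
  shows "weak_deriv a b (\<lambda>t. T (u t)) (\<lambda>t. T (g t))"
  unfolding weak_deriv_def
proof (intro allI impI)
  interpret T: bounded_linear T by fact
  fix \<phi> :: "real \<Rightarrow> real" assume \<phi>: "test_function a b \<phi>"
  show "(\<integral>t. vderiv \<phi> t *\<^sub>R T (u t) \<partial>lebesgue_on {a<..<b}) = - (\<integral>t. \<phi> t *\<^sub>R T (g t) \<partial>lebesgue_on {a<..<b})"
    using integral_bounded_linear[OF T integrable_test_scaleR[OF test_function_vderiv[OF \<phi>] u]]
      integral_bounded_linear[OF T integrable_test_scaleR[OF \<phi> g]] w \<phi>
    by (simp add: T.scaleR T.neg weak_deriv_def)
qed

lemma weak_deriv_piecewise:
  fixes U g :: "real \<Rightarrow> 'a::euclidean_space"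
  assumes ab: "a \<le> b" and U: "continuous_on {a..b} U" and K: "finite K"
    and d: "\<And>x. x \<in> {a<..<b} - K \<Longrightarrow> (U has_vector_derivative g x) (at x)"
    and g: "integrable (lebesgue_on {a<..<b}) g"
  shows "weak_deriv a b U g"
  unfolding weak_deriv_def
proof (intro allI impI)
  let ?M = "lebesgue_on {a<..<b}"
  fix \<phi> :: "real \<Rightarrow> real" assume \<phi>: "test_function a b \<phi>"
  have sm: "smooth \<phi>" using \<phi> by (simp add: test_function_def)
  have "U absolutely_integrable_on {a..b}"
    by (rule absolutely_integrable_continuous_real[OF U])
  then have "U absolutely_integrable_on {a<..<b}"
    by (rule set_integrable_subset) auto
  then have iU: "integrable ?M U"
    by (simp add: integrable_restrict_space set_integrable_def)
  note i = integrable_test_scaleR[OF test_function_vderiv[OF \<phi>] iU] integrable_test_scaleR[OF \<phi> g]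
  have "(\<integral>x. \<phi> x *\<^sub>R g x + vderiv \<phi> x *\<^sub>R U x \<partial>?M) = \<phi> b *\<^sub>R U b - \<phi> a *\<^sub>R U a"
  proof (rule integral_lebesgue_on_FTC[OF ab _ K])
    show "continuous_on {a..b} (\<lambda>x. \<phi> x *\<^sub>R U x)"
      by (intro continuous_intros U smooth_continuous[OF sm])
    show "((\<lambda>x. \<phi> x *\<^sub>R U x) has_vector_derivative \<phi> x *\<^sub>R g x + vderiv \<phi> x *\<^sub>R U x) (at x)"
      if "x \<in> {a<..<b} - K" for x
      using smooth_has_vderiv[OF sm, of x]
      by (intro has_vector_derivative_scaleR d that) (simp add: has_real_derivative_iff_has_vector_derivative)
    show "integrable ?M (\<lambda>x. \<phi> x *\<^sub>R g x + vderiv \<phi> x *\<^sub>R U x)" using i by simp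
  qed
  also have "\<dots> = 0" using test_function_support[OF \<phi>] by simp
  finally show "(\<integral>t. vderiv \<phi> t *\<^sub>R U t \<partial>?M) = - (\<integral>t. \<phi> t *\<^sub>R g t \<partial>?M)"
    using i by (simp add: add_eq_0_iff)
qed

section \<open>Weak derivatives in \<open>H\<close> and membership in \<open>V\<close>\<close>

lemma has_weak_dx_complex_test:
  fixes \<phi> :: "real \<Rightarrow> complex"
  assumes h: "has_weak_dx h g" and \<phi>: "test_function 0 pi \<phi>"
  shows "cinner_L2 h (L2_of (vderiv \<phi>)) = - cinner_L2 g (L2_of \<phi>)"
proof -
  note r = test_function_linear1[OF \<phi> bounded_linear_Re]
  note i = test_function_linear1[OF \<phi> bounded_linear_Im]
  have L: "L2_of f = L2_real (\<lambda>x. Re (f x)) + scaleC_L2 \<i> (L2_real (\<lambda>x. Im (f x)))"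
    if "test_function 0 pi f" for f :: "real \<Rightarrow> complex"
  proof -
    have s: "square_integrable (\<lambda>x. of_real (Re (f x)))" "square_integrable (\<lambda>x. of_real (Im (f x)))"
      by (rule square_integrable_smooth test_function_of_real(1) test_function_linear1(1)[OF that bounded_linear_Re]
          test_function_linear1(1)[OF that bounded_linear_Im])+
    have "(\<lambda>x. of_real (Re (f x)) + \<i> * of_real (Im (f x))) = f"
      by (auto simp: complex_eq_iff)
    then show ?thesis
      using L2_of_ops(1)[OF s(1) square_integrable_cmult[OF s(2)], of \<i>] L2_of_ops(4)[OF s(2) s(2), of \<i>]
      by (simp add: L2_real_def)
  qed
  show ?thesis
    using h[unfolded has_weak_dx_iff, rule_format, OF r(1)] h[unfolded has_weak_dx_iff, rule_format, OF i(1)]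
    by (simp only: r(2) i(2) L[OF \<phi>] L[OF test_function_vderiv[OF \<phi>]] cinner_L2_add_right
        cinner_L2_scaleC_right minus_add_distrib mult_minus_right add.commute)
qed

text \<open>
  The defining identity of the weak derivative extends from test functions to \<open>V\<close> by density.
\<close>

lemma has_weak_dx_H10:
  assumes h: "has_weak_dx h g" and w: "w \<in> H10_set"
  shows "cinner_L2 h (wdx w) = - cinner_L2 g w"
proof -
  obtain \<phi> :: "nat \<Rightarrow> real \<Rightarrow> complex" where \<phi>: "\<And>n. test_function 0 pi (\<phi> n)"
    "(\<lambda>n. L2_of (\<phi> n)) \<longlonglongrightarrow> w" "(\<lambda>n. L2_of (vderiv (\<phi> n))) \<longlonglongrightarrow> wdx w"
    by (rule H10_setE[OF w]) blast
  have "(\<lambda>n. cinner_L2 h (L2_of (vderiv (\<phi> n)))) \<longlonglongrightarrow> cinner_L2 h (wdx w)"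
    by (rule bounded_linear.tendsto[OF bounded_linear_cinner_right \<phi>(3)])
  moreover have "(\<lambda>n. - cinner_L2 g (L2_of (\<phi> n))) \<longlonglongrightarrow> - cinner_L2 g w"
    by (intro tendsto_minus bounded_linear.tendsto[OF bounded_linear_cinner_right \<phi>(2)])
  ultimately show ?thesis
    using has_weak_dx_complex_test[OF h \<phi>(1)] LIMSEQ_unique by simp
qed

lemma L2_to_Hm1_weak_dx:
  assumes "has_weak_dx h g"
  shows "L2_to_Hm1 g = - neg_div h"
proof -
  interpret bounded_linear neg_div by (rule bounded_linear_neg_div)
  have "dual_pair (L2_to_Hm1 g) w = dual_pair (0 - neg_div h) w" for w
    using has_weak_dx_H10[OF assms Rep_H10[of w]] unfolding dual_pair_ops
    by (simp add: dual_pair_L2 dual_pair_neg_div Dx.rep_eq)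
  then show ?thesis by (intro Hm1_eqI) simp
qed

lemma has_weak_dx_piecewise:
  fixes U g :: "real \<Rightarrow> complex"
  assumes U: "continuous_on {0..pi} U" "square_integrable U" and g: "square_integrable g"
    and K: "finite K" and d: "\<And>x. x \<in> {0<..<pi} - K \<Longrightarrow> (U has_vector_derivative g x) (at x)"
  shows "has_weak_dx (L2_of U) (L2_of g)"
proof -
  have "weak_deriv 0 pi U g"
    by (rule weak_deriv_piecewise[OF _ U(1) K d square_integrable_integrable[OF g]]) simp
  then show ?thesis unfolding has_weak_dx_def
  proof (rule weak_deriv_cong_AE)
    show "AE x in Om. U x = rep_L2 (L2_of U) x" using rep_L2_of[OF U(2)] by eventually_elim simp
    show "AE x in Om. g x = rep_L2 (L2_of g) x" using rep_L2_of[OF g] by eventually_elim simp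
  qed (use U(2) g square_integrable_rep in \<open>simp_all add: square_integrable_def\<close>)
qed

lemma has_weak_dx_zero_imp_const:
  assumes "has_weak_dx d 0"
  shows "\<exists>c. d = scaleC_L2 c (L2_of (\<lambda>x. 1))"
proof -
  have 0: "AE x in Om. rep_L2 0 x = 0"
    using rep_L2_of[OF square_integrable_zero] by (simp add: L2_of_zero)
  have "weak_deriv 0 pi (rep_L2 d) (\<lambda>x. 0)"
    using assms[unfolded has_weak_dx_def]
    by (rule weak_deriv_cong_AE) (use 0 square_integrable_rep in \<open>simp_all add: square_integrable_def\<close>)
  then obtain c where c: "AE x in Om. rep_L2 d x = c"
    using weak_deriv_zero_imp_const[of 0 pi "rep_L2 d"] square_integrable_integrable[OF square_integrable_rep]
    by auto
  have s: "square_integrable (\<lambda>x. 1)"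
    by (rule square_integrable_bounded[where B = 1]) auto
  have "d = L2_of (\<lambda>x. c * 1)"
    using L2_of_eq_iff[OF square_integrable_rep square_integrable_cmult[OF s, of c], of d] c
    by (simp add: L2_of_rep)
  then show ?thesis using L2_of_ops(4)[OF s s, of c] by (intro exI[of _ c]) simp
qed

text \<open>
  A continuous, piecewise differentiable function that vanishes at both ends lies in \<open>V\<close>.  The Riesz
  theorem supplies an element of \<open>V\<close> whose derivative has the same orthogonal projection off the
  constants; both derivatives have mean zero and so agree, and the two functions differ by a constant,
  which is zero because their integrals agree as well.
\<close>

lemma H10_piecewise:
  fixes U g :: "real \<Rightarrow> complex"
  assumes U: "continuous_on {0..pi} U" "square_integrable U" and g: "square_integrable g"
    and K: "finite K" and d: "\<And>x. x \<in> {0<..<pi} - K \<Longrightarrow> (U has_vector_derivative g x) (at x)"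
    and ends: "U 0 = 0" "U pi = 0"
  shows "L2_of U \<in> H10_set" "wdx (L2_of U) = L2_of g"
proof -
  interpret finite_measure Om by (rule finite_measure_Om)
  define one where "one = L2_of (\<lambda>x. 1)"
  define ex where "ex = L2_of (\<lambda>x. indicator {0..pi} x * complex_of_real x)"
  have s1: "square_integrable (\<lambda>x. 1)"
    by (rule square_integrable_bounded[where B = 1]) auto
  have sx: "square_integrable (\<lambda>x. indicator {0..pi} x * complex_of_real x)"
  proof (rule square_integrable_bounded[where B = pi])
    show "(\<lambda>x. indicator {0..pi} x * complex_of_real x) \<in> borel_measurable Om"
      by (intro measurable_restrict_space1 measurable_completion) simp
  qed (auto simp: indicator_def)
  have w1: "has_weak_dx one 0"
    unfolding one_def L2_of_zero[symmetric]
    by (rule has_weak_dx_piecewise[where K = "{}"]) (use s1 square_integrable_zero in auto)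
  have wx: "has_weak_dx ex one"
    unfolding one_def ex_def
  proof (rule has_weak_dx_piecewise[where K = "{}"])
    have "continuous_on {0..pi} complex_of_real" by (intro continuous_intros)
    then show "continuous_on {0..pi} (\<lambda>x. indicator {0..pi} x * complex_of_real x)"
      by (rule continuous_on_cong[THEN iffD1, rotated -1]) auto
    fix x assume x: "x \<in> {0<..<pi} - {}"
    have "(complex_of_real has_vector_derivative 1) (at x)"
      using has_vector_derivative_of_real[OF DERIV_ident] by simp
    then show "((\<lambda>x. indicator {0..pi} x * complex_of_real x) has_vector_derivative 1) (at x)"
      by (rule has_vector_derivative_transform_within_open[where S = "{0<..<pi}"]) (use x in auto)
  qed (use s1 sx in auto)
  have one1: "cinner_L2 one (scaleC_L2 c one) = cnj c * pi" for c
    unfolding cinner_L2_scaleC_right one_def L2_of_ops(5)[OF s1 s1]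
    using measure_Om by (simp add: scaleR_conv_of_real)
  have dU: "((\<lambda>x. cnj (U x)) has_vector_derivative cnj (g x)) (at x)" if "x \<in> {0<..<pi} - K" for x
    by (rule bounded_linear.has_vector_derivative[OF bounded_linear_cnj d[OF that]])
  have cU: "continuous_on {0..pi} (\<lambda>x. cnj (U x))" by (intro continuous_intros U)
  note pr = square_integrable_prod(1)[OF s1 g] square_integrable_prod(1)[OF sx g]
    square_integrable_prod(1)[OF s1 U(2)]
  have g1: "cinner_L2 one (L2_of g) = 0"
    unfolding one_def L2_of_ops(5)[OF s1 g]
    using integral_lebesgue_on_FTC[OF _ cU K dU] pr(1) ends by simp
  have gx: "cinner_L2 ex (L2_of g) = - cinner_L2 one (L2_of U)"
  proof -
    have "(\<integral>x. indicator {0..pi} x * complex_of_real x * cnj (g x) + 1 * cnj (U x) \<partial>Om)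
        = complex_of_real pi * cnj (U pi) - complex_of_real 0 * cnj (U 0)"
    proof (rule integral_lebesgue_on_FTC[OF _ _ K])
      show "continuous_on {0..pi} (\<lambda>x. complex_of_real x * cnj (U x))"
        by (intro continuous_intros cU)
      fix x assume x: "x \<in> {0<..<pi} - K"
      have "(complex_of_real has_vector_derivative 1) (at x)"
        using has_vector_derivative_of_real[OF DERIV_ident] by simp
      from has_vector_derivative_mult[OF this dU[OF x]]
      show "((\<lambda>x. complex_of_real x * cnj (U x)) has_vector_derivative
          indicator {0..pi} x * complex_of_real x * cnj (g x) + 1 * cnj (U x)) (at x)"
        using x by simp
    qed (use pr in simp_all)
    then have "(\<integral>x. indicator {0..pi} x * complex_of_real x * cnj (g x) \<partial>Om) + (\<integral>x. 1 * cnj (U x) \<partial>Om) = 0"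
      using pr ends by (subst (asm) Bochner_Integration.integral_add) auto
    then show ?thesis
      unfolding one_def ex_def L2_of_ops(5)[OF sx g] L2_of_ops(5)[OF s1 U(2)]
      by (simp add: add_eq_0_iff2)
  qed
  obtain v where v: "neg_div (L2_of g) = neg_div (Dx v)" using surj_neg_div_Dx by blast
  interpret L: bounded_linear "\<lambda>f. cinner_L2 f h" for h by (rule bounded_linear_cinner_left)
  interpret R: bounded_linear "\<lambda>f. cinner_L2 h f" for h by (rule bounded_linear_cinner_right)
  have "has_weak_dx (L2_of g - Dx v) 0" unfolding has_weak_dx_iff
  proof (intro allI impI)
    fix \<phi> :: "real \<Rightarrow> real" assume \<phi>: "test_function 0 pi \<phi>"
    note \<phi>c = test_function_of_real[OF \<phi>]
    define w where "w = Abs_H10 (L2_real \<phi>)"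
    have "L2_real \<phi> \<in> H10_set" unfolding L2_real_def by (rule H10_set_test[OF \<phi>c(1)])
    then have "Dx w = L2_real (vderiv \<phi>)"
      using wdx_test[OF \<phi>c(1)] \<phi>c(2) by (simp add: w_def Dx.rep_eq Abs_H10_inverse L2_real_def)
    then show "cinner_L2 (L2_of g - Dx v) (L2_real (vderiv \<phi>)) = - cinner_L2 0 (L2_real \<phi>)"
      using arg_cong[OF v, of "\<lambda>l. dual_pair l w"] by (simp add: dual_pair_neg_div L.diff L.zero)
  qed
  then obtain c where c: "L2_of g - Dx v = scaleC_L2 c one" using has_weak_dx_zero_imp_const unfolding one_def by blast
  have v1: "cinner_L2 one (Dx v) = 0"
    using has_weak_dx_H10[OF w1 Rep_H10[of v]] by (simp add: Dx.rep_eq L.zero)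
  have "cinner_L2 one (L2_of g - Dx v) = 0" using g1 v1 by (simp add: R.diff)
  then have "c = 0" unfolding c one1 by simp
  then have Dv: "L2_of g = Dx v" using c by (simp add: scaleC_L2_simps)
  have wU: "has_weak_dx (L2_of U) (L2_of g)" by (rule has_weak_dx_piecewise[OF U g K d])
  have wv: "has_weak_dx (Rep_H10 v) (L2_of g)"
    unfolding Dv Dx.rep_eq by (rule H10_setE[OF Rep_H10[of v]])
  have "has_weak_dx (Rep_H10 v - L2_of U) 0"
    using wU wv by (simp add: has_weak_dx_iff L.diff L.zero)
  then obtain c' where c': "Rep_H10 v - L2_of U = scaleC_L2 c' one" using has_weak_dx_zero_imp_const unfolding one_def by blast
  have "cinner_L2 one (Rep_H10 v) = cinner_L2 one (L2_of U)"
    using has_weak_dx_H10[OF wx Rep_H10[of v]] gx by (simp add: Dv Dx.rep_eq)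
  then have "cinner_L2 one (Rep_H10 v - L2_of U) = 0" by (simp add: R.diff)
  then have "c' = 0" unfolding c' one1 by simp
  then have eq: "L2_of U = Rep_H10 v" using c' by (simp add: scaleC_L2_simps)
  show "L2_of U \<in> H10_set" unfolding eq by (rule Rep_H10)
  show "wdx (L2_of U) = L2_of g" by (simp only: eq Dv Dx.rep_eq)
qed

section \<open>The energy identity for scalar functions of time\<close>

lemma continuous_AE_zero_imp_zero:
  fixes f :: "real \<Rightarrow> 'a::t1_space"
  assumes ab: "a < b" and f: "continuous_on {a..b} f" and AE: "AE t in lebesgue_on {a<..<b}. f t = z"
    and x: "x \<in> {a..b}"
  shows "f x = z"
proof -
  let ?S = "{t \<in> {a<..<b}. f t \<noteq> z}"
  have "open (f -` (- {z}) \<inter> {a<..<b})"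
    using continuous_on_subset[OF f greaterThanLessThan_subseteq_atLeastAtMost_iff[THEN iffD2]]
      continuous_on_open_vimage[of "{a<..<b}" f]
    by (simp add: open_Compl)
  then have op: "open ?S" by (simp add: vimage_def Int_def conj_commute)
  have "AE t in lebesgue. t \<in> {a<..<b} \<longrightarrow> f t = z"
    using AE by (subst (asm) AE_restrict_space_iff) auto
  then have "?S \<in> null_sets lebesgue"
    using op by (subst AE_iff_null_sets) (auto intro: lmeasurable_open elim: eventually_mono)
  then have "?S = {}" using op open_not_negligible by (auto simp: negligible_iff_null_sets)
  then have "f t = z" if "t \<in> {a<..<b}" for t using that by blast
  then show ?thesis
    using continuous_constant_on_closure[of "{a<..<b}" f z x] f ab x by simp
qed

text \<open>
  Both identities for \<open>R(t) = \<integral>\<^sub>a\<^sup>t r\<close> come from integrating over the triangle \<open>s < t\<close> in either order.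
\<close>

lemma
  fixes r :: "real \<Rightarrow> real"
  assumes ab: "a < b" and r: "integrable (lebesgue_on {a<..<b}) r"
  defines "R \<equiv> \<lambda>t. \<integral>s. indicator {..<t} s * r s \<partial>lebesgue_on {a<..<b}"
  shows weak_deriv_indefinite_integral: "weak_deriv a b R r"
    and integral_indefinite_integral_times: "integrable (lebesgue_on {a<..<b}) (\<lambda>t. R t * r t)"
      "(\<integral>t. r t \<partial>lebesgue_on {a<..<b})\<^sup>2 = 2 * (\<integral>t. R t * r t \<partial>lebesgue_on {a<..<b})"
proof -
  let ?M = "lebesgue_on {a<..<b}"
  interpret finite_measure ?M by (rule finite_measure_lebesgue_on) simp
  interpret P: pair_sigma_finite ?M ?M ..
  have id [measurable]: "(\<lambda>x. x) \<in> borel_measurable ?M"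
    by (intro measurable_restrict_space1 measurable_completion) simp
  have f1 [measurable]: "fst \<in> borel_measurable (?M \<Otimes>\<^sub>M ?M)" "snd \<in> borel_measurable (?M \<Otimes>\<^sub>M ?M)"
    using measurable_compose[OF measurable_fst id] measurable_compose[OF measurable_snd id] by simp_all
  have rm [measurable]: "r \<in> borel_measurable ?M" using r by simp
  have prod: "integrable (?M \<Otimes>\<^sub>M ?M) (\<lambda>(t, s). p t * r s)" if p: "integrable ?M p" for p :: "real \<Rightarrow> real"
  proof (rule P.Fubini_integrable)
    show "(\<lambda>(t, s). p t * r s) \<in> borel_measurable (?M \<Otimes>\<^sub>M ?M)" using p by measurable
    show "integrable ?M (\<lambda>x. \<integral>y. norm (case (x, y) of (t, s) \<Rightarrow> p t * r s) \<partial>?M)"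
      using p r by (simp add: abs_mult)
    show "AE x in ?M. integrable ?M (\<lambda>y. case (x, y) of (t, s) \<Rightarrow> p t * r s)"
      using r by simp
  qed
  have tri: "integrable (?M \<Otimes>\<^sub>M ?M) (\<lambda>(t, s). p t * (indicator {..<t} s * r s))"
    if p: "integrable ?M p" for p :: "real \<Rightarrow> real"
  proof (rule Bochner_Integration.integrable_bound[OF prod[OF p]])
    have [measurable]: "p \<in> borel_measurable ?M" using p by simp
    have "Measurable.pred (?M \<Otimes>\<^sub>M ?M) (\<lambda>x. snd x < fst x)" by measurable
    then have "(\<lambda>x. p (fst x) * ((if snd x < fst x then 1 else 0) * r (snd x))) \<in> borel_measurable (?M \<Otimes>\<^sub>M ?M)"
      by measurable
    then show "(\<lambda>(t, s). p t * (indicator {..<t} s * r s)) \<in> borel_measurable (?M \<Otimes>\<^sub>M ?M)"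
      by (simp add: case_prod_unfold indicator_def of_bool_def)
  qed (auto simp: indicator_def)
  have inner: "(\<integral>s. p t * (indicator {..<t} s * r s) \<partial>?M) = p t * R t" for p :: "real \<Rightarrow> real" and t
    by (simp add: R_def)
  have F: "(\<integral>t. p t * R t \<partial>?M) = (\<integral>s. (\<integral>t. p t * (indicator {..<t} s * r s) \<partial>?M) \<partial>?M)"
    if p: "integrable ?M p" for p :: "real \<Rightarrow> real"
    using P.Fubini_integral[OF tri[OF p]] by (simp add: R_def)
  have iR: "integrable ?M (\<lambda>t. p t * R t)" if p: "integrable ?M p" for p :: "real \<Rightarrow> real"
    using P.integrable_fst[OF tri[OF p]] by (simp add: R_def)
  show "integrable ?M (\<lambda>t. R t * r t)" using iR[OF r] by (simp add: mult.commute)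
  show "(\<integral>t. r t \<partial>?M)\<^sup>2 = 2 * (\<integral>t. R t * r t \<partial>?M)"
  proof -
    have split: "(\<integral>t. r t * (indicator {..<t} s * r s) \<partial>?M) = r s * ((\<integral>t. r t \<partial>?M) - R s)" for s
    proof -
      have il: "integrable ?M (\<lambda>t. indicator {..<s} t * r t)"
        by (rule Bochner_Integration.integrable_bound[OF r])
           (auto simp: indicator_def intro!: borel_measurable_times measurable_restrict_space1 measurable_completion)
      have "AE t in ?M. t \<noteq> s"
        by (subst AE_restrict_space_iff) (auto intro!: AE_I'[of "{s}"])
      then have "AE t in ?M. r t * (indicator {..<t} s * r s) = r s * (r t - indicator {..<s} t * r t)"
        by eventually_elim (auto simp: indicator_def)
      then have "(\<integral>t. r t * (indicator {..<t} s * r s) \<partial>?M) = (\<integral>t. r s * (r t - indicator {..<s} t * r t) \<partial>?M)"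
        by (rule integral_cong_AE[rotated -1]) (auto simp: indicator_def[abs_def])
      then show ?thesis using r il by (simp add: R_def)
    qed
    have "(\<integral>t. r t * R t \<partial>?M) = (\<integral>s. r s * (\<integral>t. r t \<partial>?M) - r s * R s \<partial>?M)"
      unfolding F[OF r] split by (simp add: algebra_simps)
    also have "\<dots> = (\<integral>t. r t \<partial>?M)\<^sup>2 - (\<integral>t. r t * R t \<partial>?M)"
      using r iR[OF r] by (subst Bochner_Integration.integral_diff) (auto simp: power2_eq_square)
    finally show ?thesis by (simp add: mult.commute)
  qed
  show "weak_deriv a b R r" unfolding weak_deriv_def
  proof (intro allI impI)
    fix \<phi> :: "real \<Rightarrow> real" assume \<phi>: "test_function a b \<phi>"
    have sm: "smooth \<phi>" using \<phi> by (simp add: test_function_def)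
    note i = test_function_integrable[OF test_function_vderiv[OF \<phi>]]
    have "(\<integral>t. vderiv \<phi> t * (indicator {..<t} s * r s) \<partial>?M) = - \<phi> s * r s" if s: "a < s" "s < b" for s
    proof -
      have "(\<integral>t. vderiv \<phi> t * (indicator {..<t} s * r s) \<partial>?M) = (\<integral>t. (indicator {s<..<b} t *\<^sub>R vderiv \<phi> t) * r s \<partial>?M)"
        by (intro Bochner_Integration.integral_cong) (auto simp: indicator_def)
      also have "\<dots> = (\<integral>t. indicator {s<..<b} t *\<^sub>R vderiv \<phi> t \<partial>?M) * r s"
        by (rule integral_mult_left_zero)
      also have "(\<integral>t. indicator {s<..<b} t *\<^sub>R vderiv \<phi> t \<partial>?M) = (\<integral>t. vderiv \<phi> t \<partial>lebesgue_on {s<..<b})"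
        using s by (subst (1 2) integral_restrict_space)
           (auto intro!: Bochner_Integration.integral_cong simp: indicator_def)
      also have "\<dots> = \<phi> b - \<phi> s"
        by (rule integral_lebesgue_on_FTC[where K = "{}"])
           (use s smooth_has_vderiv[OF sm] smooth_continuous[OF sm] i in auto)
      finally show ?thesis using test_function_support[OF \<phi>, of b] by simp
    qed
    then have "(\<integral>t. vderiv \<phi> t * R t \<partial>?M) = (\<integral>s. - (\<phi> s * r s) \<partial>?M)"
      unfolding F[OF i] by (intro Bochner_Integration.integral_cong) auto
    then show "(\<integral>t. vderiv \<phi> t *\<^sub>R R t \<partial>?M) = - (\<integral>t. \<phi> t *\<^sub>R r t \<partial>?M)"
      by simp
  qed
qed

text \<open>
  The energy identity \<open>(y\<^sup>2)' = 2 y y'\<close>.  By the du Bois-Reymond lemma and continuity, \<open>y\<close> is the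
  indefinite integral of its weak derivative.
\<close>

lemma weak_deriv_energy:
  fixes y r :: "real \<Rightarrow> real"
  assumes ab: "a < b" and y: "continuous_on {a..b} y" "y a = 0"
    and r: "integrable (lebesgue_on {a<..<b}) r" and w: "weak_deriv a b y r"
  shows "integrable (lebesgue_on {a<..<b}) (\<lambda>t. y t * r t)"
    "(y b)\<^sup>2 = 2 * (\<integral>t. y t * r t \<partial>lebesgue_on {a<..<b})"
proof -
  let ?M = "lebesgue_on {a<..<b}"
  define R where "R = (\<lambda>t. \<integral>s. indicator {..<t} s * r s \<partial>?M)"
  have R: "weak_deriv a b R r" "integrable ?M (\<lambda>t. R t * r t)"
      "(\<integral>t. r t \<partial>?M)\<^sup>2 = 2 * (\<integral>t. R t * r t \<partial>?M)"
    using weak_deriv_indefinite_integral[OF ab r] integral_indefinite_integral_times[OF ab r]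
    unfolding R_def by blast+
  have rs: "r absolutely_integrable_on {a<..<b}"
    using r by (simp add: integrable_restrict_space set_integrable_def)
  then have "r absolutely_integrable_on {a..b}"
    by (simp add: absolutely_integrable_on_Icc_iff_Ioo)
  then have io: "r integrable_on {a..b}" by (simp add: absolutely_integrable_on_def)
  have Rint: "R t = integral {a..t} r" if t: "t \<in> {a..b}" for t
  proof -
    have 1: "R t = (\<integral>s. r s \<partial>lebesgue_on {a<..<t})"
      unfolding R_def using t by (subst (1 2) integral_restrict_space)
           (auto intro!: Bochner_Integration.integral_cong simp: indicator_def)
    have "r absolutely_integrable_on {a<..<t}"
      by (rule set_integrable_subset[OF rs]) (use t in auto)
    then have "integrable (lebesgue_on {a<..<t}) r" by (simp add: integrable_restrict_space set_integrable_def)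
    then have "(\<integral>s. r s \<partial>lebesgue_on {a<..<t}) = integral {a<..<t} r"
      by (rule lebesgue_integral_eq_integral) simp
    then show ?thesis using 1 by (simp add: integral_open_interval_real)
  qed
  have cR: "continuous_on {a..b} R"
    by (rule continuous_on_eq[OF indefinite_integral_continuous_1[OF io]]) (simp add: Rint)
  have i: "integrable ?M f" if "continuous_on {a..b} f" for f :: "real \<Rightarrow> real"
  proof -
    have "f absolutely_integrable_on {a<..<b}"
      by (rule set_integrable_subset[OF absolutely_integrable_continuous_real[OF that]]) auto
    then show ?thesis by (simp add: integrable_restrict_space set_integrable_def)
  qed
  have "weak_deriv a b (\<lambda>t. y t - R t) (\<lambda>t. 0)"
    unfolding weak_deriv_def
  proof (intro allI impI)
    fix \<phi> :: "real \<Rightarrow> real" assume \<phi>: "test_function a b \<phi>"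
    then show "(\<integral>t. vderiv \<phi> t *\<^sub>R (y t - R t) \<partial>?M) = - (\<integral>t. \<phi> t *\<^sub>R 0 \<partial>?M)"
      using integrable_test_scaleR[OF test_function_vderiv[OF \<phi>] i[OF y(1)]]
        integrable_test_scaleR[OF test_function_vderiv[OF \<phi>] i[OF cR]] w R(1)
      by (simp add: weak_deriv_def right_diff_distrib)
  qed
  then obtain c where c: "AE t in ?M. y t - R t = c"
    using weak_deriv_zero_imp_const[OF ab, of "\<lambda>t. y t - R t"] i[OF y(1)] i[OF cR] by auto
  have eq: "y t - R t = c" if "t \<in> {a..b}" for t
    by (rule continuous_AE_zero_imp_zero[OF ab _ c that]) (intro continuous_intros y cR)
  have "c = 0" using eq[of a] Rint[of a] ab y(2) by simp
  then have yR: "y t = R t" if "t \<in> {a..b}" for t using eq[OF that] by simp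
  show "integrable ?M (\<lambda>t. y t * r t)"
    using R(2) by (rule Bochner_Integration.integrable_cong[THEN iffD1, rotated -1]) (auto simp: yR)
  have "R b = (\<integral>t. r t \<partial>?M)"
    unfolding R_def by (intro Bochner_Integration.integral_cong) auto
  moreover have "(\<integral>t. y t * r t \<partial>?M) = (\<integral>t. R t * r t \<partial>?M)"
    by (intro Bochner_Integration.integral_cong) (auto simp: yR)
  ultimately show "(y b)\<^sup>2 = 2 * (\<integral>t. y t * r t \<partial>?M)" using R(3) yR[of b] ab by simp
qed

section \<open>The sine basis\<close>

lemma square_integrable_continuous:
  fixes f :: "real \<Rightarrow> complex"
  assumes "continuous_on UNIV f" "\<And>x. cmod (f x) \<le> B"
  shows "square_integrable f"
  by (rule square_integrable_bounded[OF continuous_measurable_on[OF assms(1)] assms(2)])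

lemma square_integrable_sin_cos:
  "square_integrable (\<lambda>x. of_real (c * sin (n * x)))"
  "square_integrable (\<lambda>x. of_real (c * cos (n * x)))"
proof -
  show "square_integrable (\<lambda>x. of_real (c * sin (n * x)))"
    by (rule square_integrable_continuous[where B = "\<bar>c\<bar>"])
       (auto intro!: continuous_intros simp: norm_mult mult_left_le)
  show "square_integrable (\<lambda>x. of_real (c * cos (n * x)))"
    by (rule square_integrable_continuous[where B = "\<bar>c\<bar>"])
       (auto intro!: continuous_intros simp: norm_mult mult_left_le)
qed

text \<open>
  The factor \<open>1\<close> is the amplitude: the sines are instances of \<open>square_integrable_sin_cos\<close>.
\<close>

definition sine_mode :: "nat \<Rightarrow> H10" where
  "sine_mode n = Abs_H10 (L2_of (\<lambda>x. of_real (1 * sin (real n * x))))"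

lemma sine_mode:
  "Rep_H10 (sine_mode n) = L2_of (\<lambda>x. of_real (1 * sin (real n * x)))"
  "Dx (sine_mode n) = L2_of (\<lambda>x. of_real (real n * cos (real n * x)))"
proof -
  have d: "((\<lambda>x. complex_of_real (1 * sin (real n * x))) has_vector_derivative
      complex_of_real (real n * cos (real n * x))) (at x)" for x
    by (rule has_vector_derivative_of_real) (auto intro!: derivative_eq_intros)
  have "sin (real n * pi) = 0" by (metis mult.commute sin_npi)
  note * = H10_piecewise[OF _ square_integrable_sin_cos(1) square_integrable_sin_cos(2) finite.emptyI d]
  have "L2_of (\<lambda>x. of_real (1 * sin (real n * x))) \<in> H10_set"
    by (rule *(1)) (use \<open>sin (real n * pi) = 0\<close> in \<open>auto intro!: continuous_intros\<close>)
  moreover have "wdx (L2_of (\<lambda>x. of_real (1 * sin (real n * x)))) = L2_of (\<lambda>x. of_real (real n * cos (real n * x)))"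
    by (rule *(2)) (use \<open>sin (real n * pi) = 0\<close> in \<open>auto intro!: continuous_intros\<close>)
  ultimately show "Rep_H10 (sine_mode n) = L2_of (\<lambda>x. of_real (1 * sin (real n * x)))"
    "Dx (sine_mode n) = L2_of (\<lambda>x. of_real (real n * cos (real n * x)))"
    by (simp_all add: sine_mode_def Dx.rep_eq Abs_H10_inverse)
qed

lemma neg_div_Dx_sine_mode:
  "neg_div (Dx (sine_mode n)) = (real n)\<^sup>2 *\<^sub>R L2_to_Hm1 (Rep_H10 (sine_mode n))"
proof -
  interpret bounded_linear L2_to_Hm1 by (rule bounded_linear_L2_to_Hm1)
  have d: "((\<lambda>x. complex_of_real (real n * cos (real n * x))) has_vector_derivative
      complex_of_real (- (real n)\<^sup>2 * sin (real n * x))) (at x)" for x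
    by (rule has_vector_derivative_of_real) (auto intro!: derivative_eq_intros simp: power2_eq_square)
  have "has_weak_dx (Dx (sine_mode n)) (L2_of (\<lambda>x. of_real (- (real n)\<^sup>2 * sin (real n * x))))"
    unfolding sine_mode
    by (intro has_weak_dx_piecewise[where K = "{}"] d square_integrable_sin_cos) (auto intro!: continuous_intros)
  also have "L2_of (\<lambda>x. of_real (- (real n)\<^sup>2 * sin (real n * x))) = (- (real n)\<^sup>2) *\<^sub>R Rep_H10 (sine_mode n)"
    unfolding sine_mode L2_of_ops(3)[OF square_integrable_sin_cos(1) square_integrable_sin_cos(1)]
    by (simp add: scaleR_conv_of_real)
  finally have "L2_to_Hm1 ((- (real n)\<^sup>2) *\<^sub>R Rep_H10 (sine_mode n)) = - neg_div (Dx (sine_mode n))"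
    by (rule L2_to_Hm1_weak_dx)
  then show ?thesis unfolding scaleR by (simp add: minus_equation_iff)
qed

lemma cinner_Dx_sine_mode:
  "cinner_L2 (Dx (sine_mode n)) (Dx w) = (real n)\<^sup>2 *\<^sub>R cinner_L2 (Rep_H10 (sine_mode n)) (Rep_H10 w)"
  using arg_cong[OF neg_div_Dx_sine_mode[of n], of "\<lambda>l. dual_pair l w"]
  by (simp add: dual_pair_neg_div dual_pair_ops dual_pair_L2)

text \<open>
  Completeness of the sines.  A test function is \<open>sin x\<close> times a continuous function of \<open>cos x\<close>, hence
  a uniform limit of functions \<open>sin x p(cos x)\<close> with polynomials \<open>p\<close>, which are combinations of sines.
\<close>

lemma sines_total:
  assumes h: "\<And>n. cinner_L2 h (Rep_H10 (sine_mode (Suc n))) = 0"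
  shows "h = 0"
proof (rule L2_eq_0I)
  interpret R: bounded_linear "\<lambda>f. cinner_L2 h f" by (rule bounded_linear_cinner_right)
  have c: "square_integrable (\<lambda>x. of_real (f x))" if "continuous_on UNIV f" "\<And>x. \<bar>f x\<bar> \<le> B" for f B
    by (rule square_integrable_continuous[where B = B]) (use that in \<open>auto intro!: continuous_intros\<close>)
  have zero: "square_integrable (\<lambda>x. of_real (sin (real m * x) * cos x ^ i)) \<and>
      cinner_L2 h (L2_of (\<lambda>x. of_real (sin (real m * x) * cos x ^ i))) = 0" for m i
  proof (induction i arbitrary: m)
    case 0
    show ?case
    proof (cases m)
      case 0
      then show ?thesis by (simp add: square_integrable_zero L2_of_zero R.zero)
    next
      case (Suc n)
      then show ?thesis using h[of n] square_integrable_sin_cos(1)[of 1] by (simp add: sine_mode)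
    qed
  next
    case (Suc i)
    show ?case
    proof (cases m)
      case 0
      then show ?thesis by (simp add: square_integrable_zero L2_of_zero R.zero)
    next
      case (Suc n)
      let ?f = "\<lambda>m x. complex_of_real (sin (real m * x) * cos x ^ i)"
      have "complex_of_real (sin (real m * x) * cos x ^ Suc i) = (1/2) *\<^sub>R (?f (Suc m) x + ?f n x)" for x
      proof -
        have "real (Suc m) * x = real m * x + x" "real n * x = real m * x - x"
          using Suc by (simp_all add: algebra_simps)
        then have "sin (real m * x) * cos x = (1/2) * (sin (real (Suc m) * x) + sin (real n * x))"
          by (simp only: sin_add sin_diff) simp
        then have "sin (real m * x) * cos x ^ Suc i
            = (1/2) * (sin (real (Suc m) * x) * cos x ^ i + sin (real n * x) * cos x ^ i)"
          by (simp only: power_Suc mult.assoc[symmetric]) (simp only: mult.assoc distrib_right)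
        then show ?thesis by (simp only: scaleR_conv_of_real of_real_add of_real_mult)
      qed
      then have eq: "(\<lambda>x. complex_of_real (sin (real m * x) * cos x ^ Suc i)) = (\<lambda>x. (1/2) *\<^sub>R (?f (Suc m) x + ?f n x))"
        by blast
      note s = Suc.IH[of "Suc m", THEN conjunct1] Suc.IH[of n, THEN conjunct1]
      note s' = square_integrable_add[OF s]
      have "L2_of (\<lambda>x. (1/2) *\<^sub>R (?f (Suc m) x + ?f n x)) = (1/2) *\<^sub>R (L2_of (?f (Suc m)) + L2_of (?f n))"
        unfolding L2_of_ops(1)[OF s] L2_of_ops(3)[OF s' s'] ..
      then show ?thesis unfolding eq
        using square_integrable_scaleR[OF s', of "1/2"] Suc.IH[of "Suc m", THEN conjunct2] Suc.IH[of n, THEN conjunct2]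
        by (simp only: R.scaleR R.add) simp
    qed
  qed
  have poly: "square_integrable (\<lambda>x. of_real (sin x * (\<Sum>i<n. a i * cos x ^ i))) \<and>
      cinner_L2 h (L2_of (\<lambda>x. of_real (sin x * (\<Sum>i<n. a i * cos x ^ i)))) = 0" for n and a :: "nat \<Rightarrow> real"
  proof (induction n)
    case 0
    show ?case by (simp add: square_integrable_zero L2_of_zero R.zero)
  next
    case (Suc n)
    let ?g = "\<lambda>x. complex_of_real (sin x * (\<Sum>i<n. a i * cos x ^ i))"
    let ?f = "\<lambda>x. complex_of_real (sin (real 1 * x) * cos x ^ n)"
    have eq: "(\<lambda>x. complex_of_real (sin x * (\<Sum>i<Suc n. a i * cos x ^ i))) = (\<lambda>x. ?g x + a n *\<^sub>R ?f x)"
      by (auto simp: algebra_simps scaleR_conv_of_real)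
    note z = zero[of 1 n, THEN conjunct1] zero[of 1 n, THEN conjunct2]
    note f = square_integrable_scaleR[OF z(1), of "a n"]
    have "L2_of (\<lambda>x. ?g x + a n *\<^sub>R ?f x) = L2_of ?g + a n *\<^sub>R L2_of ?f"
      unfolding L2_of_ops(3)[OF z(1) z(1)] using L2_of_ops(1)[OF Suc[THEN conjunct1] f] by simp
    then show ?case unfolding eq
      using square_integrable_add[OF Suc[THEN conjunct1] f] z(2) Suc[THEN conjunct2]
      by (simp only: R.scaleR R.add) simp
  qed
  fix \<phi> :: "real \<Rightarrow> real" assume \<phi>: "test_function 0 pi \<phi>"
  have sm: "smooth \<phi>" using \<phi> by (simp add: test_function_def)
  obtain K where K: "compact K" "K \<subseteq> {0<..<pi}" "\<And>x. x \<notin> K \<Longrightarrow> \<phi> x = 0"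
    using \<phi> unfolding test_function_def by blast
  have "\<exists>m>0. \<forall>x\<in>K. m \<le> sin x"
  proof (cases "K = {}")
    case False
    obtain x where "x \<in> K" "\<forall>y\<in>K. sin x \<le> sin y"
      using continuous_attains_inf[OF K(1) False continuous_on_sin[OF continuous_on_id]] by auto
    then show ?thesis using K(2) sin_gt_zero by (intro exI[of _ "sin x"]) auto
  qed (auto intro: exI[of _ 1])
  then obtain m where m: "0 < m" "\<And>x. x \<in> K \<Longrightarrow> m \<le> sin x" by blast
  \<comment> \<open>The quotient by \<open>sin x\<close>; replacing \<open>sin x\<close> by \<open>m\<close> outside of the support makes it continuous.\<close>
  define q where "q x = \<phi> x / max (sin x) m" for x
  have q: "\<phi> x = sin x * q x" for x
    using m K(3)[of x] by (cases "x \<in> K") (force simp: q_def max_def)+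
  have qc: "continuous_on UNIV q" unfolding q_def
    using m(1) by (intro continuous_intros smooth_continuous[OF sm]) (metis max.strict_coboundedI2 less_irrefl)
  define \<Phi> where "\<Phi> c = q (arccos c)" for c
  have \<Phi>: "continuous_on {-1..1} \<Phi>" unfolding \<Phi>_def
    by (rule continuous_on_compose2[OF qc continuous_on_arccos']) auto
  have small: "cmod (cinner_L2 h (L2_real \<phi>)) \<le> norm h * (sqrt pi * e)" if e: "e > 0" for e
  proof -
    obtain p where p: "real_polynomial_function p" "\<And>c. c \<in> {-1..1} \<Longrightarrow> \<bar>\<Phi> c - p c\<bar> < e"
      using Stone_Weierstrass_real_polynomial_function[OF compact_Icc \<Phi> e] by blast
    obtain a n where a: "p = (\<lambda>c. \<Sum>i\<le>n. a i * c ^ i)"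
      using p(1) unfolding real_polynomial_function_iff_sum by blast
    let ?g = "\<lambda>x. complex_of_real (sin x * (\<Sum>i<Suc n. a i * cos x ^ i))"
    let ?f = "\<lambda>x. complex_of_real (\<phi> x)"
    note g = poly[of a "Suc n", THEN conjunct1]
    note f = square_integrable_smooth[OF test_function_of_real(1)[OF \<phi>]]
    note fg = square_integrable_diff[OF f g]
    have pt: "cmod (?f x - ?g x) \<le> e" if x: "x \<in> {0<..<pi}" for x
    proof -
      have "\<Phi> (cos x) = q x" using x by (simp add: \<Phi>_def arccos_cos)
      then have "\<phi> x - sin x * (\<Sum>i<Suc n. a i * cos x ^ i) = sin x * (\<Phi> (cos x) - p (cos x))"
        unfolding q[of x] a by (simp add: right_diff_distrib lessThan_Suc_atMost)
      then have "cmod (?f x - ?g x) = \<bar>sin x\<bar> * \<bar>\<Phi> (cos x) - p (cos x)\<bar>"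
        by (simp only: abs_mult norm_of_real flip: of_real_diff)
      also have "\<dots> \<le> 1 * e" using p(2)[of "cos x"] by (intro mult_mono) (auto simp: less_imp_le)
      finally show ?thesis by simp
    qed
    interpret finite_measure Om by (rule finite_measure_Om)
    have "(\<integral>x. (cmod (?f x - ?g x))\<^sup>2 \<partial>Om) \<le> (\<integral>x. e\<^sup>2 \<partial>Om)"
      using fg pt by (intro integral_mono) (auto simp: square_integrable_def intro!: power_mono)
    also have "\<dots> = (sqrt pi * e)\<^sup>2" using measure_Om by (simp add: power_mult_distrib)
    finally have n: "norm (L2_of ?f - L2_of ?g) \<le> sqrt pi * e"
      using e unfolding L2_of_ops(2)[OF f g] L2_of_ops(7)[OF fg fg]
      by (intro real_le_lsqrt) auto
    have "cinner_L2 h (L2_real \<phi>) = cinner_L2 h (L2_of ?f - L2_of ?g)"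
      using poly[of a "Suc n", THEN conjunct2] by (simp add: R.diff L2_real_def del: sum.lessThan_Suc)
    also have "cmod \<dots> \<le> norm h * norm (L2_of ?f - L2_of ?g)" by (rule cinner_L2_bound)
    also have "\<dots> \<le> norm h * (sqrt pi * e)" by (intro mult_left_mono n) auto
    finally show ?thesis .
  qed
  have "cmod (cinner_L2 h (L2_real \<phi>)) \<le> 0 + e" if e: "e > 0" for e
  proof -
    have pos: "0 < norm h * sqrt pi + 1" by (intro add_nonneg_pos mult_nonneg_nonneg) auto
    have "cmod (cinner_L2 h (L2_real \<phi>)) \<le> norm h * (sqrt pi * (e / (norm h * sqrt pi + 1)))"
      by (rule small) (use e pos in simp)
    also have "\<dots> = (norm h * sqrt pi) / (norm h * sqrt pi + 1) * e" by simp
    also have "\<dots> \<le> 1 * e" using pos e by (intro mult_right_mono) (auto simp: divide_le_eq)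
    finally show ?thesis by simp
  qed
  then have "cmod (cinner_L2 h (L2_real \<phi>)) \<le> 0" by (rule field_le_epsilon)
  then show "cinner_L2 h (L2_real \<phi>) = 0" by simp
qed


text \<open>
  Convergence follows from the density of the span, because the partial sum is the best approximation
  from the span of the first basis vectors.  Vectors that are zero contribute nothing, as \<open>x / 0 = 0\<close>.
\<close>

lemma orthogonal_expansion:
  fixes b :: "nat \<Rightarrow> 'a::{real_inner, complete_space}" and x :: 'a
  assumes orth: "\<And>m n. m \<noteq> n \<Longrightarrow> b m \<bullet> b n = 0" and total: "\<And>x. (\<And>n. x \<bullet> b n = 0) \<Longrightarrow> x = 0"
  defines "P \<equiv> \<lambda>N. \<Sum>n<N. ((x \<bullet> b n) / (b n \<bullet> b n)) *\<^sub>R b n"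
  shows "norm (P N) \<le> norm x" "P \<longlonglongrightarrow> x"
proof -
  have res: "(x - P N) \<bullet> b n = 0" if "n < N" for n N
  proof -
    have "P N \<bullet> b n = (\<Sum>k<N. (x \<bullet> b k) / (b k \<bullet> b k) * (b k \<bullet> b n))"
      by (simp add: P_def inner_sum_left)
    also have "\<dots> = (\<Sum>k<N. if k = n then x \<bullet> b n else 0)"
      by (intro sum.cong refl) (use orth in auto)
    also have "\<dots> = x \<bullet> b n" using that by simp
    finally show ?thesis by (simp add: inner_diff_left)
  qed
  have perp: "(x - P N) \<bullet> y = 0" if "y \<in> span (b ` {..<N})" for y N
    using that by (induction rule: span_induct_alt) (auto simp: res inner_add_right)
  have Pin: "P N \<in> span (b ` {..<N})" for N
    unfolding P_def by (intro span_sum span_scale span_base) auto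
  have pyth: "(norm (x - y))\<^sup>2 = (norm (x - P N))\<^sup>2 + (norm (P N - y))\<^sup>2" if "y \<in> span (b ` {..<N})" for y N
  proof -
    have "(x - P N) \<bullet> (P N - y) = 0" by (rule perp) (intro span_diff Pin that)
    moreover have "x - y = (x - P N) + (P N - y)" by simp
    ultimately show ?thesis by (simp only: power2_norm_eq_inner inner_add_left inner_add_right inner_commute)
  qed
  have "(norm (P N))\<^sup>2 \<le> (norm x)\<^sup>2" using pyth[OF span_zero, of N] by simp
  then show "norm (P N) \<le> norm x" by (rule power2_le_imp_le) simp
  have dense: "closure (span (range b)) = UNIV"
    by (rule dense_span_of_orthogonal) (use total in blast)
  have fin: "\<exists>M. y \<in> span (b ` {..<M})" if "y \<in> span (range b)" for y
    using that
  proof (induction rule: span_induct_alt)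
    case base
    then show ?case using span_zero by blast
  next
    case (step c z y)
    then obtain n M where "z = b n" "y \<in> span (b ` {..<M})" by blast
    moreover from this have "y \<in> span (b ` {..<max M (Suc n)})"
      using span_mono[of "b ` {..<M}" "b ` {..<max M (Suc n)}"] by (auto simp: image_mono)
    moreover have "b n \<in> span (b ` {..<max M (Suc n)})" by (intro span_base) auto
    ultimately show ?case by (intro exI[of _ "max M (Suc n)"] span_add span_scale) auto
  qed
  show "P \<longlonglongrightarrow> x"
  proof (rule LIMSEQ_I)
    fix e :: real assume e: "0 < e"
    have "x \<in> closure (span (range b))" using dense by simp
    then obtain y where y: "y \<in> span (range b)" "dist y x < e"
      using e unfolding closure_approachable by blast
    obtain M where M: "y \<in> span (b ` {..<M})" using fin[OF y(1)] by blast
    have "norm (P N - x) < e" if "N \<ge> M" for N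
    proof -
      have "y \<in> span (b ` {..<N})" using M that span_mono[of "b ` {..<M}" "b ` {..<N}"] by (auto simp: image_mono)
      then have "(norm (x - P N))\<^sup>2 \<le> (norm (x - y))\<^sup>2" using pyth by simp
      then have "norm (x - P N) \<le> norm (x - y)" by (rule power2_le_imp_le) simp
      then show ?thesis using y(2) by (simp add: dist_norm norm_minus_commute)
    qed
    then show "\<exists>no. \<forall>n\<ge>no. norm (P n - x) < e" by blast
  qed
qed

text \<open>
  The sines and their multiples by \<open>\<i>\<close>, as a real orthogonal basis.  It is orthogonal in \<open>V\<close> and in
  \<open>H\<close> at once, so that the same projection serves for both inner products.
\<close>

definition sine_basis :: "nat \<Rightarrow> H10" where
  "sine_basis k = scaleC_H10 (if even k then 1 else \<i>) (sine_mode (Suc (k div 2)))"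

lemma inner_sine_basis:
  "sine_basis k \<bullet> w = (real (Suc (k div 2)))\<^sup>2 * (Rep_H10 (sine_basis k) \<bullet> Rep_H10 w)"
proof -
  let ?z = "if even k then 1 else \<i>"
  let ?n = "Suc (k div 2)"
  have "sine_basis k \<bullet> w = Re (?z * cinner_L2 (Dx (sine_mode ?n)) (Dx w))"
    unfolding sine_basis_def inner_H10_def Dx_ops cinner_L2_scaleC_left[symmetric] Re_cinner_L2 ..
  also have "\<dots> = (real ?n)\<^sup>2 * Re (?z * cinner_L2 (Rep_H10 (sine_mode ?n)) (Rep_H10 w))"
    unfolding cinner_Dx_sine_mode by simp
  also have "Re (?z * cinner_L2 (Rep_H10 (sine_mode ?n)) (Rep_H10 w)) = Rep_H10 (sine_basis k) \<bullet> Rep_H10 w"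
    unfolding sine_basis_def scaleC_H10.rep_eq cinner_L2_scaleC_left[symmetric] Re_cinner_L2 ..
  finally show ?thesis .
qed

lemma sine_basis_orthogonal:
  assumes "j \<noteq> k" shows "sine_basis j \<bullet> sine_basis k = 0"
proof (cases "j div 2 = k div 2")
  case False
  let ?h = "Rep_H10 (sine_basis j) \<bullet> Rep_H10 (sine_basis k)"
  have "((real (Suc (j div 2)))\<^sup>2 - (real (Suc (k div 2)))\<^sup>2) * ?h = 0"
    using inner_sine_basis[of j "sine_basis k"] inner_sine_basis[of k "sine_basis j"]
    by (simp add: inner_commute algebra_simps)
  moreover have "(real (Suc (j div 2)))\<^sup>2 \<noteq> (real (Suc (k div 2)))\<^sup>2" using False by simp
  ultimately have "?h = 0" by simp
  then show ?thesis by (simp add: inner_sine_basis)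
next
  case True
  have par: "even j \<longleftrightarrow> odd k"
    using assms True by (metis dvd_mult_div_cancel odd_two_times_div_two_succ)
  have im: "f \<bullet> scaleC_L2 \<i> f = 0" for f
  proof -
    have "L2_of (rep_L2 f) \<bullet> L2_of (\<lambda>x. \<i> * rep_L2 f x) = (\<integral>x. rep_L2 f x \<bullet> (\<i> * rep_L2 f x) \<partial>Om)"
      by (rule L2_of_ops(6)) (intro square_integrable_rep square_integrable_cmult)+
    then show ?thesis
      using L2_of_ops(4)[OF square_integrable_rep square_integrable_rep, of \<i> f]
      by (simp add: L2_of_rep inner_complex_def)
  qed
  show ?thesis
    using par True im[of "Dx (sine_mode (Suc (k div 2)))"]
    by (cases "even k") (simp_all add: sine_basis_def inner_H10_def Dx_ops scaleC_L2_simps inner_commute)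
qed

lemma sine_basis_total:
  assumes "\<And>k. w \<bullet> sine_basis k = 0"
  shows "w = 0"
proof -
  have *: "Rep_H10 (sine_basis k) \<bullet> Rep_H10 w = 0" for k
    using assms[of k] inner_sine_basis[of k w] by (simp add: inner_commute)
  have "cinner_L2 (Rep_H10 w) (Rep_H10 (sine_mode (Suc n))) = 0" for n
  proof -
    let ?c = "cinner_L2 (Rep_H10 w) (Rep_H10 (sine_mode (Suc n)))"
    have "Re ?c = 0"
      using *[of "2 * n"] by (simp add: sine_basis_def scaleC_H10.rep_eq scaleC_L2_simps Re_cinner_L2 inner_commute)
    moreover have "Re (cnj \<i> * ?c) = 0"
      using *[of "2 * n + 1"] unfolding cinner_L2_scaleC_right[symmetric] Re_cinner_L2
      by (simp add: sine_basis_def scaleC_H10.rep_eq inner_commute)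
    ultimately show ?thesis by (simp add: complex_eq_iff)
  qed
  then have "Rep_H10 w = 0" by (rule sines_total)
  then show ?thesis by (metis Rep_H10_inject zero_H10.rep_eq)
qed

section \<open>Uniqueness of variational solutions\<close>

lemma bochner_L2_imp_L1:
  fixes u :: "real \<Rightarrow> 'a::{banach, second_countable_topology}"
  assumes "bochner_Lp 2 u"
  shows "integrable I01 u"
proof -
  interpret finite_measure I01 by (rule finite_measure_lebesgue_on) simp
  have "integrable I01 (\<lambda>t. 1 + norm (u t) ^ 2)" using assms by (simp add: bochner_Lp_def)
  then show ?thesis
  proof (rule Bochner_Integration.integrable_bound)
    have "norm (u t) \<le> 1 + norm (u t) ^ 2" for t
      using sum_squares_bound[of 1 "norm (u t)"] norm_ge_zero[of "u t"] unfolding power_one by linarith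
    then show "AE t in I01. norm (u t) \<le> norm (1 + norm (u t) ^ 2)"
      by (intro AE_I2) (auto intro: order_trans[OF _ abs_ge_self])
  qed (use assms in \<open>simp add: bochner_Lp_def\<close>)
qed

lemma integrable_norm_mult:
  fixes u :: "real \<Rightarrow> 'a::{banach, second_countable_topology}" and v :: "real \<Rightarrow> 'b::{banach, second_countable_topology}"
  assumes u: "bochner_Lp 2 u" and v: "bochner_Lp 2 v"
  shows "integrable I01 (\<lambda>t. norm (u t) * norm (v t))"
proof (rule Bochner_Integration.integrable_bound)
  show "integrable I01 (\<lambda>t. norm (u t) ^ 2 + norm (v t) ^ 2)" using u v by (simp add: bochner_Lp_def)
  have "u \<in> borel_measurable I01" "v \<in> borel_measurable I01" using u v by (auto simp: bochner_Lp_def)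
  then show "(\<lambda>t. norm (u t) * norm (v t)) \<in> borel_measurable I01" by measurable
  have "norm (u t) * norm (v t) \<le> norm (u t) ^ 2 + norm (v t) ^ 2" for t
    using sum_squares_bound[of "norm (u t)" "norm (v t)"]
      mult_nonneg_nonneg[OF norm_ge_zero[of "u t"] norm_ge_zero[of "v t"]] by linarith
  then show "AE t in I01. norm (norm (u t) * norm (v t)) \<le> norm (norm (u t) ^ 2 + norm (v t) ^ 2)"
    by (intro AE_I2) auto
qed

lemma bochner_L2_diff:
  fixes u :: "real \<Rightarrow> 'a::{banach, second_countable_topology}"
  assumes u: "bochner_Lp 2 u" and v: "bochner_Lp 2 v"
  shows "bochner_Lp 2 (\<lambda>t. u t - v t)"
  unfolding bochner_Lp_def
proof
  have m: "u \<in> borel_measurable I01" "v \<in> borel_measurable I01" using u v by (auto simp: bochner_Lp_def)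
  then show 1: "(\<lambda>t. u t - v t) \<in> borel_measurable I01" by measurable
  show "integrable I01 (\<lambda>t. norm (u t - v t) ^ 2)"
  proof (rule Bochner_Integration.integrable_bound)
    show "integrable I01 (\<lambda>t. norm (u t) ^ 2 + 2 * (norm (u t) * norm (v t)) + norm (v t) ^ 2)"
      using u v integrable_norm_mult[OF u v] by (simp add: bochner_Lp_def)
    have "norm (u t - v t) ^ 2 \<le> (norm (u t) + norm (v t)) ^ 2" for t
      by (intro power_mono norm_triangle_ineq4) auto
    then show "AE t in I01. norm (norm (u t - v t) ^ 2) \<le> norm (norm (u t) ^ 2 + 2 * (norm (u t) * norm (v t)) + norm (v t) ^ 2)"
      by (intro AE_I2) (auto simp: power2_sum mult.assoc add_ac intro: order_trans[OF _ abs_ge_self])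
  qed (use 1 in measurable)
qed

lemma bounded_linear_Re_dual_pair: "bounded_linear (\<lambda>l. Re (dual_pair l w))"
  by (rule bounded_linear_intro[where K = "norm w"])
     (auto simp: dual_pair_ops intro: order_trans[OF abs_Re_le_cmod dual_pair_bound])

lemma dual_pair_sum: "dual_pair l (\<Sum>n\<in>A. c n *\<^sub>R b n) = (\<Sum>n\<in>A. c n *\<^sub>R dual_pair l (b n))"
proof -
  interpret bounded_linear "dual_pair l"
    unfolding dual_pair.rep_eq[abs_def] by (rule blinfun.bounded_linear_right)
  show ?thesis by (simp add: sum scaleR)
qed

text \<open>
  With \<open>z\<close> projected onto finitely many sines in the second argument, the integral is a nonnegative
  combination of the squares of the coefficients of \<open>z(1)\<close>, by the scalar energy identity.  The
  projections converge in \<open>V\<close> and do not increase the norm, so dominated convergence applies.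
\<close>

lemma integral_dual_pair_deriv_nonneg:
  assumes z: "bochner_Lp 2 z" and z': "bochner_Lp 2 z'" and w: "weak_deriv 0 1 (\<lambda>t. H10_to_Hm1 (z t)) z'"
    and c: "continuous_on {0..1} c" "AE t in I01. c t = H10_to_L2 (z t)" "c 0 = 0"
  shows "integrable I01 (\<lambda>t. Re (dual_pair (z' t) (z t)))" "0 \<le> (\<integral>t. Re (dual_pair (z' t) (z t)) \<partial>I01)"
proof -
  let ?b = sine_basis
  let ?c = "\<lambda>n. ?b n \<bullet> ?b n"
  have m: "z \<in> borel_measurable I01" "z' \<in> borel_measurable I01" using z z' by (auto simp: bochner_Lp_def)
  note iz = bochner_L2_imp_L1[OF z] and iz' = bochner_L2_imp_L1[OF z']
  have bl: "bounded_linear (\<lambda>v. H10_to_Hm1 v)"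
    by (rule bounded_linear_compose[OF bounded_linear_L2_to_Hm1 bounded_linear_Rep_H10])
  have iz0: "integrable I01 (\<lambda>t. H10_to_Hm1 (z t))" by (rule integrable_bounded_linear[OF bl iz])
  define r where "r n t = Re (dual_pair (z' t) (?b n))" for n t
  have ri: "integrable I01 (r n)" for n
    unfolding r_def by (rule integrable_bounded_linear[OF bounded_linear_Re_dual_pair iz'])
  define P where "P N t = (\<Sum>n<N. ((z t \<bullet> ?b n) / ?c n) *\<^sub>R ?b n)" for N t
  have P: "norm (P N t) \<le> norm (z t)" "(\<lambda>N. P N t) \<longlonglongrightarrow> z t" for N t
    using orthogonal_expansion[OF sine_basis_orthogonal sine_basis_total, where x = "z t"]
    by (simp_all add: P_def)
  have coef: "integrable I01 (\<lambda>t. (z t \<bullet> ?b n) * r n t)" "0 \<le> (\<integral>t. (z t \<bullet> ?b n) * r n t \<partial>I01)" for n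
  proof -
    define y where "y t = c t \<bullet> Rep_H10 (?b n)" for t
    let ?k = "(real (Suc (n div 2)))\<^sup>2"
    have y: "continuous_on {0..1} y" "y 0 = 0"
      unfolding y_def using c by (auto intro!: continuous_intros)
    have my: "y \<in> borel_measurable I01"
      by (rule continuous_imp_measurable_on_sets_lebesgue[OF continuous_on_subset[OF y(1)]]) auto
    have "weak_deriv 0 1 (\<lambda>t. Re (dual_pair (H10_to_Hm1 (z t)) (?b n))) (r n)"
      unfolding r_def by (rule weak_deriv_bounded_linear[OF bounded_linear_Re_dual_pair w iz0 iz'])
    moreover have AEy: "AE t in I01. Re (dual_pair (H10_to_Hm1 (z t)) (?b n)) = y t"
      using c(2) by eventually_elim (simp add: y_def dual_pair_L2 Re_cinner_L2)
    ultimately have wy: "weak_deriv 0 1 y (r n)"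
      by (rule weak_deriv_cong_AE)
         (use my ri[of n] integrable_bounded_linear[OF bounded_linear_Re_dual_pair iz0] in auto)
    note e = weak_deriv_energy[OF _ y ri wy, simplified]
    have AE: "AE t in I01. (z t \<bullet> ?b n) * r n t = ?k * (y t * r n t)"
      using c(2)
    proof eventually_elim
      case (elim t)
      have "z t \<bullet> ?b n = ?k * y t"
        using inner_sine_basis[of n "z t"] elim by (simp add: y_def inner_commute)
      then show ?case by simp
    qed
    have mm: "(\<lambda>t. (z t \<bullet> ?b n) * r n t) \<in> borel_measurable I01" using m ri[of n] by measurable
    have i: "integrable I01 (\<lambda>t. ?k * (y t * r n t))" using e(1) by (simp del: of_nat_Suc)
    show "integrable I01 (\<lambda>t. (z t \<bullet> ?b n) * r n t)"
    proof (rule integrable_cong_AE_imp[OF i mm])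
      show "AE t in I01. ?k * (y t * r n t) = (z t \<bullet> ?b n) * r n t" using AE by eventually_elim (rule sym)
    qed
    have "(\<integral>t. (z t \<bullet> ?b n) * r n t \<partial>I01) = (\<integral>t. ?k * (y t * r n t) \<partial>I01)"
      using i by (intro integral_cong_AE mm AE) auto
    also have "\<dots> = ?k * ((y 1)\<^sup>2 / 2)" using e(2) by (simp del: of_nat_Suc)
    finally have eq: "(\<integral>t. (z t \<bullet> ?b n) * r n t \<partial>I01) = ?k * ((y 1)\<^sup>2 / 2)" .
    show "0 \<le> (\<integral>t. (z t \<bullet> ?b n) * r n t \<partial>I01)" unfolding eq by simp
  qed
  have PN: "Re (dual_pair (z' t) (P N t)) = (\<Sum>n<N. (1 / ?c n) * ((z t \<bullet> ?b n) * r n t))" for N t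
    by (simp add: P_def dual_pair_sum r_def)
  have Pi: "integrable I01 (\<lambda>t. Re (dual_pair (z' t) (P N t)))" "0 \<le> (\<integral>t. Re (dual_pair (z' t) (P N t)) \<partial>I01)" for N
  proof -
    have i: "integrable I01 (\<lambda>t. (1 / ?c n) * ((z t \<bullet> ?b n) * r n t))" for n
      by (intro integrable_mult_right coef)
    show "integrable I01 (\<lambda>t. Re (dual_pair (z' t) (P N t)))" unfolding PN by (intro Bochner_Integration.integrable_sum i)
    have "(\<integral>t. Re (dual_pair (z' t) (P N t)) \<partial>I01) = (\<Sum>n<N. (1 / ?c n) * (\<integral>t. (z t \<bullet> ?b n) * r n t \<partial>I01))"
      unfolding PN Bochner_Integration.integral_sum[OF i] integral_mult_right_zero ..
    then show "0 \<le> (\<integral>t. Re (dual_pair (z' t) (P N t)) \<partial>I01)"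
      using coef(2) by (simp only:) (intro sum_nonneg mult_nonneg_nonneg, auto)
  qed
  have lim: "(\<lambda>N. Re (dual_pair (z' t) (P N t))) \<longlonglongrightarrow> Re (dual_pair (z' t) (z t))" for t
  proof -
    have "bounded_linear (dual_pair (z' t))"
      unfolding dual_pair.rep_eq[abs_def] by (rule blinfun.bounded_linear_right)
    then show ?thesis by (rule tendsto_Re[OF bounded_linear.tendsto[OF _ P(2)]])
  qed
  have bound: "norm (Re (dual_pair (z' t) v)) \<le> norm (z' t) * norm (z t)" if "norm v \<le> norm (z t)" for v t
  proof -
    have "norm (Re (dual_pair (z' t) v)) \<le> cmod (dual_pair (z' t) v)" by (simp add: abs_Re_le_cmod)
    also have "\<dots> \<le> norm (z' t) * norm v" by (rule dual_pair_bound)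
    also have "\<dots> \<le> norm (z' t) * norm (z t)" using that by (intro mult_left_mono) auto
    finally show ?thesis .
  qed
  have mz: "(\<lambda>t. Re (dual_pair (z' t) (z t))) \<in> borel_measurable I01"
    by (rule borel_measurable_LIMSEQ_metric[where f = "\<lambda>N t. Re (dual_pair (z' t) (P N t))"])
       (use Pi(1) lim in auto)
  note dc = integrable_norm_mult[OF z' z]
  show "integrable I01 (\<lambda>t. Re (dual_pair (z' t) (z t)))"
    by (rule Bochner_Integration.integrable_bound[OF dc mz]) (use bound in auto)
  have "(\<lambda>N. \<integral>t. Re (dual_pair (z' t) (P N t)) \<partial>I01) \<longlonglongrightarrow> (\<integral>t. Re (dual_pair (z' t) (z t)) \<partial>I01)"
    by (rule integral_dominated_convergence[OF mz _ dc])
       (use Pi(1) lim bound P(1) in auto)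
  then show "0 \<le> (\<integral>t. Re (dual_pair (z' t) (z t)) \<partial>I01)"
    by (rule LIMSEQ_le_const) (use Pi(2) in auto)
qed

lemma opA_eq_neg_div:
  assumes b: "ess_bounded b"
  shows "square_integrable (\<lambda>x. of_real (b x) * rep_L2 (Dx v) x)"
    "opA b v = neg_div (L2_of (\<lambda>x. of_real (b x) * rep_L2 (Dx v) x))"
proof -
  show g: "square_integrable (\<lambda>x. of_real (b x) * rep_L2 (Dx v) x)"
  proof (rule square_integrable_mult[OF square_integrable_rep])
    show "(\<lambda>x. complex_of_real (b x)) \<in> borel_measurable Om" using ess_boundedE(1)[OF b] by measurable
    show "AE x in Om. cmod (complex_of_real (b x)) \<le> real_of_ereal (esssup Om (\<lambda>x. ereal \<bar>b x\<bar>))"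
      using ess_boundedE(2)[OF b] by simp
  qed
  show "opA b v = neg_div (L2_of (\<lambda>x. of_real (b x) * rep_L2 (Dx v) x))"
    using L2_of_ops(5)[OF g square_integrable_rep]
    by (intro Hm1_eqI) (simp add: dual_pair_opA[OF b] dual_pair_neg_div L2_of_rep)
qed

lemma opA_diff:
  assumes b: "ess_bounded b"
  shows "opA b (v - w) = opA b v - opA b w"
proof -
  interpret bounded_linear neg_div by (rule bounded_linear_neg_div)
  have d: "AE x in Om. rep_L2 (Dx (v - w)) x = rep_L2 (Dx v) x - rep_L2 (Dx w) x"
    using rep_L2_of[OF square_integrable_diff[OF square_integrable_rep square_integrable_rep], of "Dx v" "Dx w"]
      L2_of_ops(2)[OF square_integrable_rep square_integrable_rep, of "Dx v" "Dx w"]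
    by (simp add: L2_of_rep Dx_ops)
  note s = opA_eq_neg_div[OF b]
  have "L2_of (\<lambda>x. of_real (b x) * rep_L2 (Dx (v - w)) x)
      = L2_of (\<lambda>x. of_real (b x) * rep_L2 (Dx v) x - complex_of_real (b x) * rep_L2 (Dx w) x)"
    unfolding L2_of_eq_iff[OF s(1) square_integrable_diff[OF s(1) s(1)]]
    using d by eventually_elim (simp add: right_diff_distrib)
  then show ?thesis unfolding s(2) diff[symmetric] L2_of_ops(2)[OF s(1) s(1)] by simp
qed

lemma opA_coercive:
  assumes b: "ess_bounded b" and l: "AE x in Om. l \<le> b x"
  shows "l * (norm v)\<^sup>2 \<le> Re (dual_pair (opA b v) v)"
proof -
  let ?p = "rep_L2 (Dx v)"
  note s = opA_eq_neg_div[OF b]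
  have i: "integrable Om (\<lambda>x. complex_of_real (b x) * ?p x * cnj (?p x))"
    by (rule square_integrable_prod(1)[OF s(1) square_integrable_rep])
  have eq: "Re (complex_of_real (b x) * ?p x * cnj (?p x)) = b x * (cmod (?p x))\<^sup>2" for x
    by (simp only: mult.assoc complex_norm_square[symmetric] Re_complex_of_real flip: of_real_mult of_real_power)
  have "l * (norm v)\<^sup>2 = (\<integral>x. l * (cmod (?p x))\<^sup>2 \<partial>Om)"
    by (simp add: norm_H10_def norm_L2_rep)
  also have "\<dots> \<le> (\<integral>x. Re (complex_of_real (b x) * ?p x * cnj (?p x)) \<partial>Om)"
  proof (rule integral_mono_AE)
    show "integrable Om (\<lambda>x. l * (cmod (?p x))\<^sup>2)"
      using square_integrable_rep by (simp add: square_integrable_def)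
    show "integrable Om (\<lambda>x. Re (complex_of_real (b x) * ?p x * cnj (?p x)))" using i by (rule integrable_Re)
    show "AE x in Om. l * (cmod (?p x))\<^sup>2 \<le> Re (complex_of_real (b x) * ?p x * cnj (?p x))"
      unfolding eq using l by eventually_elim (simp add: mult_right_mono)
  qed
  also have "\<dots> = Re (dual_pair (opA b v) v)" unfolding dual_pair_opA[OF b] by (rule integral_Re[OF i])
  finally show ?thesis .
qed

text \<open>
  For the difference \<open>z\<close> of two solutions \<open>Re \<langle>z', z\<rangle> = - Re \<langle>A z, z\<rangle> \<le> - l \<parallel>z\<parallel>\<^sup>2\<close>, and the integral of the left-hand
  side is nonnegative, so \<open>z\<close> vanishes almost everywhere.
\<close>

theorem lions_solution_unique:
  assumes b: "\<And>t. t \<in> {0<..<1} \<Longrightarrow> ess_bounded (a t)"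
    and l: "0 < l" "\<And>t. t \<in> {0<..<1} \<Longrightarrow> AE x in Om. l \<le> a t x"
    and v: "lions_solution a f u0 v" and w: "lions_solution a f u0 w"
  shows "AE t in I01. v t = w t"
proof -
  obtain v' cv where v': "bochner_Lp 2 v" "bochner_Lp 2 v'" "weak_deriv 0 1 (\<lambda>t. H10_to_Hm1 (v t)) v'"
    "AE t in I01. v' t + opA (a t) (v t) = f t"
    "continuous_on {0..1} cv" "AE t in I01. cv t = H10_to_L2 (v t)" "cv 0 = u0"
    using v unfolding lions_solution_def by blast
  obtain w' cw where w': "bochner_Lp 2 w" "bochner_Lp 2 w'" "weak_deriv 0 1 (\<lambda>t. H10_to_Hm1 (w t)) w'"
    "AE t in I01. w' t + opA (a t) (w t) = f t"
    "continuous_on {0..1} cw" "AE t in I01. cw t = H10_to_L2 (w t)" "cw 0 = u0"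
    using w unfolding lions_solution_def by blast
  define z where "z t = v t - w t" for t
  define z' where "z' t = v' t - w' t" for t
  interpret R: bounded_linear Rep_H10 by (rule bounded_linear_Rep_H10)
  interpret L: bounded_linear L2_to_Hm1 by (rule bounded_linear_L2_to_Hm1)
  have bl: "bounded_linear (\<lambda>v. H10_to_Hm1 v)"
    by (rule bounded_linear_compose[OF bounded_linear_L2_to_Hm1 bounded_linear_Rep_H10])
  have z: "bochner_Lp 2 z" "bochner_Lp 2 z'"
    unfolding z_def[abs_def] z'_def[abs_def] using bochner_L2_diff v'(1,2) w'(1,2) by blast+
  have wz: "weak_deriv 0 1 (\<lambda>t. H10_to_Hm1 (z t)) z'"
    unfolding weak_deriv_def
  proof (intro allI impI)
    fix \<phi> :: "real \<Rightarrow> real" assume \<phi>: "test_function 0 1 \<phi>"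
    note i = integrable_test_scaleR[OF test_function_vderiv[OF \<phi>] integrable_bounded_linear[OF bl bochner_L2_imp_L1]]
      integrable_test_scaleR[OF \<phi> bochner_L2_imp_L1]
    show "(\<integral>t. vderiv \<phi> t *\<^sub>R H10_to_Hm1 (z t) \<partial>I01) = - (\<integral>t. \<phi> t *\<^sub>R z' t \<partial>I01)"
      using i(1)[OF v'(1)] i(1)[OF w'(1)] i(2)[OF v'(2)] i(2)[OF w'(2)] v'(3) w'(3) \<phi>
      by (simp add: z_def z'_def R.diff L.diff scaleR_diff_right weak_deriv_def)
  qed
  have c: "continuous_on {0..1} (\<lambda>t. cv t - cw t)" by (intro continuous_intros v'(5) w'(5))
  have cz: "AE t in I01. cv t - cw t = H10_to_L2 (z t)"
    using v'(6) w'(6) by eventually_elim (simp add: z_def R.diff)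
  have c0: "cv 0 - cw 0 = 0" using v'(7) w'(7) by simp
  note e = integral_dual_pair_deriv_nonneg[OF z wz c cz c0]
  have coerc: "AE t in I01. Re (dual_pair (z' t) (z t)) \<le> - (l * (norm (z t))\<^sup>2)"
    using v'(4) w'(4) AE_space
  proof eventually_elim
    case (elim t)
    then have t: "t \<in> {0<..<1}" by simp
    have "z' t = - opA (a t) (z t)"
      using elim by (simp add: z_def z'_def opA_diff[OF b[OF t]] algebra_simps)
    then have "dual_pair (z' t) (z t) = dual_pair (0 - opA (a t) (z t)) (z t)" by simp
    then show ?case using opA_coercive[OF b[OF t] l(2)[OF t], of "z t"] unfolding dual_pair_ops by simp
  qed
  have iz: "integrable I01 (\<lambda>t. (norm (z t))\<^sup>2)" using z(1) by (simp add: bochner_Lp_def)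
  have "0 \<le> (\<integral>t. - (l * (norm (z t))\<^sup>2) \<partial>I01)"
    by (rule order_trans[OF e(2)]) (rule integral_mono_AE[OF e(1) _ coerc], use iz in simp)
  then have "l * (\<integral>t. (norm (z t))\<^sup>2 \<partial>I01) \<le> 0" by simp
  then have "(\<integral>t. (norm (z t))\<^sup>2 \<partial>I01) \<le> 0" using l(1) by (simp add: mult_le_0_iff)
  moreover have "0 \<le> (\<integral>t. (norm (z t))\<^sup>2 \<partial>I01)" by simp
  ultimately have "(\<integral>t. (norm (z t))\<^sup>2 \<partial>I01) = 0" by simp
  then have "AE t in I01. (norm (z t))\<^sup>2 = 0"
    using integral_nonneg_eq_0_iff_AE[OF iz] by simp
  then show ?thesis by eventually_elim (simp add: z_def)
qed

section \<open>Pulses in time\<close>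

text \<open>
  The spatial frequencies; the frequencies in time are their squares.  They are multiples of \<open>8\<close>, so that
  whole periods of \<open>sin (freq n * x)\<close> fit into \<open>(0, \<pi>/4)\<close>.
\<close>

definition freq :: "nat \<Rightarrow> real" where "freq n = 2 ^ (n + 3)"

text \<open>
  The length of the final time interval on which the \<open>n\<close>th pulse is active: \<open>1/(n+4)\<close>, rounded up to a
  whole number of periods.
\<close>

definition active_len :: "nat \<Rightarrow> real" where
  "active_len n = real_of_int \<lceil>(freq n)\<^sup>2 / real (n + 4)\<rceil> / (freq n)\<^sup>2"

text \<open>
  Clamping the time to the active interval freezes the phase at a multiple of \<open>2 \<pi>\<close> before and after it,
  which switches the pulses off without breaking their Lipschitz continuity.
\<close>

definition phase :: "nat \<Rightarrow> real \<Rightarrow> real" where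
  "phase n t = 2 * pi * (freq n)\<^sup>2 * max (1 - active_len n) (min t 1)"

definition sin_pulse :: "nat \<Rightarrow> real \<Rightarrow> real" where "sin_pulse n t = sin (phase n t)"
definition cos_pulse :: "nat \<Rightarrow> real \<Rightarrow> real" where "cos_pulse n t = 1 - cos (phase n t)"

lemma freq_pos [simp]: "0 < freq n" "freq n \<noteq> 0" "0 \<le> freq n"
  by (simp_all add: freq_def)

lemma freq_ge: "8 \<le> freq n"
  by (simp add: freq_def power_add)

lemma freq_sq_ge: "real (n + 4) \<le> (freq n)\<^sup>2 / 4" "64 \<le> (freq n)\<^sup>2"
proof -
  have "real n + 1 \<le> 2 ^ n" by (induction n) auto
  then have "real (n + 4) \<le> 4 * 2 ^ n" by simp
  also have "(4::real) * 2 ^ n \<le> 16 * (2 ^ n)\<^sup>2"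
  proof -
    have p: "(1::real) \<le> 2 ^ n" by simp
    have "4 * (2 ^ n * 1) \<le> 16 * (2 ^ n * (2 ^ n :: real))" by (intro mult_mono p) auto
    then show ?thesis by (simp add: power2_eq_square)
  qed
  finally show "real (n + 4) \<le> (freq n)\<^sup>2 / 4" by (simp add: freq_def power_add power_mult_distrib)
  show "64 \<le> (freq n)\<^sup>2" using power_mono[OF freq_ge, of 2 n] by simp
qed

lemma active_len_bounds:
  "1 / real (n + 4) \<le> active_len n" "active_len n \<le> 2 / real (n + 4)" "active_len n \<le> 1 / 2" "1 / (freq n)\<^sup>2 \<le> active_len n"
proof -
  let ?y = "(freq n)\<^sup>2 / real (n + 4)"
  have y: "?y / (freq n)\<^sup>2 = 1 / real (n + 4)" by simp
  show "1 / real (n + 4) \<le> active_len n"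
    unfolding active_len_def y[symmetric] by (intro divide_right_mono) auto
  have le: "active_len n \<le> 1 / real (n + 4) + 1 / (freq n)\<^sup>2"
    unfolding active_len_def y[symmetric] add_divide_distrib[symmetric]
    by (intro divide_right_mono) (linarith, simp)
  have "1 / (freq n)\<^sup>2 \<le> 1 / real (n + 4)"
    using freq_sq_ge[of n] by (intro divide_left_mono) auto
  then show "active_len n \<le> 2 / real (n + 4)" using le by simp
  have "1 / (freq n)\<^sup>2 \<le> 1 / 64" using freq_sq_ge(2)[of n] by (intro divide_left_mono) auto
  moreover have "1 / real (n + 4) \<le> 1 / 4" by (intro divide_left_mono) auto
  ultimately show "active_len n \<le> 1 / 2" using le by linarith
  have "0 < ?y" by simp
  then have "1 \<le> \<lceil>?y\<rceil>" by (simp only: one_le_ceiling)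
  then have "1 \<le> real_of_int \<lceil>?y\<rceil>" by (simp only: of_int_1_le_iff)
  then show "1 / (freq n)\<^sup>2 \<le> active_len n"
    unfolding active_len_def by (intro divide_right_mono) auto
qed

lemma phase_onset: "phase n t = 2 * pi * of_int ((4 ^ (n + 3)) - \<lceil>(freq n)\<^sup>2 / real (n + 4)\<rceil>)" if "t \<le> 1 - active_len n"
proof -
  have "0 \<le> active_len n" using active_len_bounds(1)[of n] by (meson divide_nonneg_nonneg of_nat_0_le_iff order_trans zero_le_one)
  then have "max (1 - active_len n) (min t 1) = 1 - active_len n" using that by simp
  moreover have "(freq n)\<^sup>2 = 4 ^ (n + 3)" by (simp add: freq_def power2_eq_square flip: power_mult_distrib)
  ultimately show ?thesis by (simp add: phase_def active_len_def right_diff_distrib)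
qed

lemma phase_end: "phase n t = 2 * pi * of_int (4 ^ (n + 3))" if "1 \<le> t"
proof -
  have "0 \<le> active_len n" using active_len_bounds(1)[of n] by (meson divide_nonneg_nonneg of_nat_0_le_iff order_trans zero_le_one)
  moreover have "(freq n)\<^sup>2 = 4 ^ (n + 3)" by (simp add: freq_def power2_eq_square flip: power_mult_distrib)
  ultimately show ?thesis using that by (simp add: phase_def)
qed

lemma pulse_zero:
  assumes "t \<le> 1 - active_len n \<or> 1 \<le> t"
  shows "sin_pulse n t = 0" "cos_pulse n t = 0"
proof -
  obtain k :: int where "phase n t = 2 * pi * of_int k"
    using assms phase_onset phase_end by metis
  then show "sin_pulse n t = 0" "cos_pulse n t = 0"
    using sin_int_2pin[of k] cos_int_2pin[of k] by (simp_all add: sin_pulse_def cos_pulse_def)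
qed

lemma phase_diff: "\<bar>phase n t - phase n s\<bar> \<le> 2 * pi * (freq n)\<^sup>2 * \<bar>t - s\<bar>"
proof -
  have "\<bar>phase n t - phase n s\<bar> = 2 * pi * (freq n)\<^sup>2 * \<bar>max (1 - active_len n) (min t 1) - max (1 - active_len n) (min s 1)\<bar>"
    unfolding phase_def right_diff_distrib[symmetric] by (simp add: abs_mult)
  also have "\<dots> \<le> 2 * pi * (freq n)\<^sup>2 * \<bar>t - s\<bar>" by (intro mult_left_mono) auto
  finally show ?thesis .
qed

text \<open>
  What the sines and cosines have in common: they are bounded, oscillate no faster than the square
  of the spatial frequency, and only finitely many of them are active at any one time.
\<close>

definition pulse_family :: "(nat \<Rightarrow> real \<Rightarrow> real) \<Rightarrow> bool" where
  "pulse_family p \<longleftrightarrow>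
     (\<forall>n t. t \<le> 1 - active_len n \<or> 1 \<le> t \<longrightarrow> p n t = 0) \<and>
     (\<forall>n s t. \<bar>p n t - p n s\<bar> \<le> 2 \<and> \<bar>p n t - p n s\<bar> \<le> 2 * pi * (freq n)\<^sup>2 * \<bar>t - s\<bar>)"

lemma pulse_family_sin: "pulse_family sin_pulse"
  unfolding pulse_family_def
proof (intro conjI allI impI)
  fix n s t
  show "\<bar>sin_pulse n t - sin_pulse n s\<bar> \<le> 2"
    unfolding sin_pulse_def using abs_sin_le_one[of "phase n t"] abs_sin_le_one[of "phase n s"] by linarith
  have "\<bar>sin (phase n t) - sin (phase n s)\<bar> = 2 * (\<bar>sin ((phase n t - phase n s) / 2)\<bar> * \<bar>cos ((phase n t + phase n s) / 2)\<bar>)"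
    unfolding sin_diff_sin by (simp add: abs_mult)
  also have "\<dots> \<le> 2 * (\<bar>(phase n t - phase n s) / 2\<bar> * 1)"
    by (intro mult_left_mono mult_mono abs_sin_x_le_abs_x) auto
  finally show "\<bar>sin_pulse n t - sin_pulse n s\<bar> \<le> 2 * pi * (freq n)\<^sup>2 * \<bar>t - s\<bar>"
    using phase_diff[of n t s] by (simp add: sin_pulse_def)
qed (rule pulse_zero(1))

lemma pulse_family_cos: "pulse_family cos_pulse"
  unfolding pulse_family_def
proof (intro conjI allI impI)
  fix n s t
  show "\<bar>cos_pulse n t - cos_pulse n s\<bar> \<le> 2"
    unfolding cos_pulse_def using abs_cos_le_one[of "phase n t"] abs_cos_le_one[of "phase n s"] by linarith
  have "\<bar>cos (phase n s) - cos (phase n t)\<bar> = 2 * (\<bar>sin ((phase n s + phase n t) / 2)\<bar> * \<bar>sin ((phase n t - phase n s) / 2)\<bar>)"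
    unfolding cos_diff_cos by (simp add: abs_mult)
  also have "\<dots> \<le> 2 * (1 * \<bar>(phase n t - phase n s) / 2\<bar>)"
    by (intro mult_left_mono mult_mono abs_sin_x_le_abs_x) auto
  finally show "\<bar>cos_pulse n t - cos_pulse n s\<bar> \<le> 2 * pi * (freq n)\<^sup>2 * \<bar>t - s\<bar>"
    using phase_diff[of n t s] by (simp add: cos_pulse_def)
qed (rule pulse_zero(2))

lemma pulse_eventually_zero:
  assumes p: "pulse_family p"
  shows "\<exists>N. \<forall>n\<ge>N. p n t = 0"
proof (cases "t < 1")
  case True
  obtain N where N: "2 / (1 - t) < real N" using reals_Archimedean2 by blast
  have "p n t = 0" if "n \<ge> N" for n
  proof -
    have "2 / (1 - t) \<le> real (n + 4)" using N that by linarith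
    then have "2 / real (n + 4) \<le> 1 - t" using True by (simp add: field_simps)
    then have "t \<le> 1 - active_len n" using active_len_bounds(2)[of n] by linarith
    then show ?thesis using p by (simp add: pulse_family_def)
  qed
  then show ?thesis by blast
qed (use p in \<open>auto simp: pulse_family_def\<close>)

definition pulse_sum :: "(nat \<Rightarrow> real \<Rightarrow> real) \<Rightarrow> (nat \<Rightarrow> 'a::real_normed_vector) \<Rightarrow> real \<Rightarrow> 'a" where
  "pulse_sum p x t = (\<Sum>n. p n t *\<^sub>R x n)"

lemma pulse_sum_eventually_eq:
  assumes p: "pulse_family p"
  shows "\<exists>N. \<forall>M\<ge>N. pulse_sum p x t = (\<Sum>n<M. p n t *\<^sub>R x n)"
proof -
  obtain N where N: "\<And>n. n \<ge> N \<Longrightarrow> p n t = 0" using pulse_eventually_zero[OF p] by blast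
  have "pulse_sum p x t = (\<Sum>n<M. p n t *\<^sub>R x n)" if "M \<ge> N" for M
    unfolding pulse_sum_def by (rule suminf_finite) (use N that in auto)
  then show ?thesis by blast
qed

lemma pulse_sum_tendsto:
  assumes "pulse_family p"
  shows "(\<lambda>M. \<Sum>n<M. p n t *\<^sub>R x n) \<longlonglongrightarrow> pulse_sum p x t"
proof -
  obtain N where "\<And>M. M \<ge> N \<Longrightarrow> pulse_sum p x t = (\<Sum>n<M. p n t *\<^sub>R x n)"
    using pulse_sum_eventually_eq[OF assms] by blast
  then show ?thesis by (intro tendsto_eventually eventually_sequentiallyI[of N]) simp
qed

lemma pulse_sum_zero:
  assumes p: "pulse_family p" and t: "t \<le> 1 / 2 \<or> 1 \<le> t"
  shows "pulse_sum p x t = 0"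
proof -
  have "p n t = 0" for n
  proof -
    have "t \<le> 1 - active_len n \<or> 1 \<le> t" using t active_len_bounds(3)[of n] by linarith
    then show ?thesis using p unfolding pulse_family_def by blast
  qed
  then show ?thesis by (simp add: pulse_sum_def)
qed

lemma pulse_sum_linear:
  assumes p: "pulse_family p" and T: "linear T"
  shows "T (pulse_sum p x t) = pulse_sum p (\<lambda>n. T (x n)) t"
proof -
  obtain N where N: "\<And>M. M \<ge> N \<Longrightarrow> pulse_sum p x t = (\<Sum>n<M. p n t *\<^sub>R x n)"
    using pulse_sum_eventually_eq[OF p] by blast
  obtain N' where N': "\<And>M. M \<ge> N' \<Longrightarrow> pulse_sum p (\<lambda>n. T (x n)) t = (\<Sum>n<M. p n t *\<^sub>R T (x n))"
    using pulse_sum_eventually_eq[OF p, of "\<lambda>n. T (x n)"] by blast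
  show ?thesis using N[of "max N N'"] N'[of "max N N'"] T by (simp add: linear_sum linear_scale)
qed

lemma continuous_pulse:
  assumes "pulse_family p" shows "continuous_on S (p n)"
proof -
  have "(2 * pi * (freq n)\<^sup>2)-lipschitz_on S (p n)"
    using assms by (intro lipschitz_onI) (auto simp: pulse_family_def dist_real_def)
  then show ?thesis by (rule lipschitz_on_continuous_on)
qed

lemma pulse_sum_measurable:
  fixes x :: "nat \<Rightarrow> 'a::{banach, second_countable_topology}"
  assumes p: "pulse_family p"
  shows "pulse_sum p x \<in> borel_measurable (lebesgue_on S)"
proof (rule borel_measurable_LIMSEQ_metric)
  show "(\<lambda>t. \<Sum>n<M. p n t *\<^sub>R x n) \<in> borel_measurable (lebesgue_on S)" for M
    by (rule continuous_measurable_on) (intro continuous_intros continuous_pulse[OF p])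
qed (rule pulse_sum_tendsto[OF p])

text \<open>
  Splitting the sum at \<open>2\<^sup>-\<^sup>n = r\<close> gives two geometric series.  The inductive form of this estimate
  rests on the self-similarity \<open>S(r) = min 1 r\<^sup>2 + S(2 r) / 2\<close> and the explicit majorant.
\<close>

lemma dyadic_min_sum:
  fixes r :: real
  assumes r: "0 \<le> r"
  shows "(\<Sum>n<M. min (1 / 2 ^ n) (2 ^ n * r\<^sup>2)) \<le> (if r \<le> 1 then 4 * r - 2 * r\<^sup>2 else 2)"
  using r
proof (induction M arbitrary: r)
  case 0
  then have "r \<le> 1 \<Longrightarrow> r * r \<le> 1 * r" by (intro mult_right_mono) auto
  then show ?case using 0 by (auto simp: power2_eq_square)
next
  case (Suc M)
  have "(\<Sum>n<Suc M. min (1 / 2 ^ n) (2 ^ n * r\<^sup>2)) = min 1 (r\<^sup>2) + (\<Sum>n<M. min (1 / 2 ^ Suc n) (2 ^ Suc n * r\<^sup>2))"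
    by (subst sum.lessThan_Suc_shift) simp
  also have "(\<Sum>n<M. min (1 / 2 ^ Suc n) (2 ^ Suc n * r\<^sup>2)) = (\<Sum>n<M. min (1 / 2 ^ n) (2 ^ n * (2 * r)\<^sup>2)) / 2"
    unfolding sum_divide_distrib by (intro sum.cong refl) (auto simp: min_def power2_eq_square field_simps)
  also have "\<dots> \<le> (if 2 * r \<le> 1 then 4 * (2 * r) - 2 * (2 * r)\<^sup>2 else 2) / 2"
    using Suc.IH[of "2 * r"] Suc.prems by (intro divide_right_mono) auto
  finally have le: "(\<Sum>n<Suc M. min (1 / 2 ^ n) (2 ^ n * r\<^sup>2))
      \<le> min 1 (r\<^sup>2) + (if 2 * r \<le> 1 then 4 * (2 * r) - 2 * (2 * r)\<^sup>2 else 2) / 2" by simp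
  consider "r \<le> 1/2" | "1/2 < r" "r \<le> 1" | "1 < r" by linarith
  then show ?case
  proof cases
    case 1
    have "min 1 (r\<^sup>2) \<le> r\<^sup>2" by simp
    moreover have "(if 2 * r \<le> 1 then 4 * (2 * r) - 2 * (2 * r)\<^sup>2 else 2) = 8 * r - 8 * r\<^sup>2"
      using 1 by (simp add: power2_eq_square)
    moreover have "0 \<le> r\<^sup>2" by simp
    ultimately have "(\<Sum>n<Suc M. min (1 / 2 ^ n) (2 ^ n * r\<^sup>2)) \<le> 4 * r - 2 * r\<^sup>2" using le by linarith
    then show ?thesis using 1 by (simp del: sum.lessThan_Suc)
  next
    case 2
    have "min 1 (r\<^sup>2) \<le> r\<^sup>2" by simp
    moreover have "0 \<le> (3 * r - 1) * (1 - r)" using 2 by (intro mult_nonneg_nonneg) auto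
    then have "3 * r\<^sup>2 + 1 \<le> 4 * r" by (simp add: power2_eq_square algebra_simps)
    moreover have "(if 2 * r \<le> 1 then 4 * (2 * r) - 2 * (2 * r)\<^sup>2 else 2) = 2" using 2 by simp
    ultimately have "(\<Sum>n<Suc M. min (1 / 2 ^ n) (2 ^ n * r\<^sup>2)) \<le> 4 * r - 2 * r\<^sup>2" using le by linarith
    then show ?thesis using 2 by (simp del: sum.lessThan_Suc)
  next
    case 3
    have "min 1 (r\<^sup>2) \<le> 1" by simp
    moreover have "(if 2 * r \<le> 1 then 4 * (2 * r) - 2 * (2 * r)\<^sup>2 else 2) = 2" using 3 by simp
    ultimately have "(\<Sum>n<Suc M. min (1 / 2 ^ n) (2 ^ n * r\<^sup>2)) \<le> 2" using le by linarith
    then show ?thesis using 3 by (simp del: sum.lessThan_Suc)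
  qed
qed

text \<open>
  A pulse series whose terms decay like the inverse spatial frequency is Hoelder continuous of
  exponent \<open>1/2\<close>, because the time frequency is the square of the spatial one.
\<close>

lemma pulse_sum_Hoelder:
  fixes x :: "nat \<Rightarrow> 'a::real_normed_vector"
  assumes p: "pulse_family p" and x: "\<And>n. norm (x n) \<le> C / freq n"
  shows "norm (pulse_sum p x t - pulse_sum p x s) \<le> 32 * C * sqrt \<bar>t - s\<bar>"
proof -
  have C: "0 \<le> C" using order_trans[OF norm_ge_zero x[of 0]] by (simp add: freq_def zero_le_divide_iff)
  obtain N where N: "\<And>M. M \<ge> N \<Longrightarrow> pulse_sum p x t = (\<Sum>n<M. p n t *\<^sub>R x n)"
    using pulse_sum_eventually_eq[OF p] by blast
  obtain N' where N': "\<And>M. M \<ge> N' \<Longrightarrow> pulse_sum p x s = (\<Sum>n<M. p n s *\<^sub>R x n)"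
    using pulse_sum_eventually_eq[OF p] by blast
  define M where "M = max N N'"
  define h where "h = \<bar>t - s\<bar>"
  have incr: "norm ((p n t - p n s) *\<^sub>R x n) \<le> C * min (1 / 2 ^ n) (2 ^ n * (8 * sqrt h)\<^sup>2)" for n
  proof -
    have "norm ((p n t - p n s) *\<^sub>R x n) \<le> min 2 (2 * pi * (freq n)\<^sup>2 * h) * (C / freq n)"
      unfolding norm_scaleR h_def using p C x[of n]
      by (intro mult_mono) (auto simp: pulse_family_def)
    also have "\<dots> = min (2 * (C / freq n)) (2 * pi * (freq n)\<^sup>2 * h * (C / freq n))"
      using C by (subst min_mult_distrib_right) simp
    also have "\<dots> = min (C * (2 / freq n)) (C * (2 * pi * freq n * h))"
      by (simp add: power2_eq_square mult_ac)
    also have "\<dots> = C * min (2 / freq n) (2 * pi * freq n * h)"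
      using C by (subst min_mult_distrib_left) simp
    also have "\<dots> \<le> C * min (1 / 2 ^ n) (2 ^ n * (8 * sqrt h)\<^sup>2)"
    proof (intro mult_left_mono min.mono C)
      show "2 / freq n \<le> 1 / 2 ^ n" by (simp add: freq_def power_add field_simps)
      have "2 * pi * freq n * h \<le> 2 * 4 * freq n * h"
        using pi_less_4 by (intro mult_right_mono) (auto simp: h_def)
      also have "\<dots> = 2 ^ n * (8 * sqrt h)\<^sup>2" by (simp add: freq_def power_add power_mult_distrib h_def)
      finally show "2 * pi * freq n * h \<le> 2 ^ n * (8 * sqrt h)\<^sup>2" .
    qed
    finally show ?thesis .
  qed
  have "pulse_sum p x t - pulse_sum p x s = (\<Sum>n<M. (p n t - p n s) *\<^sub>R x n)"
    using N[of M] N'[of M] by (simp add: M_def scaleR_diff_left sum_subtractf)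
  then have "norm (pulse_sum p x t - pulse_sum p x s) \<le> (\<Sum>n<M. C * min (1 / 2 ^ n) (2 ^ n * (8 * sqrt h)\<^sup>2))"
    by (simp only:) (intro sum_norm_le incr)
  also have "\<dots> = C * (\<Sum>n<M. min (1 / 2 ^ n) (2 ^ n * (8 * sqrt h)\<^sup>2))" by (rule sum_distrib_left[symmetric])
  also have "\<dots> \<le> C * (4 * (8 * sqrt h))"
  proof (intro mult_left_mono C)
    have "0 \<le> 8 * sqrt h" by (simp add: h_def)
    moreover have "(if r \<le> 1 then 4 * r - 2 * r\<^sup>2 else 2) \<le> 4 * r" for r :: real by auto
    ultimately show "(\<Sum>n<M. min (1 / 2 ^ n) (2 ^ n * (8 * sqrt h)\<^sup>2)) \<le> 4 * (8 * sqrt h)"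
      using dyadic_min_sum[of "8 * sqrt h" M] order_trans by blast
  qed
  finally show ?thesis by (simp add: h_def mult.assoc mult.left_commute)
qed

lemma pulse_sum_bound:
  fixes x :: "nat \<Rightarrow> 'a::real_normed_vector"
  assumes p: "pulse_family p" and x: "\<And>n. norm (x n) \<le> C / freq n"
  shows "norm (pulse_sum p x t) \<le> 32 * C"
proof -
  have C: "0 \<le> C" using order_trans[OF norm_ge_zero x[of 0]] by (simp add: freq_def zero_le_divide_iff)
  show ?thesis
  proof (cases "t \<le> 1/2 \<or> 1 \<le> t")
    case True
    then show ?thesis using C pulse_sum_zero[OF p, of t x] by simp
  next
    case False
    have "norm (pulse_sum p x t - pulse_sum p x 0) \<le> 32 * C * sqrt \<bar>t - 0\<bar>" by (rule pulse_sum_Hoelder[OF p x])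
    also have "\<dots> \<le> 32 * C * 1" using False C by (intro mult_left_mono) auto
    finally show ?thesis using pulse_sum_zero[OF p, of 0 x] by simp
  qed
qed

lemma pulse_sum_continuous:
  fixes x :: "nat \<Rightarrow> 'a::real_normed_vector"
  assumes p: "pulse_family p" and x: "\<And>n. norm (x n) \<le> C / freq n"
  shows "continuous_on S (pulse_sum p x)"
  unfolding continuous_on_def
proof
  fix t
  have "((\<lambda>s. 32 * C * sqrt \<bar>t - s\<bar>) \<longlongrightarrow> 32 * C * sqrt \<bar>t - t\<bar>) (at t within S)"
    by (intro tendsto_intros)
  then have "((\<lambda>s. 32 * C * sqrt \<bar>t - s\<bar>) \<longlongrightarrow> 0) (at t within S)" by simp
  then have "((\<lambda>s. pulse_sum p x s - pulse_sum p x t) \<longlongrightarrow> 0) (at t within S)"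
    by (rule Lim_null_comparison[rotated])
       (use pulse_sum_Hoelder[OF p x] in \<open>auto simp: norm_minus_commute abs_minus_commute intro!: always_eventually\<close>)
  then show "(pulse_sum p x \<longlongrightarrow> pulse_sum p x t) (at t within S)" by (simp add: LIM_zero_cancel)
qed

text \<open>
  At the onset of the pulse both \<open>1 - cos\<close> and its derivative vanish, so it joins the zero function smoothly.
\<close>

lemma cos_pulse_deriv:
  assumes t: "t \<in> {0..1}"
  shows "(cos_pulse n has_real_derivative 2 * pi * (freq n)\<^sup>2 * sin_pulse n t) (at t within {0..1})"
proof -
  define \<theta> where "\<theta> = 2 * pi * (freq n)\<^sup>2"
  define \<sigma> where "\<sigma> = 1 - active_len n"
  define \<gamma> where "\<gamma> s = 1 - cos (\<theta> * s)" for s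
  have \<sigma>: "\<sigma> \<le> 1" "0 \<le> \<sigma>" using active_len_bounds(3,4)[of n] zero_le_power2[of "freq n"]
    unfolding \<sigma>_def by (auto intro: order_trans[rotated])
  have eq: "cos_pulse n s = \<gamma> s" "sin_pulse n s = sin (\<theta> * s)" if "\<sigma> \<le> s" "s \<le> 1" for s
    using that by (simp_all add: cos_pulse_def sin_pulse_def \<gamma>_def phase_def \<theta>_def \<sigma>_def)
  have z: "cos_pulse n s = 0" "sin_pulse n s = 0" if "s \<le> \<sigma>" for s
    using pulse_zero[of s n] that by (auto simp: \<sigma>_def)
  have d: "(\<gamma> has_real_derivative \<theta> * sin (\<theta> * s)) (at s within S)" for s S
    unfolding \<gamma>_def by (auto intro!: derivative_eq_intros)
  consider "t < \<sigma>" | "t = \<sigma>" | "\<sigma> < t" by linarith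
  then show ?thesis
  proof cases
    case 1
    have "((\<lambda>s. 0) has_real_derivative \<theta> * sin_pulse n t) (at t within {0..1})" using z[of t] 1 by simp
    then show ?thesis unfolding \<theta>_def[symmetric]
      by (rule has_field_derivative_transform_within[where d = "\<sigma> - t"]) (use 1 t z in \<open>auto simp: dist_real_def\<close>)
  next
    case 3
    have "(\<gamma> has_real_derivative \<theta> * sin_pulse n t) (at t within {0..1})" using d[of t] eq[of t] 3 t by simp
    then show ?thesis unfolding \<theta>_def[symmetric]
      by (rule has_field_derivative_transform_within[where d = "t - \<sigma>"]) (use 3 t eq in \<open>auto simp: dist_real_def\<close>)
  next
    case 2
    have s0: "sin_pulse n t = 0" "cos_pulse n t = 0" "\<gamma> t = 0" "sin (\<theta> * t) = 0"
      using z[of t] eq[of t] 2 \<sigma> by auto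
    have "(\<gamma> has_real_derivative 0) (at t within {0..1})" using d[of t "{0..1}"] s0 by simp
    then have "((\<lambda>y. (\<gamma> y - \<gamma> t) / (y - t)) \<longlongrightarrow> 0) (at t within {0..1})"
      by (simp add: has_field_derivative_iff)
    then have "((\<lambda>y. \<bar>(\<gamma> y - \<gamma> t) / (y - t)\<bar>) \<longlongrightarrow> 0) (at t within {0..1})"
      by (rule tendsto_rabs_zero)
    then have "((\<lambda>y. (cos_pulse n y - cos_pulse n t) / (y - t)) \<longlongrightarrow> 0) (at t within {0..1})"
    proof (rule Lim_null_comparison[rotated])
      show "\<forall>\<^sub>F y :: real in at t within {0..1}. norm ((cos_pulse n y - cos_pulse n t) / (y - t)) \<le> \<bar>(\<gamma> y - \<gamma> t) / (y - t)\<bar>"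
        unfolding eventually_at_filter
      proof (intro always_eventually allI impI)
        fix y :: real assume y: "y \<in> {0..1}"
        show "norm ((cos_pulse n y - cos_pulse n t) / (y - t)) \<le> \<bar>(\<gamma> y - \<gamma> t) / (y - t)\<bar>"
          using eq(1)[of y] z(1)[of y] s0 y by (cases "\<sigma> \<le> y") auto
      qed
    qed
    then show ?thesis by (simp add: has_field_derivative_iff s0)
  qed
qed

text \<open>
  Termwise differentiation is justified by the Weierstrass test, since \<open>\<Sum> 1 / freq n\<close> converges.
\<close>

lemma pulse_sum_deriv:
  fixes x :: "nat \<Rightarrow> 'a::banach"
  assumes x: "\<And>n. norm (x n) \<le> C / freq n" and t: "t \<in> {0..1}"
  shows "(pulse_sum cos_pulse (\<lambda>n. (1 / (2 * pi * (freq n)\<^sup>2)) *\<^sub>R x n) has_vector_derivative pulse_sum sin_pulse x t)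
    (at t within {0..1})"
proof -
  let ?f = "\<lambda>n t. cos_pulse n t *\<^sub>R ((1 / (2 * pi * (freq n)\<^sup>2)) *\<^sub>R x n)"
  let ?g = "\<lambda>n t. sin_pulse n t *\<^sub>R x n"
  have d: "(?f n has_vector_derivative ?g n t) (at t within {0..1})" if "t \<in> {0..1}" for n t
  proof -
    have "(?f n has_vector_derivative (cos_pulse n t *\<^sub>R 0 + (2 * pi * (freq n)\<^sup>2 * sin_pulse n t) *\<^sub>R ((1 / (2 * pi * (freq n)\<^sup>2)) *\<^sub>R x n))) (at t within {0..1})"
      by (intro has_vector_derivative_scaleR cos_pulse_deriv[OF that] has_vector_derivative_const)
    then show ?thesis by simp
  qed
  have "summable (\<lambda>n. C / freq n)"
  proof -
    have "summable (\<lambda>n. (C / 8) * (1 / 2) ^ n)" by (intro summable_mult summable_geometric) simp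
    then show ?thesis by (simp add: freq_def power_add power_one_over mult.commute)
  qed
  then have "uniform_limit {0..1} (\<lambda>n t. \<Sum>i<n. ?g i t) (\<lambda>t. suminf (\<lambda>i. ?g i t)) sequentially"
  proof (rule Weierstrass_m_test[rotated])
    fix n t
    have "norm (?g n t) \<le> 1 * norm (x n)" unfolding norm_scaleR sin_pulse_def by (intro mult_right_mono) auto
    then show "norm (?g n t) \<le> C / freq n" using x[of n] by simp
  qed
  then have U: "uniform_limit {0..1} (\<lambda>n t. \<Sum>i<n. ?g i t) (pulse_sum sin_pulse x) sequentially"
    by (simp add: pulse_sum_def[abs_def])
  have "\<exists>G. \<forall>s\<in>{0..1}. (\<lambda>n. ?f n s) sums G s \<and> (G has_derivative (\<lambda>h. h *\<^sub>R pulse_sum sin_pulse x s)) (at s within {0..1})"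
  proof (rule has_derivative_series)
    show "((\<lambda>s. ?f n s) has_derivative (\<lambda>h. h *\<^sub>R ?g n s)) (at s within {0..1})" if "s \<in> {0..1}" for n s
      using d[OF that] by (simp add: has_vector_derivative_def)
    show "(\<lambda>n. ?f n 0) sums 0" using pulse_zero(2)[of 0] active_len_bounds(3) by (simp add: order_trans[of _ "1/2::real"])
    fix e :: real assume "e > 0"
    then have "\<forall>\<^sub>F n in sequentially. \<forall>t\<in>{0..1}. dist (\<Sum>i<n. ?g i t) (pulse_sum sin_pulse x t) < e"
      using U by (auto simp: uniform_limit_iff)
    then show "\<forall>\<^sub>F n in sequentially. \<forall>s\<in>{0..1}. \<forall>h. norm ((\<Sum>i<n. h *\<^sub>R ?g i s) - h *\<^sub>R pulse_sum sin_pulse x s) \<le> e * norm h"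
    proof eventually_elim
      case (elim n)
      show ?case
      proof (intro ballI allI)
        fix s h :: real assume "s \<in> {0..1}"
        then have "norm ((\<Sum>i<n. ?g i s) - pulse_sum sin_pulse x s) \<le> e" using elim by (auto simp: dist_norm less_imp_le)
        then have "\<bar>h\<bar> * norm ((\<Sum>i<n. ?g i s) - pulse_sum sin_pulse x s) \<le> \<bar>h\<bar> * e" by (intro mult_left_mono) auto
        then show "norm ((\<Sum>i<n. h *\<^sub>R ?g i s) - h *\<^sub>R pulse_sum sin_pulse x s) \<le> e * norm h"
          by (simp only: scaleR_sum_right[symmetric] scaleR_diff_right[symmetric] norm_scaleR real_norm_def mult.commute)
      qed
    qed
  qed auto
  then obtain G where G: "\<And>s. s \<in> {0..1} \<Longrightarrow> (\<lambda>n. ?f n s) sums G s"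
    "\<And>s. s \<in> {0..1} \<Longrightarrow> (G has_vector_derivative pulse_sum sin_pulse x s) (at s within {0..1})"
    unfolding has_vector_derivative_def by blast
  have "pulse_sum cos_pulse (\<lambda>n. (1 / (2 * pi * (freq n)\<^sup>2)) *\<^sub>R x n) s = G s" if "s \<in> {0..1}" for s
    using sums_unique[OF G(1)[OF that]] by (simp add: pulse_sum_def)
  then show ?thesis
    using has_vector_derivative_transform[OF t _ G(2)[OF t]] by blast
qed

lemma integral_sin_pulse_sq:
  "integrable (lebesgue_on {0<..<1}) (\<lambda>t. (sin_pulse n t)\<^sup>2)"
  "(\<integral>t. (sin_pulse n t)\<^sup>2 \<partial>lebesgue_on {0<..<1}) = active_len n / 2"
proof -
  define \<theta> where "\<theta> = 2 * pi * (freq n)\<^sup>2"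
  define \<sigma> where "\<sigma> = 1 - active_len n"
  have \<theta>: "0 < \<theta>" by (simp add: \<theta>_def)
  have \<sigma>: "\<sigma> \<le> 1" "0 \<le> \<sigma>" using active_len_bounds(3,4)[of n] zero_le_power2[of "freq n"]
    unfolding \<sigma>_def by (auto intro: order_trans[rotated])
  interpret finite_measure "lebesgue_on {0<..<1::real}" by (rule finite_measure_lebesgue_on) simp
  have sm: "sin_pulse n \<in> borel_measurable (lebesgue_on {0<..<1})"
    by (rule continuous_measurable_on[OF continuous_pulse[OF pulse_family_sin]])
  show i: "integrable (lebesgue_on {0<..<1}) (\<lambda>t. (sin_pulse n t)\<^sup>2)"
  proof (rule integrable_const_bound[where B = 1])
    show "AE t in lebesgue_on {0<..<1}. norm ((sin_pulse n t)\<^sup>2) \<le> 1"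
      by (simp add: sin_pulse_def abs_square_le_1)
  qed (use sm in measurable)
  define F where "F t = max \<sigma> t / 2 - sin (2 * (\<theta> * max \<sigma> t)) / (4 * \<theta>)" for t
  have "(\<integral>t. (sin_pulse n t)\<^sup>2 \<partial>lebesgue_on {0<..<1}) = F 1 - F 0"
  proof (rule integral_lebesgue_on_FTC[where K = "{\<sigma>}"])
    show "continuous_on {0..1} F" unfolding F_def using \<theta> by (intro continuous_intros) auto
    fix t assume t: "t \<in> {0<..<1} - {\<sigma>}"
    show "(F has_vector_derivative (sin_pulse n t)\<^sup>2) (at t)"
      unfolding has_real_derivative_iff_has_vector_derivative[symmetric]
    proof (cases "t < \<sigma>")
      case True
      have "((\<lambda>t. F \<sigma>) has_real_derivative (sin_pulse n t)\<^sup>2) (at t)"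
        using pulse_zero(1)[of t n] True by (simp add: \<sigma>_def)
      then show "(F has_real_derivative (sin_pulse n t)\<^sup>2) (at t)"
        by (rule has_field_derivative_transform_within_open[where S = "{..<\<sigma>}"]) (use True in \<open>auto simp: F_def\<close>)
    next
      case False
      have "((\<lambda>t. t / 2 - sin (2 * (\<theta> * t)) / (4 * \<theta>)) has_real_derivative 1/2 - cos (2 * (\<theta> * t)) / 2) (at t)"
        using \<theta> by (auto intro!: derivative_eq_intros)
      also have "1/2 - cos (2 * (\<theta> * t)) / 2 = (sin_pulse n t)\<^sup>2"
      proof -
        have "sin_pulse n t = sin (\<theta> * t)" using False t by (simp add: sin_pulse_def phase_def \<theta>_def \<sigma>_def)
        then show ?thesis using cos_double_sin[of "\<theta> * t"] by (simp add: field_simps)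
      qed
      finally show "(F has_real_derivative (sin_pulse n t)\<^sup>2) (at t)"
        by (rule has_field_derivative_transform_within_open[where S = "{\<sigma><..}"]) (use False t in \<open>auto simp: F_def\<close>)
    qed
  qed (use i in auto)
  moreover have "sin (\<theta> * \<sigma>) = 0" "sin (\<theta> * 1) = 0"
    using pulse_zero(1)[of \<sigma> n] pulse_zero(1)[of 1 n] \<sigma> by (simp_all add: sin_pulse_def phase_def \<theta>_def \<sigma>_def)
  then have "sin (2 * (\<theta> * \<sigma>)) = 0" "sin (2 * (\<theta> * 1)) = 0" by (simp_all only: sin_double mult_zero_left mult_zero_right)
  then have "F 1 - F 0 = active_len n / 2" using \<sigma> by (simp add: F_def \<sigma>_def diff_divide_distrib)
  ultimately show "(\<integral>t. (sin_pulse n t)\<^sup>2 \<partial>lebesgue_on {0<..<1}) = active_len n / 2" by simp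
qed

text \<open>
  Only pulses with \<open>n + 4 < 2 / (1 - t)\<close> are active at time \<open>t\<close>.
\<close>

lemma sum_sin_pulse_sq:
  assumes t: "t < 1"
  shows "(\<Sum>n<M. (sin_pulse n t)\<^sup>2) \<le> 2 / (1 - t)"
proof -
  define A where "A = {n\<in>{..<M}. real (n + 4) < 2 / (1 - t)}"
  have "(\<Sum>n<M. (sin_pulse n t)\<^sup>2) = (\<Sum>n\<in>A. (sin_pulse n t)\<^sup>2)"
  proof (rule sum.mono_neutral_right)
    show "\<forall>n\<in>{..<M} - A. (sin_pulse n t)\<^sup>2 = 0"
    proof
      fix n assume "n \<in> {..<M} - A"
      then have "2 / (1 - t) \<le> real (n + 4)" by (auto simp: A_def)
      then have "2 / real (n + 4) \<le> 1 - t" using t by (simp add: field_simps)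
      then show "(sin_pulse n t)\<^sup>2 = 0" using pulse_zero(1)[of t n] active_len_bounds(2)[of n] by simp
    qed
  qed (auto simp: A_def)
  also have "\<dots> \<le> (\<Sum>n\<in>A. 1)" by (intro sum_mono) (auto simp: sin_pulse_def abs_square_le_1)
  also have "\<dots> \<le> 2 / (1 - t)"
  proof (cases "A = {}")
    case False
    have fin: "finite A" by (simp add: A_def)
    have "A \<subseteq> {..Max A}" using fin by auto
    then have "card A \<le> Suc (Max A)" using card_mono[of "{..Max A}" A] by simp
    moreover have "real (Max A + 4) < 2 / (1 - t)" using Max_in[OF fin False] by (simp add: A_def)
    ultimately show ?thesis by simp
  qed (use t in simp)
  finally show ?thesis .
qed

section \<open>Oscillations in space\<close>

text \<open>
  The factors in \<open>x\<close> of the solution, of its slope and of its flux.  At the cut-off \<open>\<pi>/4\<close> the first and the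
  last are continuous and \<open>osc_cos\<close> jumps; the coefficient jumps with it, and the flux does not.
\<close>

definition osc_sin :: "nat \<Rightarrow> real \<Rightarrow> real" where
  "osc_sin n x = (if x < pi / 4 then sin (freq n * x) else 0)"

definition osc_cos :: "nat \<Rightarrow> real \<Rightarrow> real" where
  "osc_cos n x = (if x < pi / 4 then cos (freq n * x) else 0)"

definition osc_pot :: "nat \<Rightarrow> real \<Rightarrow> real" where
  "osc_pot n x = (if x < pi / 4 then (1 - cos (freq n * x)) / freq n else 0)"

lemma freq_quarter_pi: "sin (freq n * (pi / 4)) = 0" "cos (freq n * (pi / 4)) = 1"
proof -
  have "freq n * (pi / 4) = real (2 ^ n) * (2 * pi)" by (simp add: freq_def power_add)
  then show "sin (freq n * (pi / 4)) = 0" "cos (freq n * (pi / 4)) = 1"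
    using sin_2npi[of "2 ^ n"] cos_2npi[of "2 ^ n"] by (simp_all add: mult_ac)
qed

lemma osc_bounds:
  "\<bar>osc_sin n x\<bar> \<le> 1" "\<bar>osc_cos n x\<bar> \<le> 1" "\<bar>osc_pot n x\<bar> \<le> 2 / freq n"
proof -
  show "\<bar>osc_sin n x\<bar> \<le> 1" "\<bar>osc_cos n x\<bar> \<le> 1" by (auto simp: osc_sin_def osc_cos_def)
  have "\<bar>1 - cos (freq n * x)\<bar> \<le> 2" using abs_cos_le_one[of "freq n * x"] by linarith
  then have "\<bar>1 - cos (freq n * x)\<bar> / freq n \<le> 2 / freq n" by (intro divide_right_mono) auto
  then show "\<bar>osc_pot n x\<bar> \<le> 2 / freq n" by (simp add: osc_pot_def)
qed

lemma osc_borel [measurable]: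
  "osc_sin n \<in> borel_measurable borel" "osc_cos n \<in> borel_measurable borel" "osc_pot n \<in> borel_measurable borel"
  unfolding osc_sin_def[abs_def] osc_cos_def[abs_def] osc_pot_def[abs_def] by measurable

lemma borel_imp_Om_measurable:
  "f \<in> borel_measurable borel \<Longrightarrow> f \<in> borel_measurable Om"
  by (intro measurable_restrict_space1 measurable_completion) simp

lemma square_integrable_real:
  assumes f: "f \<in> borel_measurable borel" and B: "\<And>x. \<bar>f x\<bar> \<le> B"
  shows "square_integrable (\<lambda>x. of_real (f x))"
  by (rule square_integrable_bounded[where B = B])
     (use f B in \<open>auto intro!: borel_imp_Om_measurable borel_measurable_of_real\<close>)

lemma osc_square_integrable:
  "square_integrable (\<lambda>x. of_real (c * osc_sin n x))"
  "square_integrable (\<lambda>x. of_real (c * osc_cos n x))"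
  "square_integrable (\<lambda>x. of_real (osc_sin n x))"
  "square_integrable (\<lambda>x. of_real (osc_cos n x))"
  "square_integrable (\<lambda>x. of_real (osc_pot n x))"
proof -
  show "square_integrable (\<lambda>x. of_real (c * osc_sin n x))"
    "square_integrable (\<lambda>x. of_real (c * osc_cos n x))" for c
    by (rule square_integrable_real[where B = "\<bar>c\<bar>"]; simp add: abs_mult mult_left_le osc_bounds)+
  from this[of 1] show "square_integrable (\<lambda>x. of_real (osc_sin n x))"
    "square_integrable (\<lambda>x. of_real (osc_cos n x))" by simp_all
  show "square_integrable (\<lambda>x. of_real (osc_pot n x))"
    by (rule square_integrable_real[where B = "2 / freq n"]) (simp_all add: osc_bounds)
qed

lemma continuous_osc: "continuous_on UNIV (osc_sin n)" "continuous_on UNIV (osc_pot n)"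
proof -
  have U: "(UNIV :: real set) = {..pi/4} \<union> {pi/4..}" by auto
  have s: "osc_sin n = (\<lambda>x. if x \<le> pi/4 then sin (freq n * x) else 0)"
  proof
    fix x show "osc_sin n x = (if x \<le> pi/4 then sin (freq n * x) else 0)"
      by (cases "x = pi/4")
         (simp only: osc_sin_def freq_quarter_pi less_irrefl order_refl if_True if_False, simp add: osc_sin_def less_le)
  qed
  have p: "osc_pot n = (\<lambda>x. if x \<le> pi/4 then (1 - cos (freq n * x)) / freq n else 0)"
  proof
    fix x show "osc_pot n x = (if x \<le> pi/4 then (1 - cos (freq n * x)) / freq n else 0)"
      by (cases "x = pi/4")
         (simp only: osc_pot_def freq_quarter_pi less_irrefl order_refl if_True if_False diff_self div_0, simp add: osc_pot_def less_le)
  qed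
  have z: "sin (freq n * x) = 0" "cos (freq n * x) = 1" if "x * 4 = pi" for x
  proof -
    have "x = pi / 4" using that by simp
    then show "sin (freq n * x) = 0" "cos (freq n * x) = 1" by (simp_all only: freq_quarter_pi)
  qed
  show "continuous_on UNIV (osc_sin n)" unfolding s U
    by (rule continuous_on_If) (auto intro!: continuous_intros simp: z)
  show "continuous_on UNIV (osc_pot n)" unfolding p U
    by (rule continuous_on_If) (auto intro!: continuous_intros simp: z)
qed

lemma osc_deriv:
  assumes "x \<noteq> pi / 4"
  shows "(osc_sin n has_real_derivative freq n * osc_cos n x) (at x)"
    "(osc_pot n has_real_derivative osc_sin n x) (at x)"
proof -
  consider "x < pi/4" | "pi/4 < x" using assms by linarith
  then have "(osc_sin n has_real_derivative freq n * osc_cos n x) (at x) \<and>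
    (osc_pot n has_real_derivative osc_sin n x) (at x)"
  proof cases
    case 1
    have "((\<lambda>x. sin (freq n * x)) has_real_derivative freq n * osc_cos n x) (at x)"
      "((\<lambda>x. (1 - cos (freq n * x)) / freq n) has_real_derivative osc_sin n x) (at x)"
      using 1 by (auto intro!: derivative_eq_intros simp: osc_cos_def osc_sin_def)
    then show ?thesis
      by (intro conjI; elim has_field_derivative_transform_within_open[where S = "{..<pi/4}"])
         (use 1 in \<open>auto simp: osc_sin_def osc_pot_def\<close>)
  next
    case 2
    have "((\<lambda>x. 0) has_real_derivative freq n * osc_cos n x) (at x)"
      "((\<lambda>x. 0) has_real_derivative osc_sin n x) (at x)"
      using 2 by (auto simp: osc_cos_def osc_sin_def)
    then show ?thesis
      by (intro conjI; elim has_field_derivative_transform_within_open[where S = "{pi/4<..}"])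
         (use 2 in \<open>auto simp: osc_sin_def osc_pot_def\<close>)
  qed
  then show "(osc_sin n has_real_derivative freq n * osc_cos n x) (at x)"
    "(osc_pot n has_real_derivative osc_sin n x) (at x)" by blast+
qed

definition osc_mode :: "nat \<Rightarrow> H10" where
  "osc_mode n = Abs_H10 (L2_of (\<lambda>x. of_real (osc_sin n x)))"

lemma osc_mode:
  "Rep_H10 (osc_mode n) = L2_of (\<lambda>x. of_real (osc_sin n x))"
  "Dx (osc_mode n) = freq n *\<^sub>R L2_of (\<lambda>x. of_real (osc_cos n x))"
proof -
  have c: "continuous_on {0..pi} (\<lambda>x. complex_of_real (osc_sin n x))"
    by (intro continuous_intros continuous_on_subset[OF continuous_osc(1)]) auto
  have d: "((\<lambda>x. complex_of_real (osc_sin n x)) has_vector_derivative complex_of_real (freq n * osc_cos n x)) (at x)"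
    if "x \<in> {0<..<pi} - {pi/4}" for x
    by (rule has_vector_derivative_of_real[OF osc_deriv(1)]) (use that in auto)
  note * = H10_piecewise[OF c osc_square_integrable(3) osc_square_integrable(2), where K = "{pi/4}", OF _ d]
  have "L2_of (\<lambda>x. of_real (osc_sin n x)) \<in> H10_set"
    by (rule *(1)) (simp_all add: osc_sin_def)
  moreover have "wdx (L2_of (\<lambda>x. of_real (osc_sin n x))) = L2_of (\<lambda>x. of_real (freq n * osc_cos n x))"
    by (rule *(2)) (simp_all add: osc_sin_def)
  ultimately show "Rep_H10 (osc_mode n) = L2_of (\<lambda>x. of_real (osc_sin n x))"
    "Dx (osc_mode n) = freq n *\<^sub>R L2_of (\<lambda>x. of_real (osc_cos n x))"
    using L2_of_ops(3)[OF osc_square_integrable(4) osc_square_integrable(4), of "freq n" n]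
    by (simp_all add: osc_mode_def Dx.rep_eq Abs_H10_inverse scaleR_conv_of_real)
qed

text \<open>
  In \<open>V'\<close> the modes gain a factor \<open>1 / freq n\<close>, because \<open>osc_pot\<close> is a small primitive that vanishes at
  the cut-off.
\<close>

lemma L2_to_Hm1_osc_mode:
  "L2_to_Hm1 (Rep_H10 (osc_mode n)) = - neg_div (L2_of (\<lambda>x. of_real (osc_pot n x)))"
  unfolding osc_mode
proof (rule L2_to_Hm1_weak_dx, rule has_weak_dx_piecewise)
  show "continuous_on {0..pi} (\<lambda>x. complex_of_real (osc_pot n x))"
    by (intro continuous_intros continuous_on_subset[OF continuous_osc(2)]) auto
  show "((\<lambda>x. complex_of_real (osc_pot n x)) has_vector_derivative complex_of_real (osc_sin n x)) (at x)"
    if "x \<in> {0<..<pi} - {pi/4}" for x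
    by (rule has_vector_derivative_of_real[OF osc_deriv(2)]) (use that in auto)
qed (auto intro: osc_square_integrable)

lemma norm_L2_of_le:
  assumes f: "f \<in> borel_measurable borel" and B: "\<And>x. \<bar>f x\<bar> \<le> B"
  shows "norm (L2_of (\<lambda>x. of_real (f x))) \<le> 2 * B"
proof -
  interpret finite_measure Om by (rule finite_measure_Om)
  note s = square_integrable_real[OF f B]
  have B0: "0 \<le> B" using B[of 0] by linarith
  have "(f x)\<^sup>2 \<le> B\<^sup>2" for x using power_mono[OF B[of x], of 2] by simp
  then have "(\<integral>x. (cmod (complex_of_real (f x)))\<^sup>2 \<partial>Om) \<le> (\<integral>x. B\<^sup>2 \<partial>Om)"
    using s by (intro integral_mono) (auto simp: square_integrable_def)
  also have "\<dots> = pi * B\<^sup>2" using measure_Om by simp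
  also have "\<dots> \<le> 4 * B\<^sup>2" using pi_less_4 by (intro mult_right_mono) auto
  also have "\<dots> = (2 * B)\<^sup>2" by (simp add: power_mult_distrib)
  finally show ?thesis unfolding L2_of_ops(7)[OF s s] using B0 by (intro real_le_lsqrt) auto
qed

lemma osc_mode_norms:
  "norm (osc_mode n) \<le> 2 * freq n" "norm (L2_to_Hm1 (Rep_H10 (osc_mode n))) \<le> 4 / freq n"
proof -
  have "norm (L2_of (\<lambda>x. of_real (osc_cos n x))) \<le> 2 * 1"
    by (rule norm_L2_of_le) (auto intro: osc_bounds)
  then show "norm (osc_mode n) \<le> 2 * freq n" by (simp add: norm_H10_def osc_mode)
  have le: "norm (neg_div g) \<le> norm g" for g
    using cinner_L2_bound[of g] by (intro norm_Hm1_le) (auto simp: dual_pair_neg_div norm_H10_def)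
  have "norm (L2_of (\<lambda>x. of_real (osc_pot n x))) \<le> 2 * (2 / freq n)"
    by (rule norm_L2_of_le) (auto intro: osc_bounds)
  from order_trans[OF le this] show "norm (L2_to_Hm1 (Rep_H10 (osc_mode n))) \<le> 4 / freq n"
    unfolding L2_to_Hm1_osc_mode norm_minus_cancel by simp
qed

text \<open>
  The modes are orthogonal because sums and differences of frequencies are again multiples of \<open>8\<close>.
\<close>

lemma inner_osc_mode:
  "Rep_H10 (osc_mode m) \<bullet> Rep_H10 (osc_mode n) = (if m = n then pi / 8 else 0)"
proof -
  let ?q = "\<lambda>x. complex_of_real (osc_sin m x) \<bullet> complex_of_real (osc_sin n x)"
  define F where "F x = (if m = n then x / 2 - sin (2 * freq n * x) / (4 * freq n)
      else sin ((freq m - freq n) * x) / (2 * (freq m - freq n)) - sin ((freq m + freq n) * x) / (2 * (freq m + freq n)))" for x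
  have d: "(F has_real_derivative sin (freq m * x) * sin (freq n * x)) (at x)" for x
  proof (cases "m = n")
    case True
    have "(F has_real_derivative 1 / 2 - cos (2 * freq n * x) / 2) (at x)"
      unfolding F_def using True by (auto intro!: derivative_eq_intros)
    then show ?thesis using True cos_double_sin[of "freq n * x"] by (simp add: power2_eq_square mult.assoc diff_divide_distrib)
  next
    case False
    then have ne: "freq m - freq n \<noteq> 0" "freq m + freq n \<noteq> 0"
      using add_pos_pos[OF freq_pos(1) freq_pos(1), of m n] by (auto simp: freq_def)
    have 1: "((\<lambda>x. sin (c * x) / (2 * c)) has_real_derivative cos (c * x) / 2) (at x)" if "c \<noteq> 0" for c
      using that by (auto intro!: derivative_eq_intros)
    have "(F has_real_derivative cos ((freq m - freq n) * x) / 2 - cos ((freq m + freq n) * x) / 2) (at x)"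
      unfolding F_def using False DERIV_diff[OF 1[OF ne(1)] 1[OF ne(2)]] by simp
    then show ?thesis by (simp add: sin_times_sin left_diff_distrib distrib_right diff_divide_distrib)
  qed
  have cF: "continuous_on UNIV F"
    using d by (meson DERIV_isCont continuous_at_imp_continuous_on)
  have c: "continuous_on {0..pi} (\<lambda>x. F (min x (pi/4)))"
    by (rule continuous_on_compose2[OF cF]) (auto intro!: continuous_intros)
  have dq: "((\<lambda>x. F (min x (pi/4))) has_vector_derivative ?q x) (at x)" if x: "x \<in> {0<..<pi} - {pi/4}" for x
    unfolding has_real_derivative_iff_has_vector_derivative[symmetric]
  proof (cases "x < pi/4")
    case True
    have "(F has_real_derivative ?q x) (at x)"
      using d[of x] True by (simp add: osc_sin_def inner_complex_def)
    then show "((\<lambda>x. F (min x (pi/4))) has_real_derivative ?q x) (at x)"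
      by (rule has_field_derivative_transform_within_open[where S = "{..<pi/4}"]) (use True in auto)
  next
    case False
    have "((\<lambda>x. F (pi/4)) has_real_derivative ?q x) (at x)"
      using False by (simp add: osc_sin_def inner_complex_def)
    then show "((\<lambda>x. F (min x (pi/4))) has_real_derivative ?q x) (at x)"
      by (rule has_field_derivative_transform_within_open[where S = "{pi/4<..}"]) (use False x in auto)
  qed
  have "(\<integral>x. ?q x \<partial>Om) = F (min pi (pi/4)) - F (min 0 (pi/4))"
    by (rule integral_lebesgue_on_FTC[where K = "{pi/4}", OF _ c _ dq]) (auto intro!: square_integrable_prod osc_square_integrable)
  also have "F (min 0 (pi/4)) = 0" by (simp add: F_def)
  also have "F (min pi (pi/4)) = (if m = n then pi / 8 else 0)"
  proof -
    have "sin (2 * freq n * (pi/4)) = 0"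
      using sin_double[of "freq n * (pi/4)"] freq_quarter_pi(1)[of n] by (simp add: mult.assoc)
    moreover have "sin ((freq m - freq n) * (pi/4)) = 0" "sin ((freq m + freq n) * (pi/4)) = 0"
      using freq_quarter_pi[of n] freq_quarter_pi[of m] by (simp_all only: left_diff_distrib distrib_right sin_diff sin_add)
    ultimately show ?thesis by (simp add: F_def min_def)
  qed
  finally show ?thesis
    unfolding osc_mode L2_of_ops(6)[OF osc_square_integrable(3) osc_square_integrable(3)] by simp
qed

text \<open>The time derivative of the oscillating part of the solution in \<open>H\<close>, up to the small factor.\<close>

definition rough_rate :: "real \<Rightarrow> L2" where
  "rough_rate = pulse_sum sin_pulse (\<lambda>n. Rep_H10 (osc_mode n))"

text \<open>
  All large \<open>M\<close> give the same sum, since only finitely many pulses are active at time \<open>t\<close>.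
\<close>

lemma norm_rough_rate:
  "\<exists>N. \<forall>M\<ge>N. (norm (rough_rate t))\<^sup>2 = pi / 8 * (\<Sum>n<M. (sin_pulse n t)\<^sup>2)"
proof -
  obtain N where N: "\<And>M. M \<ge> N \<Longrightarrow> rough_rate t = (\<Sum>n<M. sin_pulse n t *\<^sub>R Rep_H10 (osc_mode n))"
    using pulse_sum_eventually_eq[OF pulse_family_sin] unfolding rough_rate_def by blast
  have "(norm (rough_rate t))\<^sup>2 = pi / 8 * (\<Sum>n<M. (sin_pulse n t)\<^sup>2)" if "M \<ge> N" for M
  proof -
    have "(norm (rough_rate t))\<^sup>2 = (\<Sum>n<M. \<Sum>m<M. sin_pulse n t * (sin_pulse m t * (if m = n then pi / 8 else 0)))"
      unfolding power2_norm_eq_inner N[OF that] inner_sum_left inner_sum_right by (simp add: inner_osc_mode)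
    also have "\<dots> = (\<Sum>n<M. pi / 8 * (sin_pulse n t)\<^sup>2)"
      by (intro sum.cong refl) (simp add: power2_eq_square if_distrib cong: if_cong)
    finally show ?thesis by (simp add: sum_distrib_left)
  qed
  then show ?thesis by blast
qed

lemma norm_rough_rate_le:
  assumes t: "t < 1"
  shows "norm (rough_rate t) \<le> (1 - t) powr (- 1 / 2)"
proof -
  obtain N where N: "(norm (rough_rate t))\<^sup>2 = pi / 8 * (\<Sum>n<N. (sin_pulse n t)\<^sup>2)"
    using norm_rough_rate[of t] by blast
  also have "\<dots> \<le> 1 / 2 * (2 / (1 - t))"
    using sum_sin_pulse_sq[OF t, of N] pi_less_4 by (intro mult_mono sum_nonneg) auto
  also have "\<dots> = ((1 - t) powr (- 1 / 2))\<^sup>2"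
    using t by (simp add: power2_eq_square powr_minus divide_simps flip: powr_add)
  finally show ?thesis by (rule power2_le_imp_le) simp
qed

lemma norm_rough_rate_ge: "pi / 8 * (\<Sum>n<M. (sin_pulse n t)\<^sup>2) \<le> (norm (rough_rate t))\<^sup>2"
proof -
  obtain N where N: "\<And>K. K \<ge> N \<Longrightarrow> (norm (rough_rate t))\<^sup>2 = pi / 8 * (\<Sum>n<K. (sin_pulse n t)\<^sup>2)"
    using norm_rough_rate[of t] by blast
  have "(\<Sum>n<M. (sin_pulse n t)\<^sup>2) \<le> (\<Sum>n<max M N. (sin_pulse n t)\<^sup>2)"
    by (rule sum_mono2) auto
  then show ?thesis using N[of "max M N"] by simp
qed

lemma rough_rate_measurable: "rough_rate \<in> borel_measurable I01"
  unfolding rough_rate_def by (rule pulse_sum_measurable[OF pulse_family_sin])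

text \<open>
  The bound \<open>(1 - t)\<^sup>-\<^sup>1\<^sup>/\<^sup>2\<close> is integrable up to the final time.
\<close>

lemma bochner_L1_rough_rate: "bochner_Lp 1 rough_rate"
  unfolding bochner_Lp_def
proof
  have "(\<lambda>x. x powr (- 1 / 2)) integrable_on {0..(1::real)}"
    by (rule integrable_on_powr_from_0) auto
  then obtain I where "((\<lambda>x. x powr (- 1 / 2)) has_integral I) (cbox 0 (1::real))"
    by (auto simp: integrable_on_def)
  from has_integral_affinity[OF this, of "-1" 1]
  have "(\<lambda>x. (1 - x) powr (- 1 / 2)) integrable_on {0..(1::real)}"
    by (auto simp: integrable_on_def image_affinity_atLeastAtMost)
  then have "(\<lambda>x. (1 - x) powr (- 1 / 2)) absolutely_integrable_on {0..(1::real)}"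
    by (intro nonnegative_absolutely_integrable_1) auto
  then have "(\<lambda>x. (1 - x) powr (- 1 / 2)) absolutely_integrable_on {0<..<(1::real)}"
    by (rule set_integrable_subset) auto
  then have "integrable I01 (\<lambda>x. (1 - x) powr (- 1 / 2))"
    by (simp add: integrable_restrict_space set_integrable_def)
  then show "integrable I01 (\<lambda>t. norm (rough_rate t) ^ 1)"
    by (rule Bochner_Integration.integrable_bound)
       (use norm_rough_rate_le rough_rate_measurable in \<open>auto intro!: AE_I2\<close>)
qed (rule rough_rate_measurable)

text \<open>
  Integrating the squared norm pulse by pulse dominates a multiple of the harmonic series.
\<close>

lemma not_bochner_L2_rough_rate: "\<not> integrable I01 (\<lambda>t. (norm (rough_rate t))\<^sup>2)"
proof
  assume i: "integrable I01 (\<lambda>t. (norm (rough_rate t))\<^sup>2)"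
  define C where "C = (\<integral>t. (norm (rough_rate t))\<^sup>2 \<partial>I01)"
  have le: "(\<Sum>n<M. 1 / real (n + 4)) \<le> 16 / pi * C" for M
  proof -
    have "(\<Sum>n<M. 1 / real (n + 4)) \<le> (\<Sum>n<M. active_len n)" by (intro sum_mono active_len_bounds)
    also have "\<dots> = 16 / pi * (\<integral>t. pi / 8 * (\<Sum>n<M. (sin_pulse n t)\<^sup>2) \<partial>I01)"
      by (simp add: integral_sin_pulse_sq sum_divide_distrib[symmetric])
    also have "\<dots> \<le> 16 / pi * C" unfolding C_def
      using integral_sin_pulse_sq(1)
      by (intro mult_left_mono integral_mono i norm_rough_rate_ge) auto
    finally show ?thesis .
  qed
  have "summable (\<lambda>n. 1 / real (n + 4))"
    by (rule summableI_nonneg_bounded[OF _ le]) simp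
  then have "summable (\<lambda>n. inverse (real n))" using summable_iff_shift[of "\<lambda>n. inverse (real n)" 4] by (simp add: inverse_eq_divide)
  then show False using not_summable_harmonic[where 'a = real] by simp
qed

section \<open>The coefficient\<close>

text \<open>
  The time derivative and the second space derivative of the potential, up to the small factor \<open>e\<close>.
\<close>

definition flux_osc :: "real \<Rightarrow> real \<Rightarrow> real" where
  "flux_osc t x = pulse_sum sin_pulse (\<lambda>n. osc_pot n x) t"

definition slope_osc :: "real \<Rightarrow> real \<Rightarrow> real" where
  "slope_osc t x = pulse_sum cos_pulse (\<lambda>n. osc_cos n x / (2 * pi * freq n)) t"

text \<open>
  Flux divided by slope, minus one.  The maximum with \<open>1/2\<close> keeps the denominator away from zero for small
  \<open>t\<close>, where the numerator vanishes; for \<open>t \<ge> 1/2\<close> the denominator is the slope of the solution.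
\<close>

definition coef_pert :: "real \<Rightarrow> real \<Rightarrow> real \<Rightarrow> real" where
  "coef_pert e t x = e * (flux_osc t x - slope_osc t x) / (max t (1 / 2) * cos x + e * slope_osc t x)"

lemma slope_term_bound: "norm (osc_cos n x / (2 * pi * freq n)) \<le> 1 / freq n"
proof -
  have "norm (osc_cos n x / (2 * pi * freq n)) = \<bar>osc_cos n x\<bar> / (2 * pi) / freq n"
    by (simp add: abs_mult)
  also have "\<dots> \<le> 1 / freq n"
  proof (rule divide_right_mono)
    have "\<bar>osc_cos n x\<bar> \<le> 1" "1 \<le> 2 * pi" using osc_bounds(2)[of n x] pi_ge_two by auto
    then show "\<bar>osc_cos n x\<bar> / (2 * pi) \<le> 1" by (simp add: divide_le_eq)
  qed simp
  finally show ?thesis .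
qed

lemma osc_Hoelder:
  "\<bar>flux_osc t x - flux_osc s x\<bar> \<le> 64 * sqrt \<bar>t - s\<bar>" "\<bar>slope_osc t x - slope_osc s x\<bar> \<le> 32 * sqrt \<bar>t - s\<bar>"
  "\<bar>flux_osc t x\<bar> \<le> 64" "\<bar>slope_osc t x\<bar> \<le> 32"
proof -
  have b: "norm (osc_pot n x) \<le> 2 / freq n" for n using osc_bounds(3)[of n x] by simp
  show "\<bar>flux_osc t x - flux_osc s x\<bar> \<le> 64 * sqrt \<bar>t - s\<bar>"
    using pulse_sum_Hoelder[OF pulse_family_sin b, where t = t and s = s] by (simp add: flux_osc_def)
  show "\<bar>slope_osc t x - slope_osc s x\<bar> \<le> 32 * sqrt \<bar>t - s\<bar>"
    using pulse_sum_Hoelder[OF pulse_family_cos slope_term_bound, where t = t and s = s]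
    by (simp add: slope_osc_def)
  show "\<bar>flux_osc t x\<bar> \<le> 64"
    using pulse_sum_bound[OF pulse_family_sin b, where t = t] by (simp add: flux_osc_def)
  show "\<bar>slope_osc t x\<bar> \<le> 32"
    using pulse_sum_bound[OF pulse_family_cos slope_term_bound, where t = t]
    by (simp add: slope_osc_def)
qed

lemma osc_zero:
  "t \<le> 1 / 2 \<or> 1 \<le> t \<Longrightarrow> flux_osc t x = 0" "t \<le> 1 / 2 \<or> 1 \<le> t \<Longrightarrow> slope_osc t x = 0"
  "pi / 4 \<le> x \<Longrightarrow> flux_osc t x = 0" "pi / 4 \<le> x \<Longrightarrow> slope_osc t x = 0"
  by (simp_all add: flux_osc_def slope_osc_def pulse_sum_zero[OF pulse_family_sin] pulse_sum_zero[OF pulse_family_cos])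
     (simp_all add: pulse_sum_def osc_pot_def osc_cos_def)

lemma coef_pert_zero:
  assumes "t \<le> 1 / 2 \<or> 1 \<le> t \<or> pi / 4 \<le> x"
  shows "coef_pert e t x = 0"
proof -
  have "flux_osc t x = 0" "slope_osc t x = 0" using assms osc_zero by blast+
  then show ?thesis by (simp add: coef_pert_def)
qed

lemma slope_lower_bound:
  assumes e: "0 \<le> e" "e \<le> 1 / 2048" and x: "0 < x" "x < pi / 4"
  shows "1 / 8 \<le> max t (1 / 2) * cos x + e * slope_osc t x"
proof -
  have "cos (pi / 3) \<le> cos x" using x by (intro cos_monotone_0_pi_le) auto
  then have "1 / 2 * (1 / 2) \<le> max t (1 / 2) * cos x" by (intro mult_mono) (auto simp: cos_60)
  moreover have "\<bar>e * slope_osc t x\<bar> \<le> 1 / 2048 * 32"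
    unfolding abs_mult using e osc_Hoelder(4)[of t x] by (intro mult_mono) auto
  ultimately show ?thesis by linarith
qed

lemma coef_pert_bound:
  assumes e: "0 \<le> e" "e \<le> 1 / 2048" and x: "0 < x"
  shows "\<bar>coef_pert e t x\<bar> \<le> 768 * e"
proof (cases "x < pi / 4")
  case True
  define D where "D = max t (1 / 2) * cos x + e * slope_osc t x"
  define G where "G = flux_osc t x - slope_osc t x"
  have D: "1 / 8 \<le> D" unfolding D_def by (rule slope_lower_bound[OF e x True])
  have "\<bar>G\<bar> \<le> 96" unfolding G_def using osc_Hoelder(3,4)[of t x] by linarith
  then have "e * \<bar>G\<bar> \<le> e * 96" using e(1) by (rule mult_left_mono)
  then have "e * \<bar>G\<bar> / D \<le> (e * 96) / (1 / 8)" using D e by (intro frac_le) auto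
  moreover have "\<bar>coef_pert e t x\<bar> = e * \<bar>G\<bar> / D"
    unfolding coef_pert_def D_def[symmetric] G_def[symmetric] using D e by (simp add: abs_mult abs_divide)
  ultimately show ?thesis by simp
next
  case False
  then show ?thesis using e by (simp add: coef_pert_zero)
qed

lemma coef_pert_Hoelder:
  assumes e: "0 \<le> e" "e \<le> 1 / 2048" and x: "0 < x" and ts: "t \<in> {0..1}" "s \<in> {0..1}"
  shows "\<bar>coef_pert e t x - coef_pert e s x\<bar> \<le> 13056 * e * sqrt \<bar>t - s\<bar>"
proof (cases "x < pi / 4")
  case True
  define D where "D t = max t (1 / 2) * cos x + e * slope_osc t x" for t :: real
  define G where "G t = flux_osc t x - slope_osc t x" for t :: real
  let ?r = "sqrt \<bar>t - s\<bar>"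
  have D: "1 / 8 \<le> D t" "1 / 8 \<le> D s" unfolding D_def by (intro slope_lower_bound[OF e x True])+
  have G: "\<bar>G s\<bar> \<le> 96" unfolding G_def using osc_Hoelder(3,4)[of s x] by linarith
  have dG: "\<bar>G t - G s\<bar> \<le> 96 * ?r" unfolding G_def using osc_Hoelder(1,2)[of t x s] by linarith
  have "\<bar>t - s\<bar> \<le> 1" using ts by auto
  then have "?r * ?r \<le> ?r * 1" by (intro mult_left_mono) auto
  then have r: "\<bar>t - s\<bar> \<le> ?r" by simp
  have dD: "\<bar>D s - D t\<bar> \<le> 2 * ?r"
  proof -
    have "\<bar>(max s (1 / 2) - max t (1 / 2)) * cos x\<bar> \<le> \<bar>t - s\<bar> * 1"
      unfolding abs_mult by (intro mult_mono) auto
    moreover have "\<bar>e * (slope_osc s x - slope_osc t x)\<bar> \<le> 1 / 2048 * (32 * ?r)"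
      unfolding abs_mult using e osc_Hoelder(2)[of s x t] by (intro mult_mono) (auto simp: abs_minus_commute)
    moreover have "D s - D t = (max s (1 / 2) - max t (1 / 2)) * cos x + e * (slope_osc s x - slope_osc t x)"
      by (simp add: D_def algebra_simps)
    then have "\<bar>D s - D t\<bar> \<le> \<bar>(max s (1 / 2) - max t (1 / 2)) * cos x\<bar> + \<bar>e * (slope_osc s x - slope_osc t x)\<bar>"
      by (simp only: abs_triangle_ineq)
    moreover have "0 \<le> ?r" by simp
    ultimately show ?thesis using r by linarith
  qed
  have 1: "\<bar>(G t - G s) / D t\<bar> \<le> 96 * ?r / (1 / 8)"
    unfolding abs_divide using D dG by (intro frac_le) auto
  have "\<bar>G s * (D s - D t) / (D t * D s)\<bar> \<le> 96 * (2 * ?r) / (1 / 8 * (1 / 8))"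
    unfolding abs_divide abs_mult using D G dD by (intro frac_le mult_mono) auto
  then have 2: "\<bar>G s * (D s - D t) / (D t * D s)\<bar> \<le> 12288 * ?r" by simp
  have "coef_pert e t x - coef_pert e s x = e * ((G t - G s) / D t + G s * (D s - D t) / (D t * D s))"
    unfolding coef_pert_def D_def[symmetric] G_def[symmetric] using D by (simp add: field_simps)
  then have "\<bar>coef_pert e t x - coef_pert e s x\<bar> = e * \<bar>(G t - G s) / D t + G s * (D s - D t) / (D t * D s)\<bar>"
    using e by (simp add: abs_mult)
  also have "\<dots> \<le> e * (13056 * ?r)"
    using order_trans[OF abs_triangle_ineq add_mono[OF 1 2]] e by (intro mult_left_mono) auto
  finally show ?thesis by simp
next
  case False
  then show ?thesis using e by (simp add: coef_pert_zero)
qed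

lemma osc_borel_measurable:
  "(\<lambda>p. flux_osc (fst p) (snd p)) \<in> borel_measurable borel" "(\<lambda>p. slope_osc (fst p) (snd p)) \<in> borel_measurable borel"
proof -
  have m [measurable]: "sin_pulse n \<in> borel_measurable borel" "cos_pulse n \<in> borel_measurable borel" for n
    by (intro borel_measurable_continuous_onI continuous_pulse pulse_family_sin pulse_family_cos)+
  have fs [measurable]: "fst \<in> borel_measurable (borel :: (real \<times> real) measure)" "snd \<in> borel_measurable (borel :: (real \<times> real) measure)"
    by (auto intro!: borel_measurable_continuous_onI continuous_intros)
  show "(\<lambda>p. flux_osc (fst p) (snd p)) \<in> borel_measurable borel"
  proof (rule borel_measurable_LIMSEQ_metric)
    show "(\<lambda>p. \<Sum>n<M. sin_pulse n (fst p) *\<^sub>R osc_pot n (snd p)) \<in> borel_measurable borel" for M by measurable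
  qed (auto simp: flux_osc_def simp del: real_scaleR_def intro!: pulse_sum_tendsto[OF pulse_family_sin])
  show "(\<lambda>p. slope_osc (fst p) (snd p)) \<in> borel_measurable borel"
  proof (rule borel_measurable_LIMSEQ_metric)
    show "(\<lambda>p. \<Sum>n<M. cos_pulse n (fst p) *\<^sub>R (osc_cos n (snd p) / (2 * pi * freq n))) \<in> borel_measurable borel" for M by measurable
  qed (auto simp: slope_osc_def simp del: real_scaleR_def intro!: pulse_sum_tendsto[OF pulse_family_cos])
qed

lemma coef_pert_measurable:
  "(\<lambda>p. coef_pert e (fst p) (snd p)) \<in> borel_measurable borel" "coef_pert e t \<in> borel_measurable borel"
proof -
  have fs [measurable]: "fst \<in> borel_measurable (borel :: (real \<times> real) measure)" "snd \<in> borel_measurable (borel :: (real \<times> real) measure)"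
    by (auto intro!: borel_measurable_continuous_onI continuous_intros)
  note [measurable] = osc_borel_measurable
  show 1: "(\<lambda>p. coef_pert e (fst p) (snd p)) \<in> borel_measurable borel"
    unfolding coef_pert_def by measurable
  have "(\<lambda>x. (t, x)) \<in> borel_measurable (borel :: real measure)"
    by (auto intro!: borel_measurable_continuous_onI continuous_intros)
  from measurable_compose[OF this 1] show "coef_pert e t \<in> borel_measurable borel" by simp
qed

lemma Linf_norm_le:
  assumes f: "f \<in> borel_measurable borel" and B: "\<And>x. 0 < x \<Longrightarrow> \<bar>f x\<bar> \<le> B"
  shows "ess_bounded f" "norm (Linf_of f) \<le> B"
proof -
  have B0: "0 \<le> B" using B[of 1] by linarith
  have AE: "AE x in Om. \<bar>f x\<bar> \<le> B" using B by (intro AE_I2) auto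
  note m = borel_imp_Om_measurable[OF f]
  show eb: "ess_bounded f" by (rule ess_boundedI[OF m AE])
  have "esssup Om (\<lambda>x. ereal \<bar>f x\<bar>) \<le> ereal B" by (rule esssup_Om_le[OF m AE])
  then show "norm (Linf_of f) \<le> B"
    unfolding norm_Linf_of[OF eb] using B0 esssup_Om_nonneg[of f]
    by (cases "esssup Om (\<lambda>x. ereal \<bar>f x\<bar>)") auto
qed

lemma holder_norm_le:
  fixes g :: "real \<Rightarrow> 'a::real_normed_vector"
  assumes A: "\<And>t. t \<in> {0..1} \<Longrightarrow> norm (g t) \<le> A"
    and B: "\<And>s t. s \<in> {0..1} \<Longrightarrow> t \<in> {0..1} \<Longrightarrow> norm (g t - g s) \<le> B * \<bar>t - s\<bar> powr \<alpha>"
  shows "holder_norm 1 \<alpha> g \<le> ereal (A + B)"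
  unfolding holder_norm_def plus_ereal.simps(1)[symmetric]
proof (intro add_mono SUP_least)
  show "ereal (norm (g t)) \<le> ereal A" if "t \<in> {0..1}" for t using A[OF that] by simp
  fix p assume "p \<in> {(s, t). s \<in> {0..1::real} \<and> t \<in> {0..1} \<and> s \<noteq> t}"
  then obtain s t where p: "p = (s, t)" "s \<in> {0..1}" "t \<in> {0..1}" "s \<noteq> t" by auto
  then have "norm (g t - g s) / \<bar>t - s\<bar> powr \<alpha> \<le> B"
    using B[OF p(2,3)] by (simp add: divide_le_eq)
  then show "(case p of (s, t) \<Rightarrow> ereal (norm (g t - g s) / \<bar>t - s\<bar> powr \<alpha>)) \<le> ereal B" using p(1) by simp
qed

lemma holder_norm_finiteD:
  fixes g :: "real \<Rightarrow> 'a::real_normed_vector"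
  assumes "holder_norm 1 \<alpha> g < \<infinity>"
  shows "\<exists>C. \<forall>s\<in>{0..1}. \<forall>t\<in>{0..1}. norm (g t - g s) \<le> C * \<bar>t - s\<bar> powr \<alpha>"
proof -
  define S where "S = (SUP (s, t)\<in>{(s, t). s \<in> {0..1::real} \<and> t \<in> {0..1} \<and> s \<noteq> t}.
    ereal (norm (g t - g s) / \<bar>t - s\<bar> powr \<alpha>))"
  define U where "U = (SUP t\<in>{0..1::real}. ereal (norm (g t)))"
  have "0 \<le> U" unfolding U_def by (rule SUP_upper2[of 0]) auto
  moreover have "U + S < \<infinity>" using assms by (simp add: holder_norm_def U_def S_def)
  ultimately have "S \<noteq> \<infinity>" by auto
  then obtain C where C: "S \<le> ereal C" by (cases S) auto
  have "norm (g t - g s) \<le> C * \<bar>t - s\<bar> powr \<alpha>" if "s \<in> {0..1}" "t \<in> {0..1}" for s t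
  proof (cases "s = t")
    case False
    have "ereal (norm (g t - g s) / \<bar>t - s\<bar> powr \<alpha>) \<le> S"
      unfolding S_def by (rule SUP_upper2[of "(s, t)"]) (use that False in auto)
    then have "ereal (norm (g t - g s) / \<bar>t - s\<bar> powr \<alpha>) \<le> ereal C" using C by (rule order_trans)
    then show ?thesis using False by (simp add: divide_le_eq)
  qed simp
  then show ?thesis by blast
qed

lemma coef_elliptic:
  assumes e: "0 \<le> e" "e \<le> 1 / 2048"
  shows "elliptic_coefficient (\<lambda>t x. 1 + coef_pert e t x)"
  unfolding elliptic_coefficient_def
proof (intro conjI exI)
  have "(\<lambda>p. 1 + coef_pert e (fst p) (snd p)) \<in> borel_measurable borel"
    using coef_pert_measurable(1)[of e] by measurable
  then show "(\<lambda>(t, x). 1 + coef_pert e t x) \<in> borel_measurable (lebesgue_on ({0..1} \<times> {0<..<pi}))"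
    by (intro measurable_restrict_space1 measurable_completion) (simp add: case_prod_beta)
  show "AE (t, x) in lebesgue_on ({0..1::real} \<times> {0<..<pi}). 1 / 2 \<le> 1 + coef_pert e t x \<and> 1 + coef_pert e t x \<le> 3 / 2"
  proof (rule AE_I2)
    fix p assume "p \<in> space (lebesgue_on ({0..1::real} \<times> {0<..<pi::real}))"
    then obtain t x where p: "p = (t, x)" "0 < x" by (auto simp: space_restrict_space)
    have "\<bar>coef_pert e t x\<bar> \<le> 768 * e" by (rule coef_pert_bound[OF e p(2)])
    then show "case p of (t, x) \<Rightarrow> 1 / 2 \<le> 1 + coef_pert e t x \<and> 1 + coef_pert e t x \<le> 3 / 2"
      using e p(1) by auto
  qed
qed auto

lemma coef_ess_bounded:
  assumes e: "0 \<le> e" "e \<le> 1 / 2048"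
  shows "ess_bounded (\<lambda>x. coef_pert e t x)" "ess_bounded (\<lambda>x. 1 + coef_pert e t x)"
proof -
  show "ess_bounded (\<lambda>x. coef_pert e t x)"
    by (rule Linf_norm_le(1)[OF coef_pert_measurable(2) coef_pert_bound[OF e]])
  then show "ess_bounded (\<lambda>x. 1 + coef_pert e t x)"
    by (rule ess_bounded_ops(1)[OF ess_bounded_const])
qed

lemma coef_holder_norm:
  assumes e: "0 \<le> e" "e \<le> 1 / 2048"
  shows "holder_norm 1 (1 / 2) (\<lambda>t. Linf_of (\<lambda>x. (1 + coef_pert e t x) - 1)) \<le> ereal (13824 * e)"
    "holder_coefficient (1 / 2) (\<lambda>t x. 1 + coef_pert e t x)"
proof -
  note eb = coef_ess_bounded[OF e]
  have d: "norm (Linf_of (coef_pert e t) - Linf_of (coef_pert e s)) \<le> 13056 * e * \<bar>t - s\<bar> powr (1 / 2)"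
    if "s \<in> {0..1}" "t \<in> {0..1}" for s t :: real
    unfolding Linf_of_diff[OF eb(1) eb(1)] powr_half_sqrt[OF abs_ge_zero]
    using coef_pert_measurable(2)[of e] coef_pert_Hoelder[OF e _ that(2,1)]
    by (intro Linf_norm_le(2)) measurable
  have "holder_norm 1 (1 / 2) (\<lambda>t. Linf_of (coef_pert e t)) \<le> ereal (768 * e + 13056 * e)"
    by (rule holder_norm_le[OF Linf_norm_le(2)[OF coef_pert_measurable(2) coef_pert_bound[OF e]] d])
  then show "holder_norm 1 (1 / 2) (\<lambda>t. Linf_of (\<lambda>x. (1 + coef_pert e t x) - 1)) \<le> ereal (13824 * e)"
    by simp
  have one: "Linf_of (\<lambda>x. 1 + coef_pert e t x) - Linf_of (\<lambda>x. 1 + coef_pert e s x) = Linf_of (coef_pert e t) - Linf_of (coef_pert e s)" for s t :: real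
    unfolding Linf_of_diff[OF eb(1) eb(1)] Linf_of_diff[OF eb(2) eb(2)] by simp
  have m: "(\<lambda>x. 1 + coef_pert e t x) \<in> borel_measurable borel" for t :: real
    using coef_pert_measurable(2)[of e t] by measurable
  have "\<bar>1 + coef_pert e t x\<bar> \<le> 2" if "0 < x" for t x
    using coef_pert_bound[OF e that, of t] e by linarith
  then have "norm (Linf_of (\<lambda>x. 1 + coef_pert e t x)) \<le> 2" for t :: real
    by (rule Linf_norm_le(2)[OF m])
  then have "holder_norm 1 (1 / 2) (\<lambda>t. Linf_of (\<lambda>x. 1 + coef_pert e t x)) \<le> ereal (2 + 13056 * e)"
    by (rule holder_norm_le) (use d in \<open>simp only: one\<close>)
  then show "holder_coefficient (1 / 2) (\<lambda>t x. 1 + coef_pert e t x)"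
    unfolding holder_coefficient_def using eb(2) by (auto intro: le_less_trans)
qed

lemma pulse_sum_continuous_arg:
  fixes f :: "nat \<Rightarrow> 'b::topological_space \<Rightarrow> 'a::real_normed_vector"
  assumes p: "pulse_family p" and f: "\<And>n. continuous_on S (f n)"
  shows "continuous_on S (\<lambda>x. pulse_sum p (\<lambda>n. f n x) t)"
proof -
  obtain N where N: "\<And>n. n \<ge> N \<Longrightarrow> p n t = 0" using pulse_eventually_zero[OF p] by blast
  have "pulse_sum p (\<lambda>n. f n x) t = (\<Sum>n<N. p n t *\<^sub>R f n x)" for x
    unfolding pulse_sum_def by (rule suminf_finite) (use N in auto)
  then show ?thesis by (simp only:) (intro continuous_intros f)
qed

text \<open>
  Half a period before the final time, the oscillation of the given frequency is at its peak, at
  \<open>x = 0\<close> the lower frequencies add to it, and the higher ones vanish.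
\<close>

lemma slope_osc_peak:
  defines "t \<equiv> \<lambda>n. 1 - 1 / (2 * (freq n)\<^sup>2)"
  shows "1 / (pi * freq n) \<le> slope_osc (t n) 0"
proof -
  have "phase n (t n) = 2 * pi * (freq n)\<^sup>2 * t n"
  proof -
    have "1 / (2 * (freq n)\<^sup>2) \<le> 1 / (freq n)\<^sup>2" by (intro divide_left_mono) auto
    then have "1 - active_len n \<le> t n" "t n \<le> 1" using active_len_bounds(4)[of n] by (auto simp: t_def)
    then show ?thesis by (simp add: phase_def)
  qed
  also have "\<dots> = 2 * pi * of_int (4 ^ (n + 3)) - pi"
  proof -
    have "(freq n)\<^sup>2 = of_int (4 ^ (n + 3))" by (simp add: freq_def power2_eq_square flip: power_mult_distrib)
    moreover have "2 * pi * (freq n)\<^sup>2 * t n = 2 * pi * (freq n)\<^sup>2 - pi" by (simp add: t_def field_simps)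
    ultimately show ?thesis by simp
  qed
  finally have "cos (phase n (t n)) = - cos (2 * pi * of_int (4 ^ (n + 3)))" by (simp only: cos_diff cos_pi sin_pi)
  then have c: "cos_pulse n (t n) = 2" unfolding cos_int_2pin by (simp add: cos_pulse_def)
  have o: "osc_cos m 0 = 1" for m by (simp add: osc_cos_def)
  have pos: "0 \<le> cos_pulse m s * (osc_cos m 0 / (2 * pi * freq m))" for m s
    unfolding o by (intro mult_nonneg_nonneg divide_nonneg_nonneg) (auto simp: cos_pulse_def)
  obtain N where N: "\<And>M. M \<ge> N \<Longrightarrow> slope_osc (t n) 0 = (\<Sum>m<M. cos_pulse m (t n) *\<^sub>R (osc_cos m 0 / (2 * pi * freq m)))"
    using pulse_sum_eventually_eq[OF pulse_family_cos, of "\<lambda>m. osc_cos m 0 / (2 * pi * freq m)" "t n"]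
    unfolding slope_osc_def by blast
  have "1 / (pi * freq n) = cos_pulse n (t n) * (osc_cos n 0 / (2 * pi * freq n))"
    unfolding c o by simp
  also have "\<dots> \<le> (\<Sum>m<max N (Suc n). cos_pulse m (t n) * (osc_cos m 0 / (2 * pi * freq m)))"
    by (rule member_le_sum) (rule pos | simp)+
  also have "\<dots> = slope_osc (t n) 0"
    using N[OF max.cobounded1[of N "Suc n"]] by (simp only: real_scaleR_def)
  finally show ?thesis .
qed

text \<open>
  The perturbation vanishes at \<open>t = 1\<close> and is at least of order \<open>1 / freq n\<close> at the distance \<open>1 / (2 (freq n)\<^sup>2)\<close>
  from there.  A bound in \<open>L\<^sup>\<infinity>\<close> holds for almost every \<open>x\<close> only; continuity in \<open>x\<close> carries it over to \<open>x = 0\<close>.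
\<close>

lemma coef_not_holder:
  assumes e: "0 < e" "e \<le> 1 / 2048" and \<alpha>: "1 / 2 < \<alpha>"
  shows "\<not> holder_coefficient \<alpha> (\<lambda>t x. 1 + coef_pert e t x)"
proof
  assume h: "holder_coefficient \<alpha> (\<lambda>t x. 1 + coef_pert e t x)"
  have e': "0 \<le> e" using e by simp
  note eb = coef_ess_bounded[OF e' e(2)]
  define g where "g t = Linf_of (\<lambda>x. 1 + coef_pert e t x)" for t :: real
  have "holder_norm 1 \<alpha> g < \<infinity>" using h unfolding holder_coefficient_def g_def[abs_def] by blast
  then obtain C where C: "\<And>s t. s \<in> {0..1} \<Longrightarrow> t \<in> {0..1} \<Longrightarrow> norm (g t - g s) \<le> C * \<bar>t - s\<bar> powr \<alpha>"
    using holder_norm_finiteD by blast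
  have le: "norm (g t - g 1) \<le> C * (1 - t) powr \<alpha>" if t: "t \<in> {0..<1}" for t :: real
    using C[of 1 t] t by simp
  define t where "t n = 1 - 1 / (2 * (freq n)\<^sup>2)" for n
  have t: "t n \<in> {1/2..<1}" for n
  proof -
    have "1 / (2 * (freq n)\<^sup>2) \<le> 1 / (2 * 1)" using freq_sq_ge(2)[of n] by (intro divide_left_mono) auto
    then show ?thesis by (simp add: t_def)
  qed
  have bound: "e / (pi * freq n) \<le> 2 * (C * (1 - t n) powr \<alpha>)" for n
  proof -
    define \<beta> where "\<beta> = C * (1 - t n) powr \<alpha>"
    have nb: "norm (Linf_of (\<lambda>x. coef_pert e (t n) x)) \<le> \<beta>"
      using le[of "t n"] t[of n] coef_pert_zero[of 1 _ e]
      unfolding \<beta>_def g_def Linf_of_diff[OF eb(2) eb(2)] by simp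
    have AE: "AE x in Om. \<bar>coef_pert e (t n) x\<bar> \<le> \<beta>"
      using ess_boundedE(2)[OF eb(1)[of "t n"]]
      by eventually_elim (use nb in \<open>simp add: norm_Linf_of[OF eb(1)]\<close>)
    \<comment> \<open>The excess over the bound: zero almost everywhere, hence everywhere by continuity.\<close>
    define q where "q x = max 0 (e * \<bar>flux_osc (t n) x - slope_osc (t n) x\<bar> - 2 * \<beta>)" for x
    have "q 0 = 0"
    proof (rule continuous_AE_zero_imp_zero[where f = q and a = 0 and b = "pi/8"])
      have "continuous_on {0..pi/8} (osc_cos m)" for m
      proof (rule continuous_on_eq[of _ "\<lambda>x. cos (freq m * x)"])
        fix x assume "x \<in> {0..pi/8}"
        then have "x < pi / 4" using pi_gt_zero unfolding atLeastAtMost_iff by linarith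
        then show "cos (freq m * x) = osc_cos m x" by (simp add: osc_cos_def)
      qed (intro continuous_intros)
      then have "continuous_on {0..pi/8} (slope_osc (t n))" unfolding slope_osc_def[abs_def]
        by (intro pulse_sum_continuous_arg pulse_family_cos continuous_intros) auto
      moreover have "continuous_on {0..pi/8} (flux_osc (t n))" unfolding flux_osc_def[abs_def]
        by (intro pulse_sum_continuous_arg pulse_family_sin continuous_on_subset[OF continuous_osc(2)]) auto
      ultimately show "continuous_on {0..pi/8} q" unfolding q_def[abs_def] by (intro continuous_intros)
      have "AE x in lebesgue. x \<in> {0<..<pi} \<longrightarrow> \<bar>coef_pert e (t n) x\<bar> \<le> \<beta>"
        using AE by (subst (asm) AE_restrict_space_iff) auto
      then have "AE x in lebesgue. x \<in> {0<..<pi/8} \<longrightarrow> q x = 0"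
      proof eventually_elim
        case (elim x)
        show ?case
        proof
          assume x: "x \<in> {0<..<pi/8}"
          let ?D = "max (t n) (1 / 2) * cos x + e * slope_osc (t n) x"
          have D: "1 / 8 \<le> ?D" using x by (intro slope_lower_bound[OF e' e(2)]) auto
          have "\<bar>e * slope_osc (t n) x\<bar> \<le> 1 * 32 * (1 / 2048)"
            unfolding abs_mult using mult_mono[OF e(2) osc_Hoelder(4)[of "t n" x]] e by auto
          moreover have "max (t n) (1 / 2) * cos x \<le> max (t n) (1 / 2) * 1" by (intro mult_left_mono) auto
          moreover have "max (t n) (1 / 2) \<le> 1" using t[of n] by simp
          ultimately have D2: "?D \<le> 2" by linarith
          have "\<bar>coef_pert e (t n) x\<bar> \<le> \<beta>" using elim x by auto
          then have "e * \<bar>flux_osc (t n) x - slope_osc (t n) x\<bar> \<le> \<beta> * ?D"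
            using D e by (simp add: coef_pert_def abs_mult abs_divide divide_le_eq)
          also have "\<dots> \<le> \<beta> * 2"
            using \<open>\<bar>coef_pert e (t n) x\<bar> \<le> \<beta>\<close> by (intro mult_left_mono D2) linarith
          finally show "q x = 0" by (simp add: q_def)
        qed
      qed
      then show "AE x in lebesgue_on {0<..<pi/8}. q x = 0" by (subst AE_restrict_space_iff) auto
    qed auto
    then have "e * \<bar>flux_osc (t n) 0 - slope_osc (t n) 0\<bar> \<le> 2 * \<beta>" by (simp add: q_def max_def split: if_splits)
    moreover have "flux_osc (t n) 0 = 0" by (simp add: flux_osc_def pulse_sum_def osc_pot_def)
    moreover have "1 / (pi * freq n) \<le> \<bar>slope_osc (t n) 0\<bar>"
      using slope_osc_peak[of n] unfolding t_def by linarith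
    then have "e * (1 / (pi * freq n)) \<le> e * \<bar>slope_osc (t n) 0\<bar>" using e' by (rule mult_left_mono)
    ultimately show ?thesis unfolding \<beta>_def by simp
  qed
  have "e / (2 * pi) \<le> \<bar>C\<bar> * freq n powr (1 - 2 * \<alpha>)" for n
  proof -
    have "(1 - t n) powr \<alpha> \<le> (1 / (freq n)\<^sup>2) powr \<alpha>"
      using \<alpha> unfolding t_def by (intro powr_mono2) (auto intro!: divide_left_mono)
    also have "\<dots> = freq n powr (- 2 * \<alpha>)"
      by (simp add: powr_divide powr_minus_divide powr_powr flip: powr_numeral)
    finally have "C * (1 - t n) powr \<alpha> \<le> \<bar>C\<bar> * freq n powr (- 2 * \<alpha>)"
      by (intro mult_mono) auto
    then have "e / (pi * freq n) \<le> 2 * (\<bar>C\<bar> * freq n powr (- 2 * \<alpha>))" using bound[of n] by linarith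
    then have "e / (2 * pi) \<le> \<bar>C\<bar> * (freq n powr (- 2 * \<alpha>) * freq n)" by (simp add: field_simps)
    also have "freq n powr (- 2 * \<alpha>) * freq n = freq n powr (1 - 2 * \<alpha>)"
      using powr_add[of "freq n" "- 2 * \<alpha>" 1] by simp
    finally show ?thesis .
  qed
  moreover have "(\<lambda>n. \<bar>C\<bar> * freq n powr (1 - 2 * \<alpha>)) \<longlonglongrightarrow> \<bar>C\<bar> * 0"
  proof (intro tendsto_mult tendsto_const tendsto_neg_powr)
    show "filterlim freq at_top sequentially"
    proof (rule filterlim_at_top_mono[OF filterlim_real_sequentially], intro always_eventually allI)
      fix n
      have "real n \<le> 2 ^ n" using of_nat_less_two_power[of n, where 'a = real] by simp
      also have "(2::real) ^ n \<le> freq n" unfolding freq_def by (rule power_increasing) auto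
      finally show "real n \<le> freq n" .
    qed
  qed (use \<alpha> in auto)
  ultimately have "e / (2 * pi) \<le> \<bar>C\<bar> * 0" by (intro LIMSEQ_le_const) auto
  moreover have "0 < e / (2 * pi)" using e(1) by simp
  ultimately show False by linarith
qed

section \<open>The solution\<close>

lemma L2_of_lincomb:
  fixes f g :: "real \<Rightarrow> real"
  assumes f: "square_integrable (\<lambda>x. of_real (f x))" and g: "square_integrable (\<lambda>x. of_real (g x))"
  shows "square_integrable (\<lambda>x. of_real (c * f x + d * g x))"
    "L2_of (\<lambda>x. of_real (c * f x + d * g x))
      = c *\<^sub>R L2_of (\<lambda>x. of_real (f x)) + d *\<^sub>R L2_of (\<lambda>x. of_real (g x))"
proof -
  note s = square_integrable_scaleR[OF f, of c] square_integrable_scaleR[OF g, of d]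
  have eq: "(\<lambda>x. complex_of_real (c * f x + d * g x)) = (\<lambda>x. c *\<^sub>R complex_of_real (f x) + d *\<^sub>R complex_of_real (g x))"
    by (simp add: scaleR_conv_of_real)
  show "square_integrable (\<lambda>x. of_real (c * f x + d * g x))"
    unfolding eq by (rule square_integrable_add[OF s])
  show "L2_of (\<lambda>x. of_real (c * f x + d * g x))
      = c *\<^sub>R L2_of (\<lambda>x. of_real (f x)) + d *\<^sub>R L2_of (\<lambda>x. of_real (g x))"
    unfolding eq L2_of_ops(3)[OF f f] L2_of_ops(3)[OF g g] L2_of_ops(1)[OF s] ..
qed

lemma pulse_sum_L2_of:
  fixes f :: "nat \<Rightarrow> real \<Rightarrow> real"
  assumes p: "pulse_family p" and f: "\<And>n. square_integrable (\<lambda>x. of_real (f n x))"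
  shows "square_integrable (\<lambda>x. of_real (pulse_sum p (\<lambda>n. f n x) t))"
    "pulse_sum p (\<lambda>n. L2_of (\<lambda>x. of_real (f n x))) t = L2_of (\<lambda>x. of_real (pulse_sum p (\<lambda>n. f n x) t))"
proof -
  obtain N where N: "\<And>n. n \<ge> N \<Longrightarrow> p n t = 0" using pulse_eventually_zero[OF p] by blast
  have ev: "pulse_sum p y t = (\<Sum>n<N. p n t *\<^sub>R y n)" for y :: "nat \<Rightarrow> 'b::real_normed_vector"
    unfolding pulse_sum_def by (rule suminf_finite) (use N in auto)
  have "square_integrable (\<lambda>x. of_real (\<Sum>n<M. p n t *\<^sub>R f n x)) \<and>
    (\<Sum>n<M. p n t *\<^sub>R L2_of (\<lambda>x. of_real (f n x))) = L2_of (\<lambda>x. of_real (\<Sum>n<M. p n t *\<^sub>R f n x))" for M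
  proof (induction M)
    case 0
    show ?case by (simp add: square_integrable_zero L2_of_zero)
  next
    case (Suc M)
    show ?case using L2_of_lincomb[OF Suc[THEN conjunct1] f[of M], of 1 "p M t"] Suc[THEN conjunct2] by simp
  qed
  then show "square_integrable (\<lambda>x. of_real (pulse_sum p (\<lambda>n. f n x) t))"
    "pulse_sum p (\<lambda>n. L2_of (\<lambda>x. of_real (f n x))) t = L2_of (\<lambda>x. of_real (pulse_sum p (\<lambda>n. f n x) t))"
    unfolding ev by blast+
qed

lemma real_valued_L2_of:
  assumes "square_integrable (\<lambda>x. of_real (f x))"
  shows "real_valued (L2_of (\<lambda>x. of_real (f x)))"
  unfolding real_valued_def using rep_L2_of[OF assms] by eventually_elim simp

definition ground_mode :: H10 where "ground_mode = sine_mode 1"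

lemma ground_mode:
  "Rep_H10 ground_mode = L2_of (\<lambda>x. of_real (sin x))" "Dx ground_mode = L2_of (\<lambda>x. of_real (cos x))"
  "square_integrable (\<lambda>x. of_real (sin x))" "square_integrable (\<lambda>x. of_real (cos x))"
  "neg_div (Dx ground_mode) = L2_to_Hm1 (Rep_H10 ground_mode)"
  using sine_mode[of 1] square_integrable_sin_cos[of 1 1] neg_div_Dx_sine_mode[of 1]
  unfolding ground_mode_def by simp_all

definition rough_sol :: "real \<Rightarrow> real \<Rightarrow> H10" where
  "rough_sol e t = t *\<^sub>R ground_mode
     + e *\<^sub>R pulse_sum cos_pulse (\<lambda>n. (1 / (2 * pi * (freq n)\<^sup>2)) *\<^sub>R osc_mode n) t"

text \<open>
  The time derivative of \<open>rough_sol\<close>, in \<open>V'\<close> everywhere and in \<open>H\<close> in the weak sense.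
\<close>

definition rough_sol_rate :: "real \<Rightarrow> real \<Rightarrow> L2" where
  "rough_sol_rate e t = Rep_H10 ground_mode + e *\<^sub>R rough_rate t"

lemma linear_maps: "linear Rep_H10" "linear L2_to_Hm1" "linear Dx" "linear neg_div" "linear (\<lambda>v. H10_to_Hm1 v)"
  using bounded_linear_Rep_H10 bounded_linear_L2_to_Hm1 bounded_linear_Dx bounded_linear_neg_div
    bounded_linear_compose[OF bounded_linear_L2_to_Hm1 bounded_linear_Rep_H10]
  by (simp_all add: bounded_linear.linear)

lemma rough_sol_continuous: "continuous_on S (rough_sol e)"
proof -
  have "norm ((1 / (2 * pi * (freq n)\<^sup>2)) *\<^sub>R osc_mode n) \<le> 1 / freq n" for n
  proof -
    have "norm ((1 / (2 * pi * (freq n)\<^sup>2)) *\<^sub>R osc_mode n) \<le> 1 / (2 * pi * (freq n)\<^sup>2) * (2 * freq n)"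
      unfolding norm_scaleR using osc_mode_norms(1)[of n] by (intro mult_mono) auto
    also have "\<dots> = (1 / pi) / freq n" by (simp add: power2_eq_square)
    also have "\<dots> \<le> 1 / freq n" using pi_ge_two by (intro divide_right_mono) auto
    finally show ?thesis .
  qed
  then show ?thesis unfolding rough_sol_def[abs_def]
    by (intro continuous_intros pulse_sum_continuous[OF pulse_family_cos, where C = 1])
qed

lemma rough_sol_rate_Hm1:
  "L2_to_Hm1 (rough_sol_rate e t) = H10_to_Hm1 ground_mode + e *\<^sub>R pulse_sum sin_pulse (\<lambda>n. H10_to_Hm1 (osc_mode n)) t"
  unfolding rough_sol_rate_def rough_rate_def
  by (simp add: linear_add[OF linear_maps(2)] linear_scale[OF linear_maps(2)]
      pulse_sum_linear[OF pulse_family_sin linear_maps(2)])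

lemma rough_sol_C1: "C1_with_deriv (\<lambda>t. H10_to_Hm1 (rough_sol e t)) (\<lambda>t. L2_to_Hm1 (rough_sol_rate e t))"
  unfolding C1_with_deriv_def
proof (intro conjI ballI)
  show "continuous_on {0..1} (\<lambda>t. L2_to_Hm1 (rough_sol_rate e t))"
    unfolding rough_sol_rate_Hm1
    by (intro continuous_intros pulse_sum_continuous[OF pulse_family_sin osc_mode_norms(2)])
  fix t :: real assume t: "t \<in> {0..1}"
  have eq: "(\<lambda>t. H10_to_Hm1 (rough_sol e t)) = (\<lambda>t. t *\<^sub>R H10_to_Hm1 ground_mode
      + e *\<^sub>R pulse_sum cos_pulse (\<lambda>n. (1 / (2 * pi * (freq n)\<^sup>2)) *\<^sub>R H10_to_Hm1 (osc_mode n)) t)"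
    unfolding rough_sol_def
    by (simp add: linear_add[OF linear_maps(5)] linear_scale[OF linear_maps(5)]
      pulse_sum_linear[OF pulse_family_cos linear_maps(5)])
  have "((\<lambda>t. t *\<^sub>R H10_to_Hm1 ground_mode
      + e *\<^sub>R pulse_sum cos_pulse (\<lambda>n. (1 / (2 * pi * (freq n)\<^sup>2)) *\<^sub>R H10_to_Hm1 (osc_mode n)) t)
    has_vector_derivative ((t *\<^sub>R 0 + 1 *\<^sub>R H10_to_Hm1 ground_mode) + e *\<^sub>R pulse_sum sin_pulse (\<lambda>n. H10_to_Hm1 (osc_mode n)) t))
    (at t within {0..1})"
    by (intro has_vector_derivative_add has_vector_derivative_scaleR has_vector_derivative_const DERIV_ident
        bounded_linear.has_vector_derivative[OF bounded_linear_scaleR_right] pulse_sum_deriv[OF osc_mode_norms(2) t])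
  then show "((\<lambda>t. H10_to_Hm1 (rough_sol e t)) has_vector_derivative L2_to_Hm1 (rough_sol_rate e t)) (at t within {0..1})"
    unfolding eq rough_sol_rate_Hm1 by simp
qed

text \<open>
  The flux of the solution is \<open>t cos x\<close> plus the time derivative of the potential of its oscillating
  part, by the choice of the coefficient.
\<close>

lemma opA_rough_sol:
  assumes e: "0 \<le> e" "e \<le> 1 / 2048" and t: "t \<in> {0..1}"
  shows "opA (\<lambda>x. 1 + coef_pert e t x) (rough_sol e t) = L2_to_Hm1 (t *\<^sub>R Rep_H10 ground_mode - e *\<^sub>R rough_rate t)"
proof -
  note eb = coef_ess_bounded(2)[OF e, of t]
  let ?slope = "\<lambda>x. complex_of_real (t * cos x + e * slope_osc t x)"
  let ?flux = "\<lambda>x. complex_of_real (t * cos x + e * flux_osc t x)"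
  have sc: "square_integrable (\<lambda>x. of_real (osc_cos n x / (2 * pi * freq n)))" for n
    using osc_square_integrable(2)[of "1 / (2 * pi * freq n)" n] by simp
  have slope: "square_integrable (\<lambda>x. of_real (slope_osc t x))"
    "pulse_sum cos_pulse (\<lambda>n. L2_of (\<lambda>x. of_real (osc_cos n x / (2 * pi * freq n)))) t
      = L2_of (\<lambda>x. of_real (slope_osc t x))"
    unfolding slope_osc_def by (rule pulse_sum_L2_of[OF pulse_family_cos sc])+
  have flux: "square_integrable (\<lambda>x. of_real (flux_osc t x))"
    "pulse_sum sin_pulse (\<lambda>n. L2_of (\<lambda>x. of_real (osc_pot n x))) t
      = L2_of (\<lambda>x. of_real (flux_osc t x))"
    unfolding flux_osc_def by (rule pulse_sum_L2_of[OF pulse_family_sin osc_square_integrable(5)])+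
  have Dm: "(1 / (2 * pi * (freq n)\<^sup>2)) *\<^sub>R Dx (osc_mode n) = L2_of (\<lambda>x. of_real (osc_cos n x / (2 * pi * freq n)))" for n
    using L2_of_ops(3)[OF osc_square_integrable(4) osc_square_integrable(4), of "1 / (2 * pi * freq n)" n]
    by (simp add: osc_mode power2_eq_square scaleR_conv_of_real field_simps)
  have "Dx (rough_sol e t) = t *\<^sub>R L2_of (\<lambda>x. of_real (cos x)) + e *\<^sub>R L2_of (\<lambda>x. of_real (slope_osc t x))"
    unfolding rough_sol_def Dx_ops(2,5) pulse_sum_linear[OF pulse_family_cos linear_maps(3)] Dm ground_mode slope(2) ..
  also have "\<dots> = L2_of ?slope" by (rule L2_of_lincomb(2)[OF ground_mode(4) slope(1), symmetric])
  finally have D: "AE x in Om. rep_L2 (Dx (rough_sol e t)) x = ?slope x"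
    using rep_L2_of[OF L2_of_lincomb(1)[OF ground_mode(4) slope(1), of t e]] by simp
  have key: "(1 + coef_pert e t x) * (t * cos x + e * slope_osc t x) = t * cos x + e * flux_osc t x" if x: "0 < x" for x
  proof (cases "1 / 2 < t \<and> x < pi / 4")
    case True
    define Q where "Q = t * cos x + e * slope_osc t x"
    have "1 / 8 \<le> Q" unfolding Q_def using slope_lower_bound[OF e x, of t] True by simp
    moreover have "coef_pert e t x = e * (flux_osc t x - slope_osc t x) / Q"
      unfolding coef_pert_def Q_def using True by simp
    ultimately have "(1 + coef_pert e t x) * Q = Q + e * (flux_osc t x - slope_osc t x)" by (simp add: field_simps)
    then show ?thesis by (simp add: Q_def algebra_simps)
  next
    case False
    then have "t \<le> 1 / 2 \<or> pi / 4 \<le> x" by auto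
    then have "flux_osc t x = 0" "slope_osc t x = 0" "coef_pert e t x = 0"
      using osc_zero coef_pert_zero by blast+
    then show ?thesis by simp
  qed
  have fl: "square_integrable ?flux" by (rule L2_of_lincomb(1)[OF ground_mode(4) flux(1)])
  have "AE x in Om. 0 < x" by (intro AE_I2) simp
  with D have "AE x in Om. complex_of_real (1 + coef_pert e t x) * rep_L2 (Dx (rough_sol e t)) x = ?flux x"
  proof eventually_elim
    case (elim x)
    show ?case unfolding elim(1) of_real_mult[symmetric] key[OF elim(2)] ..
  qed
  then have "L2_of (\<lambda>x. of_real (1 + coef_pert e t x) * rep_L2 (Dx (rough_sol e t)) x) = L2_of ?flux"
    using L2_of_eq_iff[OF opA_eq_neg_div(1)[OF eb] fl] by blast
  then have "opA (\<lambda>x. 1 + coef_pert e t x) (rough_sol e t) = neg_div (L2_of ?flux)"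
    unfolding opA_eq_neg_div(2)[OF eb] by simp
  also have "L2_of ?flux = t *\<^sub>R Dx ground_mode + e *\<^sub>R pulse_sum sin_pulse (\<lambda>n. L2_of (\<lambda>x. of_real (osc_pot n x))) t"
    unfolding L2_of_lincomb(2)[OF ground_mode(4) flux(1)] ground_mode flux(2) ..
  also have "neg_div \<dots> = t *\<^sub>R H10_to_Hm1 ground_mode + e *\<^sub>R pulse_sum sin_pulse (\<lambda>n. neg_div (L2_of (\<lambda>x. of_real (osc_pot n x)))) t"
    by (simp add: linear_add[OF linear_maps(4)] linear_scale[OF linear_maps(4)]
        pulse_sum_linear[OF pulse_family_sin linear_maps(4)] ground_mode(5))
  also have "pulse_sum sin_pulse (\<lambda>n. neg_div (L2_of (\<lambda>x. of_real (osc_pot n x)))) t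
      = - pulse_sum sin_pulse (\<lambda>n. H10_to_Hm1 (osc_mode n)) t"
  proof -
    have "linear (uminus :: Hm1 \<Rightarrow> Hm1)" by (rule bounded_linear.linear) (intro bounded_linear_minus bounded_linear_ident)
    then show ?thesis
      by (simp only: pulse_sum_linear[OF pulse_family_sin] L2_to_Hm1_osc_mode minus_minus)
  qed
  also have "t *\<^sub>R H10_to_Hm1 ground_mode + e *\<^sub>R - pulse_sum sin_pulse (\<lambda>n. H10_to_Hm1 (osc_mode n)) t
      = L2_to_Hm1 (t *\<^sub>R Rep_H10 ground_mode - e *\<^sub>R rough_rate t)"
    unfolding rough_rate_def
    by (simp add: linear_diff[OF linear_maps(2)] linear_scale[OF linear_maps(2)]
        pulse_sum_linear[OF pulse_family_sin linear_maps(2)])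
  finally show ?thesis .
qed

lemma bochner_Lp_continuous:
  fixes u :: "real \<Rightarrow> 'a::{banach, second_countable_topology}"
  assumes u: "continuous_on {0..1} u"
  shows "bochner_Lp p u"
  unfolding bochner_Lp_def
proof
  interpret finite_measure I01 by (rule finite_measure_lebesgue_on) simp
  show m: "u \<in> borel_measurable I01"
    by (rule continuous_imp_measurable_on_sets_lebesgue[OF continuous_on_subset[OF u]]) auto
  have "compact ((\<lambda>t. norm (u t) ^ p) ` {0..1})"
    by (intro compact_continuous_image continuous_intros u) auto
  then obtain B where B: "\<And>t. t \<in> {0..1} \<Longrightarrow> norm (norm (u t) ^ p) \<le> B"
    using compact_imp_bounded bounded_iff by (metis image_eqI)
  show "integrable I01 (\<lambda>t. norm (u t) ^ p)"
    by (rule integrable_const_bound[where B = B]) (use B m in \<open>auto intro!: AE_I2\<close>)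
qed

lemma bochner_L1_iff: "bochner_Lp 1 u \<longleftrightarrow> integrable I01 u"
  by (auto simp: bochner_Lp_def integrable_iff_bounded)

text \<open>
  Tested against an element of \<open>V\<close>, both sides become scalar integrals, to which the fundamental theorem
  applies.
\<close>

lemma weak_deriv_C1_Hm1:
  fixes u u' :: "real \<Rightarrow> Hm1"
  assumes C1: "C1_with_deriv u u'"
  shows "weak_deriv 0 1 u u'"
  unfolding weak_deriv_def
proof (intro allI impI)
  fix \<phi> :: "real \<Rightarrow> real" assume \<phi>: "test_function 0 1 \<phi>"
  have d: "(u has_vector_derivative u' t) (at t within {0..1})" if "t \<in> {0..1}" for t
    using C1 that by (simp add: C1_with_deriv_def)
  have cu': "continuous_on {0..1} u'" using C1 by (simp add: C1_with_deriv_def)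
  have cu: "continuous_on {0..1} u"
    using d by (meson continuous_on_eq_continuous_within has_vector_derivative_continuous)
  note i = bochner_Lp_continuous[OF cu, of 1, unfolded bochner_L1_iff]
    and i' = bochner_Lp_continuous[OF cu', of 1, unfolded bochner_L1_iff]
  show "(\<integral>t. vderiv \<phi> t *\<^sub>R u t \<partial>I01) = - (\<integral>t. \<phi> t *\<^sub>R u' t \<partial>I01)"
  proof (rule Hm1_eqI)
    fix w
    have bl: "bounded_linear (\<lambda>l. dual_pair l w)"
      by (rule bounded_linear_intro[where K = "norm w"]) (auto simp: dual_pair_ops dual_pair_bound)
    have "weak_deriv 0 1 (\<lambda>t. dual_pair (u t) w) (\<lambda>t. dual_pair (u' t) w)"
    proof (rule weak_deriv_piecewise[where K = "{}"])
      show "continuous_on {0..1} (\<lambda>t. dual_pair (u t) w)"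
        by (rule bounded_linear.continuous_on[OF bl cu])
      show "((\<lambda>t. dual_pair (u t) w) has_vector_derivative dual_pair (u' t) w) (at t)" if "t \<in> {0<..<1} - {}" for t
        using bounded_linear.has_vector_derivative[OF bl d[of t]] that at_within_Icc_at[of 0 t 1] by simp
      show "integrable I01 (\<lambda>t. dual_pair (u' t) w)" by (rule integrable_bounded_linear[OF bl i'])
    qed auto
    then have "(\<integral>t. vderiv \<phi> t *\<^sub>R dual_pair (u t) w \<partial>I01) = - (\<integral>t. \<phi> t *\<^sub>R dual_pair (u' t) w \<partial>I01)"
      using \<phi> by (simp add: weak_deriv_def)
    then show "dual_pair (\<integral>t. vderiv \<phi> t *\<^sub>R u t \<partial>I01) w = dual_pair (- (\<integral>t. \<phi> t *\<^sub>R u' t \<partial>I01)) w"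
      using integral_bounded_linear[OF bl integrable_test_scaleR[OF test_function_vderiv[OF \<phi>] i]]
        integral_bounded_linear[OF bl integrable_test_scaleR[OF \<phi> i']]
        dual_pair_ops(2)[of 0 "\<integral>t. \<phi> t *\<^sub>R u' t \<partial>I01" w]
      by (simp add: dual_pair_ops)
  qed
qed

text \<open>
  The embedding of \<open>H\<close> into \<open>V'\<close> is injective and commutes with the integral.
\<close>

lemma weak_deriv_L2_of_Hm1:
  assumes w: "weak_deriv 0 1 (\<lambda>t. L2_to_Hm1 (u t)) (\<lambda>t. L2_to_Hm1 (g t))"
    and u: "integrable I01 u" and g: "integrable I01 g"
  shows "weak_deriv 0 1 u g"
  unfolding weak_deriv_def
proof (intro allI impI)
  interpret L: bounded_linear L2_to_Hm1 by (rule bounded_linear_L2_to_Hm1)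
  fix \<phi> :: "real \<Rightarrow> real" assume \<phi>: "test_function 0 1 \<phi>"
  have "L2_to_Hm1 (\<integral>t. vderiv \<phi> t *\<^sub>R u t \<partial>I01) = L2_to_Hm1 (- (\<integral>t. \<phi> t *\<^sub>R g t \<partial>I01))"
    using integral_bounded_linear[OF bounded_linear_L2_to_Hm1 integrable_test_scaleR[OF test_function_vderiv[OF \<phi>] u]]
      integral_bounded_linear[OF bounded_linear_L2_to_Hm1 integrable_test_scaleR[OF \<phi> g]] w \<phi>
    by (simp add: L.scaleR L.neg weak_deriv_def)
  then show "(\<integral>t. vderiv \<phi> t *\<^sub>R u t \<partial>I01) = - (\<integral>t. \<phi> t *\<^sub>R g t \<partial>I01)"
    by (rule injD[OF inj_L2_to_Hm1])
qed

lemma not_bochner_L2_affine_rough_rate: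
  assumes c: "continuous_on {0..1} c" and e: "e \<noteq> 0"
  shows "\<not> bochner_Lp 2 (\<lambda>t. c t + e *\<^sub>R rough_rate t)"
proof
  assume "bochner_Lp 2 (\<lambda>t. c t + e *\<^sub>R rough_rate t)"
  then have "bochner_Lp 2 (\<lambda>t. (c t + e *\<^sub>R rough_rate t) - c t)"
    by (rule bochner_L2_diff) (rule bochner_Lp_continuous[OF c])
  then have "integrable I01 (\<lambda>t. e\<^sup>2 * (norm (rough_rate t))\<^sup>2)" by (simp add: bochner_Lp_def power_mult_distrib)
  then have "integrable I01 (\<lambda>t. (1 / e\<^sup>2) * (e\<^sup>2 * (norm (rough_rate t))\<^sup>2))" by (rule integrable_mult_right)
  then show False using e not_bochner_L2_rough_rate by simp
qed

theorem theorem1p1: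
  fixes \<delta> :: real
  assumes "\<delta> > 0"
  shows "\<exists>a :: real \<Rightarrow> real \<Rightarrow> real.
    elliptic_coefficient a \<and>
    holder_coefficient (1/2) a \<and>
    holder_norm 1 (1/2) (\<lambda>t. Linf_of (\<lambda>x. a t x - 1)) < ereal \<delta> \<and>
    (\<forall>\<alpha>. 1/2 < \<alpha> \<and> \<alpha> < 1 \<longrightarrow> \<not> holder_coefficient \<alpha> a) \<and>
    (\<exists>(f :: real \<Rightarrow> L2) (u :: real \<Rightarrow> H10) (u' :: real \<Rightarrow> Hm1).
      (\<forall>t\<in>{0..1}. real_valued (f t)) \<and> continuous_on {0..1} f \<and> bochner_Lp 2 f \<and>
      (\<forall>t\<in>{0..1}. real_valued (H10_to_L2 (u t))) \<and>
      continuous_on {0..1} u \<and>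
      C1_with_deriv (\<lambda>t. H10_to_Hm1 (u t)) u' \<and>
      sobolev_W1 1 (\<lambda>t. H10_to_L2 (u t)) \<and>
      u 0 = 0 \<and>
      (\<forall>t\<in>{0..1}. u' t + opA (a t) (u t) = L2_to_Hm1 (f t)) \<and>
      lions_solution a (\<lambda>t. L2_to_Hm1 (f t)) 0 u \<and>
      (\<forall>w. lions_solution a (\<lambda>t. L2_to_Hm1 (f t)) 0 w \<longrightarrow> (AE t in I01. w t = u t)) \<and>
      (\<forall>t\<in>{0..1}. u t \<in> dom_AH (a t)) \<and>
      bochner_Lp 1 (\<lambda>t. AH (a t) (u t)) \<and>
      \<not> bochner_Lp 2 (\<lambda>t. AH (a t) (u t)) \<and>
      \<not> deriv_in_Lp 2 (\<lambda>t. H10_to_L2 (u t))) \<and>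
    \<not> maximal_L2_regularity a"
proof -
  \<comment> \<open>The first bound keeps the slope positive, the second beats the constant in \<open>coef_holder_norm\<close>.\<close>
  define e where "e = min (1 / 2048) (\<delta> / 20000)"
  have e: "0 < e" "e \<le> 1 / 2048" "13824 * e < \<delta>"
    using assms by (auto simp: e_def min_def field_simps)
  have e0: "0 \<le> e" using e by simp
  define a where "a t x = 1 + coef_pert e t x" for t x
  define f where "f t = (1 + t) *\<^sub>R Rep_H10 ground_mode" for t
  define u where "u = rough_sol e"
  define g where "g = rough_sol_rate e"
  define Au where "Au t = t *\<^sub>R Rep_H10 ground_mode - e *\<^sub>R rough_rate t" for t
  have ell: "elliptic_coefficient a" unfolding a_def[abs_def] by (rule coef_elliptic[OF e0 e(2)])
  have hc: "holder_coefficient (1/2) a" unfolding a_def[abs_def] by (rule coef_holder_norm(2)[OF e0 e(2)])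
  have hn: "holder_norm 1 (1/2) (\<lambda>t. Linf_of (\<lambda>x. a t x - 1)) < ereal \<delta>"
    unfolding a_def using e(3) by (intro le_less_trans[OF coef_holder_norm(1)[OF e0 e(2)]]) simp
  have nh: "\<not> holder_coefficient \<alpha> a" if "1/2 < \<alpha> \<and> \<alpha> < 1" for \<alpha>
    unfolding a_def[abs_def] using that by (intro coef_not_holder[OF e(1,2)]) simp
  have fc: "continuous_on {0..1} f" unfolding f_def[abs_def] by (intro continuous_intros)
  have fr: "real_valued (f t)" for t
    using real_valued_L2_of[OF L2_of_lincomb(1)[OF ground_mode(3) ground_mode(3), of "1 + t" 0]]
      L2_of_lincomb(2)[OF ground_mode(3) ground_mode(3), of "1 + t" 0]
    by (simp add: f_def ground_mode(1))
  have uc: "continuous_on {0..1} u" unfolding u_def by (rule rough_sol_continuous)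
  have ur: "real_valued (H10_to_L2 (u t))" for t
  proof -
    have s: "square_integrable (\<lambda>x. of_real (1 / (2 * pi * (freq n)\<^sup>2) * osc_sin n x))" for n
      by (rule osc_square_integrable(1))
    have "Rep_H10 ((1 / (2 * pi * (freq n)\<^sup>2)) *\<^sub>R osc_mode n) = L2_of (\<lambda>x. of_real (1 / (2 * pi * (freq n)\<^sup>2) * osc_sin n x))" for n
      using L2_of_ops(3)[OF osc_square_integrable(3) osc_square_integrable(3), of "1 / (2 * pi * (freq n)\<^sup>2)" n]
      by (simp add: linear_scale[OF linear_maps(1)] osc_mode scaleR_conv_of_real)
    then have "H10_to_L2 (u t) = t *\<^sub>R L2_of (\<lambda>x. of_real (sin x))
      + e *\<^sub>R L2_of (\<lambda>x. of_real (pulse_sum cos_pulse (\<lambda>n. 1 / (2 * pi * (freq n)\<^sup>2) * osc_sin n x) t))"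
      unfolding u_def rough_sol_def linear_add[OF linear_maps(1)] linear_scale[OF linear_maps(1)]
        pulse_sum_linear[OF pulse_family_cos linear_maps(1)] ground_mode pulse_sum_L2_of(2)[OF pulse_family_cos s, symmetric]
      by simp
    then show ?thesis
      using real_valued_L2_of[OF L2_of_lincomb(1)[OF ground_mode(3) pulse_sum_L2_of(1)[OF pulse_family_cos s]]]
        L2_of_lincomb(2)[OF ground_mode(3) pulse_sum_L2_of(1)[OF pulse_family_cos s]] by simp
  qed
  have C1: "C1_with_deriv (\<lambda>t. H10_to_Hm1 (u t)) (\<lambda>t. L2_to_Hm1 (g t))"
    unfolding u_def g_def by (rule rough_sol_C1)
  then have gc: "continuous_on {0..1} (\<lambda>t. L2_to_Hm1 (g t))" by (simp add: C1_with_deriv_def)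
  have u0: "u 0 = 0" by (simp add: u_def rough_sol_def pulse_sum_zero[OF pulse_family_cos])
  have opA_u: "opA (a t) (u t) = L2_to_Hm1 (Au t)" if "t \<in> {0..1}" for t
    unfolding a_def[abs_def] u_def Au_def by (rule opA_rough_sol[OF e0 e(2) that])
  have eq: "L2_to_Hm1 (g t) + opA (a t) (u t) = L2_to_Hm1 (f t)" if "t \<in> {0..1}" for t
    unfolding opA_u[OF that] linear_add[OF linear_maps(2), symmetric]
    by (simp add: g_def rough_sol_rate_def Au_def f_def scaleR_add_left)
  have dom: "u t \<in> dom_AH (a t)" "AH (a t) (u t) = Au t" if "t \<in> {0..1}" for t
    using opA_u[OF that] AH_eq[of "Au t" "a t" "u t"] by (auto simp: dom_AH_def intro!: exI[of _ "Au t"])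
  have cH: "continuous_on {0..1} (\<lambda>t. H10_to_L2 (u t))"
    by (rule bounded_linear.continuous_on[OF bounded_linear_Rep_H10 uc])
  have wd: "weak_deriv 0 1 (\<lambda>t. H10_to_Hm1 (u t)) (\<lambda>t. L2_to_Hm1 (g t))" by (rule weak_deriv_C1_Hm1[OF C1])
  have lions: "lions_solution a (\<lambda>t. L2_to_Hm1 (f t)) 0 u"
    unfolding lions_solution_def
  proof (intro conjI exI)
    show "bochner_Lp 2 u" "bochner_Lp 2 (\<lambda>t. L2_to_Hm1 (g t))"
      by (rule bochner_Lp_continuous uc gc)+
    show "AE t in I01. L2_to_Hm1 (g t) + opA (a t) (u t) = L2_to_Hm1 (f t)" using eq by (intro AE_I2) auto
    show "H10_to_L2 (u 0) = 0" by (simp add: u0 linear_0[OF linear_maps(1)])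
  qed (use wd cH in auto)
  have irr: "integrable I01 rough_rate" using bochner_L1_rough_rate unfolding bochner_L1_iff .
  have igm: "integrable I01 (\<lambda>t. c t *\<^sub>R Rep_H10 ground_mode)" if "continuous_on {0..1} c" for c :: "real \<Rightarrow> real"
  proof -
    have "continuous_on {0..1} (\<lambda>t. c t *\<^sub>R Rep_H10 ground_mode)" by (intro continuous_intros that)
    then show ?thesis using bochner_Lp_continuous[where p = 1] unfolding bochner_L1_iff by blast
  qed
  have ig: "integrable I01 g"
    unfolding g_def rough_sol_rate_def[abs_def] using igm[of "\<lambda>t. 1"] irr by simp
  have iu: "integrable I01 (\<lambda>t. H10_to_L2 (u t))"
    using bochner_Lp_continuous[OF cH, of 1] unfolding bochner_L1_iff .
  have wdH: "weak_deriv 0 1 (\<lambda>t. H10_to_L2 (u t)) g" by (rule weak_deriv_L2_of_Hm1[OF wd iu ig])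
  have sob: "sobolev_W1 1 (\<lambda>t. H10_to_L2 (u t))"
    unfolding sobolev_W1_def deriv_in_Lp_def bochner_L1_iff using iu ig wdH by blast
  have AHeq: "AE t in I01. AH (a t) (u t) = Au t" using dom(2) by (intro AE_I2) auto
  have mAH: "(\<lambda>t. AH (a t) (u t)) \<in> borel_measurable I01 \<longleftrightarrow> Au \<in> borel_measurable I01"
    by (rule measurable_cong) (auto intro: dom(2))
  have AHp: "bochner_Lp p (\<lambda>t. AH (a t) (u t)) \<longleftrightarrow> bochner_Lp p Au" for p
    unfolding bochner_Lp_def mAH
    by (intro conj_cong refl Bochner_Integration.integrable_cong) (auto simp: dom(2))
  have iA: "bochner_Lp 1 Au"
    unfolding bochner_L1_iff Au_def[abs_def] using igm[of "\<lambda>t. t"] irr by (auto intro: continuous_intros)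
  have nA: "\<not> bochner_Lp 2 Au"
  proof -
    have "continuous_on {0..1} (\<lambda>t. t *\<^sub>R Rep_H10 ground_mode)" by (intro continuous_intros)
    from not_bochner_L2_affine_rough_rate[OF this, of "- e"] show ?thesis
      using e(1) by (simp add: Au_def[abs_def])
  qed
  have nd: "\<not> deriv_in_Lp 2 (\<lambda>t. H10_to_L2 (u t))"
  proof
    assume "deriv_in_Lp 2 (\<lambda>t. H10_to_L2 (u t))"
    then obtain h where h: "bochner_Lp 2 h" "weak_deriv 0 1 (\<lambda>t. H10_to_L2 (u t)) h"
      by (auto simp: deriv_in_Lp_def)
    have gh: "AE t in I01. h t = g t"
      by (rule weak_deriv_unique[OF h(2) wdH bochner_L2_imp_L1[OF h(1)] ig])
    have mg: "g \<in> borel_measurable I01" using ig by simp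
    have "integrable I01 (\<lambda>t. norm (g t) ^ 2)"
    proof (rule integrable_cong_AE_imp)
      show "integrable I01 (\<lambda>t. norm (h t) ^ 2)" using h(1) by (simp add: bochner_Lp_def)
      show "AE t in I01. norm (h t) ^ 2 = norm (g t) ^ 2" using gh by eventually_elim simp
    qed (use mg in measurable)
    then have "bochner_Lp 2 g" using mg by (simp add: bochner_Lp_def)
    then show False
      using not_bochner_L2_affine_rough_rate[of "\<lambda>t. Rep_H10 ground_mode" e] e(1)
      by (simp add: g_def rough_sol_rate_def[abs_def])
  qed
  have uniq: "AE t in I01. w t = u t" if "lions_solution a (\<lambda>t. L2_to_Hm1 (f t)) 0 w" for w
  proof (rule lions_solution_unique[OF _ _ _ that lions])
    show "ess_bounded (a t)" for t unfolding a_def[abs_def] by (rule coef_ess_bounded(2)[OF e0 e(2)])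
    show "AE x in Om. 1 / 2 \<le> a t x" for t
    proof (rule AE_I2)
      fix x assume "x \<in> space Om"
      then have "\<bar>coef_pert e t x\<bar> \<le> 768 * e" by (intro coef_pert_bound[OF e0 e(2)]) simp
      then show "1 / 2 \<le> a t x" unfolding a_def using e(2) by linarith
    qed
  qed simp
  have nm: "\<not> maximal_L2_regularity a"
    unfolding maximal_L2_regularity_def using bochner_Lp_continuous[OF fc, of 2] lions nd by blast
  have f2: "bochner_Lp 2 f" by (rule bochner_Lp_continuous[OF fc])
  have AH: "bochner_Lp 1 (\<lambda>t. AH (a t) (u t))" "\<not> bochner_Lp 2 (\<lambda>t. AH (a t) (u t))"
    using iA nA unfolding AHp by blast+
  show ?thesis
    by (intro exI[of _ a] exI[of _ f] exI[of _ u] exI[of _ "\<lambda>t. L2_to_Hm1 (g t)"] conjI ballI allI impI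
        ell hc hn nm fr fc f2 ur uc C1 sob u0 eq lions uniq dom(1) AH nd nh) simp_all
qed

end
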